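(* Let $V$ be an $n\times n$ matrix-valued function on $\mathbb{R}$ with $V(x)^\dagger=V(x)$ a.e. Let $\{ik_j\}_{j=1}^N$ ($0<k_1<\dots<k_N$, $N\ge0$) be the zeros of $\det A(k)$ on the positive imaginary axis, with $A(k)$ as defined in the context. Assume $$\sum_{1\le l,s\le n}\int_{-\infty}^\infty |V_{ls}(x)|e^{2\gamma |x|}\,dx<\infty$$ for some $\gamma>0$ with $\gamma>k_j$ for all $j$. Then the scattering matrix $$\begin{bmatrix} T_+(k) & S_+(k)\\ S_-(k) & T_-(k)\end{bmatrix},\quad k\in\mathbb{R}\setminus\{0\},$$ uniquely determines the potential $V$ (i.e., two such self-adjoint potentials satisfying these assumptions with the same scattering matrix coincide a.e.).
   Context: Consider $-\Psi''+V(x)\Psi=k^2\Psi$ on $\mathbb{R}$. For $\operatorname{Im}k\ge0$, the Jost solutions $f_\pm(k,x)$ are the $n\times n$ matrix solutions of $$f_+(k,x)=e^{ikx}I_n+\int_x^\infty\frac{\sin k(t-x)}{k}V(t)f_+(k,t)\,dt,\qquad f_-(k,x)=e^{-ikx}I_n+\int_{-\infty}^x\frac{\sin k(x-t)}{k}V(t)f_-(k,t)\,dt.$$ For matrix functions $F,G$ the Wronskian is $[F;G]=FG'-F'G$ (independent of $x$ in the cases below). Define $A(k)=\frac{1}{2ik}[f_-(-\bar k,x)^\dagger;f_+(k,x)]$ for $\operatorname{Im}k\ge0$, $k\ne0$; $B(k)=-\frac{1}{2ik}[f_-(\bar k,x)^\dagger;f_+(k,x)]$ for real $k\neq0$; $C(k)=-B(\bar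 k)^\dagger$, $D(k)=A(-\bar k)^\dagger$. The reflection coefficients are $S_-(k)=B(k)A(k)^{-1}$, $S_+(k)=C(k)D(k)^{-1}$ and the transmission coefficients are $T_+(k)=A(k)^{-1}$, $T_-(k)=D(k)^{-1}$. Here $\dagger$ is conjugate transpose and $\bar k$ complex conjugate. The numbers $-k_j^2$ are the eigenvalues of the operator. *)

theory Defs
  imports "HOL-Analysis.Analysis"
begin

definition madj :: "complex^'n^'n \<Rightarrow> complex^'n^'n" where
  "madj M = (\<chi> i j. cnj (M $ j $ i))"

definition jost_kernel :: "complex \<Rightarrow> real \<Rightarrow> complex" where
  "jost_kernel k s = (if k = 0 then complex_of_real s else sin (k * complex_of_real s) / k)"

text \<open>f solves the Volterra equation of the right Jost solution f_+ (in the class where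
  e^{-ikx} f(x) is bounded on [0,oo), in which the solution is unique).\<close>
definition is_jost_plus :: "(real \<Rightarrow> complex^'n^'n) \<Rightarrow> complex \<Rightarrow> (real \<Rightarrow> complex^'n^'n) \<Rightarrow> bool" where
  "is_jost_plus V k f \<longleftrightarrow>
     (\<forall>x. ((\<lambda>t. mat (jost_kernel k (t - x)) ** V t ** f t)
            has_integral (f x - mat (exp (\<i> * k * complex_of_real x)))) {x..})
   \<and> bounded ((\<lambda>x. mat (exp (- \<i> * k * complex_of_real x)) ** f x) ` {0..})"

definition is_jost_minus :: "(real \<Rightarrow> complex^'n^'n) \<Rightarrow> complex \<Rightarrow> (real \<Rightarrow> complex^'n^'n) \<Rightarrow> bool" where
  "is_jost_minus V k f \<longleftrightarrow>
     (\<forall>x. ((\<lambda>t. mat (jost_kernel k (x - t)) ** V t ** f t)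
            has_integral (f x - mat (exp (- \<i> * k * complex_of_real x)))) {..x})
   \<and> bounded ((\<lambda>x. mat (exp (\<i> * k * complex_of_real x)) ** f x) ` {..0})"

definition jost_plus :: "(real \<Rightarrow> complex^'n^'n) \<Rightarrow> complex \<Rightarrow> real \<Rightarrow> complex^'n^'n" where
  "jost_plus V k = (THE f. is_jost_plus V k f)"

definition jost_minus :: "(real \<Rightarrow> complex^'n^'n) \<Rightarrow> complex \<Rightarrow> real \<Rightarrow> complex^'n^'n" where
  "jost_minus V k = (THE f. is_jost_minus V k f)"

definition wronsk :: "(real \<Rightarrow> complex^'n^'n) \<Rightarrow> (real \<Rightarrow> complex^'n^'n) \<Rightarrow> real \<Rightarrow> complex^'n^'n" where
  "wronsk F G x = F x ** vector_derivative G (at x) - vector_derivative F (at x) ** G x"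

text \<open>The Wronskians are independent of x; we evaluate them at x = 0.\<close>
definition coefA :: "(real \<Rightarrow> complex^'n^'n) \<Rightarrow> complex \<Rightarrow> complex^'n^'n" where
  "coefA V k = mat (1 / (2 * \<i> * k)) **
     wronsk (\<lambda>x. madj (jost_minus V (- cnj k) x)) (jost_plus V k) 0"

definition coefB :: "(real \<Rightarrow> complex^'n^'n) \<Rightarrow> complex \<Rightarrow> complex^'n^'n" where
  "coefB V k = mat (- 1 / (2 * \<i> * k)) **
     wronsk (\<lambda>x. madj (jost_minus V (cnj k) x)) (jost_plus V k) 0"

definition coefC :: "(real \<Rightarrow> complex^'n^'n) \<Rightarrow> complex \<Rightarrow> complex^'n^'n" where
  "coefC V k = - madj (coefB V (cnj k))"

definition coefD :: "(real \<Rightarrow> complex^'n^'n) \<Rightarrow> complex \<Rightarrow> complex^'n^'n" where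
  "coefD V k = madj (coefA V (- cnj k))"

definition refl_minus :: "(real \<Rightarrow> complex^'n^'n) \<Rightarrow> complex \<Rightarrow> complex^'n^'n" where
  "refl_minus V k = coefB V k ** matrix_inv (coefA V k)"

definition refl_plus :: "(real \<Rightarrow> complex^'n^'n) \<Rightarrow> complex \<Rightarrow> complex^'n^'n" where
  "refl_plus V k = coefC V k ** matrix_inv (coefD V k)"

definition trans_plus :: "(real \<Rightarrow> complex^'n^'n) \<Rightarrow> complex \<Rightarrow> complex^'n^'n" where
  "trans_plus V k = matrix_inv (coefA V k)"

definition trans_minus :: "(real \<Rightarrow> complex^'n^'n) \<Rightarrow> complex \<Rightarrow> complex^'n^'n" where
  "trans_minus V k = matrix_inv (coefD V k)"

definition admissible_potential :: "(real \<Rightarrow> complex^'n^'n) \<Rightarrow> bool" where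
  "admissible_potential V \<longleftrightarrow>
     (AE x in lebesgue. madj (V x) = V x) \<and>
     (\<exists>\<gamma>::real. \<gamma> > 0 \<and>
        (\<forall>l s. integrable lebesgue (\<lambda>x. exp (2 * \<gamma> * \<bar>x\<bar>) *\<^sub>R (V x $ l $ s))) \<and>
        (\<forall>\<kappa>::real. \<kappa> > 0 \<and> det (coefA V (\<i> * complex_of_real \<kappa>)) = 0 \<longrightarrow> \<kappa> < \<gamma>))"

end

(* Write f_+(k) = e^{ikx} m_+(k) and f_-(k) = e^{-ikx} m_-(k), k' for the conjugate of k and M^H for
   the adjoint of M. For two potentials with the same scattering data consider the mixed Green
   function m_+^1(k) A(k)^{-1} m_-^2(-k')^H and subtract the adjoint, at -k', of the same function with
   the potentials exchanged; call the difference H(k). On the real axis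
   f_+(k) A(k)^{-1} = f_-(-k) + f_-(k) S_-(k) and S_-(-k)^H = S_-(k), so S_- cancels and
   H(k) = m_-^1(-k) m_-^2(-k')^H - m_-^1(k) m_-^2(k')^H. The right-hand side is odd, and by the
   exponential decay of the potentials it is holomorphic in the strip |Im k| < gamma, which contains
   all poles of A^{-1} in the upper half-plane. Hence H extends to a bounded odd entire function and
   vanishes by Liouville's theorem. The term of order 1/kappa of H(i kappa) = 0 shows that the
   integrals of V_1 - V_2 over (x, oo) and (-oo, x) differ by a constant that does not depend on x,
   so V_1 = V_2. *)
theory Submission
  imports Defs "HOL-Complex_Analysis.Complex_Analysis"
begin

unbundle no fps_syntax

section \<open>Complex matrices\<close>

text \<open>The pole-free right-hand side is what makes the argument work: neither bound states nor
  a singularity of A^{-1} at k = 0 call for a residue or norming-constant analysis. In the strip the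
  two sides agree off a countable set, and the right-hand side supplies the remaining values. Two
  facts feed this. Poles of A^{-1} off the imaginary axis are excluded by self-adjointness: they
  would produce eigenfunctions decaying in both directions for a non-real k^2. And m_-(k), m_-(-k)
  both continue across the real axis because the Volterra kernel (e^{2iks} - 1)/(2ik) grows at most
  like e^{2 gamma s} for Im k > -gamma, which the weight e^{2 gamma |x|} absorbs. Equality of the
  transmission coefficients enters as A_1 = A_2: the mixed Green functions share the factor A^{-1},
  hence their poles, and their leading terms at k = i kappa do not depend on x. Since V is only
  integrable, the derivative of a Jost solution is merely absolutely continuous; the differential
  equation is therefore handled through integrals, and V is recovered from its integrals over
  intervals.\<close>

definition cscale :: "complex \<Rightarrow> complex^'n^'m \<Rightarrow> complex^'n^'m" (infixr "\<odot>" 75) where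
  "c \<odot> M = (\<chi> i j. c * M $ i $ j)"

lemma cscale_nth [simp]: "(c \<odot> M) $ i $ j = c * M $ i $ j"
  by (simp add: cscale_def)

lemma madj_nth [simp]: "madj M $ i $ j = cnj (M $ j $ i)"
  by (simp add: madj_def)

lemma norm_matrix_le: "norm (A $ i $ j) \<le> norm (A :: complex^'n^'m)"
  by (meson Finite_Cartesian_Product.norm_nth_le order_trans)

text \<open>The norm of the matrix type is the Frobenius norm, so this is the Cauchy-Schwarz
  inequality for each entry, summed. In this norm \<open>mat 1\<close> has norm sqrt n, which is why
  factors \<open>norm (mat 1)\<close> run through the later bounds.\<close>

lemma norm_matrix_mult_le:
  fixes A :: "complex^'n^'m" and B :: "complex^'p^'n"
  shows "norm (A ** B) \<le> norm A * norm B"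
proof -
  have sq: "(norm M)\<^sup>2 = (\<Sum>i\<in>UNIV. \<Sum>j\<in>UNIV. (cmod (M $ i $ j))\<^sup>2)" for M :: "complex^'q^'r"
    unfolding norm_vec_def L2_set_def
    by (simp add: real_sqrt_pow2 sum_nonneg)
  have entry: "(cmod ((A ** B) $ i $ j))\<^sup>2
      \<le> (\<Sum>k\<in>UNIV. (cmod (A $ i $ k))\<^sup>2) * (\<Sum>k\<in>UNIV. (cmod (B $ k $ j))\<^sup>2)" for i j
  proof -
    have "cmod ((A ** B) $ i $ j) \<le> (\<Sum>k\<in>UNIV. \<bar>cmod (A $ i $ k)\<bar> * \<bar>cmod (B $ k $ j)\<bar>)"
      unfolding matrix_matrix_mult_def
      by (simp, rule order_trans[OF norm_sum]) (simp add: norm_mult)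
    also have "\<dots> \<le> L2_set (\<lambda>k. cmod (A $ i $ k)) UNIV * L2_set (\<lambda>k. cmod (B $ k $ j)) UNIV"
      by (rule L2_set_mult_ineq)
    finally have "(cmod ((A ** B) $ i $ j))\<^sup>2
        \<le> (L2_set (\<lambda>k. cmod (A $ i $ k)) UNIV * L2_set (\<lambda>k. cmod (B $ k $ j)) UNIV)\<^sup>2"
      by (rule power_mono) simp
    then show ?thesis
      by (simp add: power_mult_distrib L2_set_def sum_nonneg)
  qed
  have "(norm (A ** B))\<^sup>2 \<le> (\<Sum>i\<in>UNIV. \<Sum>j\<in>UNIV.
      (\<Sum>k\<in>UNIV. (cmod (A $ i $ k))\<^sup>2) * (\<Sum>k\<in>UNIV. (cmod (B $ k $ j))\<^sup>2))"
    unfolding sq by (intro sum_mono entry)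
  also have "\<dots> = (\<Sum>i\<in>UNIV. \<Sum>k\<in>UNIV. (cmod (A $ i $ k))\<^sup>2) *
      (\<Sum>j\<in>UNIV. \<Sum>k\<in>UNIV. (cmod (B $ k $ j))\<^sup>2)"
    by (simp add: sum_product)
  also have "(\<Sum>j\<in>UNIV. \<Sum>k\<in>UNIV. (cmod (B $ k $ j))\<^sup>2) = (norm B)\<^sup>2"
    unfolding sq by (rule sum.swap)
  also have "(\<Sum>i\<in>UNIV. \<Sum>k\<in>UNIV. (cmod (A $ i $ k))\<^sup>2) = (norm A)\<^sup>2"
    unfolding sq ..
  finally have "(norm (A ** B))\<^sup>2 \<le> (norm A * norm B)\<^sup>2"
    by (simp add: power_mult_distrib)
  then show ?thesis
    by (rule power2_le_imp_le) simp
qed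

lemma norm_cscale [simp]: "norm (c \<odot> M) = norm c * norm M"
  by (simp add: norm_vec_def norm_mult L2_set_right_distrib)

lemma norm_madj [simp]: "norm (madj M) = norm M" for M :: "complex^'n^'n"
proof -
  have sq: "norm M = sqrt (\<Sum>i\<in>UNIV. \<Sum>j\<in>UNIV. (cmod (M $ i $ j))\<^sup>2)" for M :: "complex^'n^'n"
    unfolding norm_vec_def L2_set_def
    by (simp add: real_sqrt_pow2 sum_nonneg)
  show ?thesis
    unfolding sq by (subst sum.swap) simp
qed

interpretation mm: bounded_bilinear "(**) :: complex^'n^'m \<Rightarrow> complex^'p^'n \<Rightarrow> complex^'p^'m"
proof
  show "\<exists>K. \<forall>(a::complex^'n^'m) (b::complex^'p^'n). norm (a ** b) \<le> norm a * norm b * K"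
    by (rule exI[of _ 1]) (simp add: norm_matrix_mult_le)
  show "r *\<^sub>R a ** b = r *\<^sub>R (a ** b)" "a ** r *\<^sub>R b = r *\<^sub>R (a ** b)"
    for r and a :: "complex^'n^'m" and b :: "complex^'p^'n"
    by (simp_all add: vec_eq_iff matrix_matrix_mult_def scaleR_sum_right)
qed (simp_all add: vec_eq_iff matrix_matrix_mult_def sum.distrib distrib_left distrib_right)

interpretation cs: bounded_bilinear "cscale :: complex \<Rightarrow> complex^'n^'m \<Rightarrow> complex^'n^'m"
proof
  show "\<exists>K. \<forall>(a::complex) (b::complex^'n^'m). norm (a \<odot> b) \<le> norm a * norm b * K"
    by (rule exI[of _ 1]) simp
qed (simp_all add: vec_eq_iff algebra_simps)

lemma bounded_linear_madj: "bounded_linear (madj :: complex^'n^'n \<Rightarrow> complex^'n^'n)"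
proof
  show "\<exists>K. \<forall>x::complex^'n^'n. norm (madj x) \<le> norm x * K"
    by (rule exI[of _ 1]) simp
qed (simp_all add: vec_eq_iff)

text \<open>The Jost equations and the coefficients are stated with scalars in the form
  \<open>mat c ** M\<close>; the simplifier moves them to \<open>cscale\<close>, which is bilinear
  and commutes past matrix products.\<close>

lemma mat_mult_eq_cscale [simp]: "mat c ** M = c \<odot> M" for M :: "complex^'p^'n"
  by (simp add: vec_eq_iff matrix_matrix_mult_def mat_def if_distrib if_distribR
      sum.delta[OF finite] cong: if_cong)

lemma mult_mat_eq_cscale [simp]: "M ** mat c = c \<odot> M" for M :: "complex^'n^'p"
  by (simp add: vec_eq_iff matrix_matrix_mult_def mat_def if_distrib if_distribR
      sum.delta'[OF finite] mult.commute cong: if_cong)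

lemma mat_eq_cscale: "mat c = c \<odot> (mat 1 :: complex^'n^'n)"
  by (simp add: vec_eq_iff mat_def)

lemma cscale_mult_left [simp]: "(c \<odot> A) ** B = c \<odot> (A ** B)"
  for A :: "complex^'n^'m" and B :: "complex^'p^'n"
  by (simp add: vec_eq_iff matrix_matrix_mult_def sum_distrib_left mult.assoc)

lemma cscale_mult_right [simp]: "A ** (c \<odot> B) = c \<odot> (A ** B)"
  for A :: "complex^'n^'m" and B :: "complex^'p^'n"
  by (simp add: vec_eq_iff matrix_matrix_mult_def sum_distrib_left mult_ac)

lemma cscale_cscale [simp]: "c \<odot> d \<odot> A = (c * d) \<odot> A"
  by (simp add: vec_eq_iff)

lemma cscale_one [simp]: "1 \<odot> A = A"
  by (simp add: vec_eq_iff)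

lemma madj_cscale [simp]: "madj (c \<odot> A) = cnj c \<odot> madj A" for A :: "complex^'n^'n"
  by (simp add: vec_eq_iff)

lemma madj_madj [simp]: "madj (madj A) = A" for A :: "complex^'n^'n"
  by (simp add: vec_eq_iff)

lemma madj_mult: "madj (A ** B) = madj B ** madj A" for A B :: "complex^'n^'n"
  by (simp add: vec_eq_iff matrix_matrix_mult_def mult.commute)

lemma madj_mat [simp]: "madj (mat c) = mat (cnj c)"
  by (simp add: vec_eq_iff mat_def)

lemma matrix_inv_right_left:
  fixes A :: "complex^'n^'n"
  assumes "invertible A"
  shows "A ** matrix_inv A = mat 1" "matrix_inv A ** A = mat 1"
  using assms someI_ex[of "\<lambda>B. A ** B = mat 1 \<and> B ** A = mat 1"]
  by (auto simp: invertible_def matrix_inv_def)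

text \<open>A kernel vector is copied into every column of \<open>U\<close>. Testing with square
  matrices keeps the later injectivity arguments inside the algebra of n by n matrices.\<close>

lemma invertible_if_mult_eq_0:
  fixes A :: "complex^'n^'n"
  assumes "\<And>U :: complex^'n^'n. A ** U = 0 \<Longrightarrow> U = 0"
  shows "invertible A"
proof -
  have "x = 0" if "A *v x = 0" for x
  proof -
    define U :: "complex^'n^'n" where "U = (\<chi> i j. x $ i)"
    have "A ** U = 0"
      using that by (simp add: U_def vec_eq_iff matrix_matrix_mult_def matrix_vector_mult_def)
    then have "U = 0" by (rule assms)
    then show "x = 0" by (simp add: U_def vec_eq_iff)
  qed
  then show ?thesis
    by (metis invertible_left_inverse matrix_left_invertible_ker)
qed

lemma borel_measurable_matrix_mult:
  fixes f :: "'a \<Rightarrow> complex^'n^'m" and g :: "'a \<Rightarrow> complex^'p^'n"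
  assumes "f \<in> borel_measurable M" "g \<in> borel_measurable M"
  shows "(\<lambda>x. f x ** g x) \<in> borel_measurable M"
  by (rule borel_measurable_continuous_Pair[OF assms])
     (intro mm.continuous_on continuous_intros)

lemma borel_measurable_cscale:
  fixes f :: "'a \<Rightarrow> complex" and g :: "'a \<Rightarrow> complex^'n^'m"
  assumes "f \<in> borel_measurable M" "g \<in> borel_measurable M"
  shows "(\<lambda>x. f x \<odot> g x) \<in> borel_measurable M"
  by (rule borel_measurable_continuous_Pair[OF assms])
     (intro cs.continuous_on continuous_intros)

lemma borel_measurable_lebesgue_continuous:
  fixes f :: "real \<Rightarrow> 'b::euclidean_space"
  assumes "continuous_on UNIV f"
  shows "f \<in> borel_measurable lebesgue"
  using borel_measurable_continuous_onI[OF assms]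
  by (simp add: measurable_completion)

section \<open>Primitives of locally integrable functions\<close>

text \<open>\<open>u\<close> is locally absolutely continuous with almost everywhere derivative
  \<open>\<phi>\<close>. The integral form is chosen because the second derivative of a Jost
  solution contains \<open>V\<close>, which is merely integrable.\<close>

definition prim :: "(real \<Rightarrow> 'a::euclidean_space) \<Rightarrow> (real \<Rightarrow> 'a) \<Rightarrow> bool" where
  "prim u \<phi> \<longleftrightarrow> (\<forall>a b. a \<le> b \<longrightarrow> \<phi> absolutely_integrable_on {a..b} \<and> integral {a..b} \<phi> = u b - u a)"

lemma primD:
  assumes "prim u \<phi>" "a \<le> b"
  shows "\<phi> absolutely_integrable_on {a..b}" "\<phi> integrable_on {a..b}" "integral {a..b} \<phi> = u b - u a"
  using assms set_lebesgue_integral_eq_integral(1) by (auto simp: prim_def)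

lemma prim_continuous:
  assumes "prim u \<phi>"
  shows "continuous_on S u"
proof -
  have "continuous_on {a..b} u" if "a < b" for a b
  proof -
    have "continuous_on {a..b} (\<lambda>x. u a + integral {a..x} \<phi>)"
      using primD(2)[OF assms, of a b] that
      by (intro continuous_intros indefinite_integral_continuous_1) auto
    then show ?thesis
      by (rule continuous_on_eq) (use primD(3)[OF assms] in auto)
  qed
  note cont = this
  have "isCont u x" for x
    using cont[of "x-1" "x+1"] by (rule continuous_on_interior) auto
  then show ?thesis
    by (simp add: continuous_at_imp_continuous_on)
qed

text \<open>Cut the range of \<open>\<alpha>\<close>, not its domain, into N equal pieces: N
  increments of size c (\<Delta>/N)^2 sum to c \<Delta>^2 / N, which tends to 0.\<close>

lemma const_if_quadratic_increments:
  fixes F :: "real \<Rightarrow> 'a::real_normed_vector" and \<alpha> :: "real \<Rightarrow> real"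
  assumes cont: "continuous_on {a..b} \<alpha>" and "a \<le> b" and "c \<ge> 0"
    and inc: "\<And>x y. a \<le> x \<Longrightarrow> x \<le> y \<Longrightarrow> y \<le> b \<Longrightarrow> norm (F y - F x) \<le> c * (\<alpha> y - \<alpha> x)\<^sup>2"
    and mono: "\<alpha> a \<le> \<alpha> b"
  shows "F b = F a"
proof -
  have inc': "norm (F y - F x) \<le> c * (\<alpha> y - \<alpha> x)\<^sup>2" if "x \<in> {a..b}" "y \<in> {a..b}" for x y
  proof (cases "x \<le> y")
    case False
    then show ?thesis using inc[of y x] that by (simp add: norm_minus_commute power2_commute)
  qed (use inc that in auto)
  define \<Delta> where "\<Delta> = \<alpha> b - \<alpha> a"
  have bound: "norm (F b - F a) \<le> c * \<Delta>\<^sup>2 / real N" if "N > 0" for N :: nat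
  proof -
    have "\<exists>x\<in>{a..b}. \<alpha> x = \<alpha> a + real i * \<Delta> / N" if "i \<le> N" for i
    proof -
      have "real i * \<Delta> / N \<le> \<Delta>"
        using that \<open>N > 0\<close> mono mult_right_mono[of "real i" "real N" "\<alpha> b - \<alpha> a"]
        by (simp add: \<Delta>_def divide_le_eq mult.commute)
      then show ?thesis
        using IVT'[of \<alpha> a "\<alpha> a + real i * \<Delta> / N" b] mono cont \<open>a \<le> b\<close>
        by (auto simp: \<Delta>_def)
    qed
    then obtain p where p: "\<And>i. i \<le> N \<Longrightarrow> p i \<in> {a..b} \<and> \<alpha> (p i) = \<alpha> a + real i * \<Delta> / N"
      by metis
    have step: "norm (F (p (Suc i)) - F (p i)) \<le> c * (\<Delta> / N)\<^sup>2" if "i < N" for i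
    proof -
      have "\<alpha> (p (Suc i)) - \<alpha> (p i) = \<Delta> / N"
        using p[of i] p[of "Suc i"] that by (simp add: add_divide_distrib distrib_right)
      then show ?thesis
        using inc'[of "p i" "p (Suc i)"] p[of i] p[of "Suc i"] that by simp
    qed
    have "norm (F (p N) - F (p 0)) \<le> real N * (c * (\<Delta> / N)\<^sup>2)"
    proof -
      have "F (p N) - F (p 0) = (\<Sum>i<N. F (p (Suc i)) - F (p i))"
        using sum_lessThan_telescope[of "\<lambda>i. F (p i)" N] by simp
      also have "norm \<dots> \<le> (\<Sum>i<N. c * (\<Delta> / N)\<^sup>2)"
        by (rule sum_norm_le) (use step in auto)
      finally show ?thesis by simp
    qed
    \<comment> \<open>\<open>p 0\<close> and \<open>p N\<close> need not be the endpoints, but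
      \<open>\<alpha>\<close> takes the same values there, so these increments of \<open>F\<close>
      vanish.\<close>
    moreover have "F (p 0) = F a" "F (p N) = F b"
      using inc'[of a "p 0"] inc'[of b "p N"] p[of 0] p[of N] \<open>N > 0\<close> \<open>a \<le> b\<close>
      by (auto simp: \<Delta>_def)
    moreover have "real N * (c * (\<Delta> / N)\<^sup>2) = c * \<Delta>\<^sup>2 / N"
      using \<open>N > 0\<close> by (simp add: power2_eq_square field_simps)
    ultimately show ?thesis by simp
  qed
  have "(\<lambda>N. c * \<Delta>\<^sup>2 / real N) \<longlonglongrightarrow> 0"
    by (rule lim_const_over_n)
  then have "norm (F b - F a) \<le> 0"
    by (rule LIMSEQ_le_const) (use bound in \<open>auto intro: exI[of _ 1]\<close>)
  then show ?thesis by simp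
qed

lemma bilinear_absolutely_integrable:
  fixes f :: "real \<Rightarrow> 'a::euclidean_space" and g :: "real \<Rightarrow> 'b::euclidean_space"
    and B :: "'a \<Rightarrow> 'b \<Rightarrow> 'c::euclidean_space"
  assumes B: "bounded_bilinear B"
    and f: "continuous_on {a..b} f" and g: "g absolutely_integrable_on {a..b}"
  shows "(\<lambda>t. B (f t) (g t)) absolutely_integrable_on {a..b}"
proof -
  have "bilinear B"
    using B by (simp add: bilinear_conv_bounded_bilinear)
  moreover have "f \<in> borel_measurable (lebesgue_on {a..b})"
    using f by (simp add: continuous_imp_measurable_on_sets_lebesgue)
  moreover have "bounded (f ` {a..b})"
    using f by (simp add: compact_continuous_image compact_imp_bounded)
  ultimately show ?thesis
    using absolutely_integrable_bounded_measurable_product[of B f "{a..b}" g] g by simp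
qed

text \<open>Lebesgue's differentiation theorem is not needed for the product rule: the defect
  \<open>F\<close> below has increments that are quadratic in those of a continuous increasing function.\<close>

lemma prim_bilinear:
  fixes B :: "'a::euclidean_space \<Rightarrow> 'b::euclidean_space \<Rightarrow> 'c::euclidean_space"
  assumes B: "bounded_bilinear B" and u: "prim u \<phi>" and v: "prim v \<psi>"
  shows "prim (\<lambda>x. B (u x) (v x)) (\<lambda>x. B (u x) (\<psi> x) + B (\<phi> x) (v x))"
  unfolding prim_def
proof (intro allI impI)
  fix a b :: real assume ab: "a \<le> b"
  interpret B: bounded_bilinear B by (rule B)
  obtain K where "K > 0" and K: "\<And>x y. norm (B x y) \<le> norm x * norm y * K"
    using B.pos_bounded by blast
  define h where "h = (\<lambda>t. B (u t) (\<psi> t) + B (\<phi> t) (v t))"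
  have i1: "(\<lambda>t. B (u t) (\<psi> t)) absolutely_integrable_on {c..d}"
    and i2: "(\<lambda>t. B (\<phi> t) (v t)) absolutely_integrable_on {c..d}" if "c \<le> d" for c d
    using bilinear_absolutely_integrable[OF B prim_continuous[OF u] primD(1)[OF v that]]
      bilinear_absolutely_integrable[OF B.flip prim_continuous[OF v] primD(1)[OF u that]]
    by auto
  have hi: "h absolutely_integrable_on {c..d}" if "c \<le> d" for c d
    unfolding h_def using i1[OF that] i2[OF that] by (rule set_integral_add)
  have hi': "h integrable_on {c..d}" if "c \<le> d" for c d
    using hi[OF that] set_lebesgue_integral_eq_integral(1) by blast
  define F where "F = (\<lambda>x. B (u x) (v x) - integral {a..x} h)"
  define p where "p = (\<lambda>x y. integral {x..y} (\<lambda>t. norm (\<phi> t)))"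
  define r where "r = (\<lambda>x y. integral {x..y} (\<lambda>t. norm (\<psi> t)))"
  define \<alpha> where "\<alpha> = (\<lambda>x. p a x + r a x)"
  have ni: "(\<lambda>t. norm (\<phi> t)) integrable_on {c..d}" "(\<lambda>t. norm (\<psi> t)) integrable_on {c..d}"
    if "c \<le> d" for c d
    using primD(1)[OF u that] primD(1)[OF v that] by (auto simp: absolutely_integrable_on_def)
  have up: "norm (u y - u x) \<le> p x y" if "x \<le> y" for x y
    using integral_norm_bound_integral[OF primD(2)[OF u that] ni(1)[OF that]]
    by (simp add: primD(3)[OF u that] p_def)
  have vr: "norm (v y - v x) \<le> r x y" if "x \<le> y" for x y
    using integral_norm_bound_integral[OF primD(2)[OF v that] ni(2)[OF that]]
    by (simp add: primD(3)[OF v that] r_def)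
  have pr_mono: "p x t \<le> p x y" "r x t \<le> r x y" if "x \<le> t" "t \<le> y" for x y t
    unfolding p_def r_def using that by (auto intro!: integral_subset_le ni)
  \<comment> \<open>Freezing \<open>u\<close> and \<open>v\<close> at x inside the integrals leaves
    three terms, each at most \<open>K * p x y * r x y\<close>; the product of the two variations is
    below the square of their sum, which is the increment of \<open>\<alpha>\<close>.\<close>
  have inc: "norm (F y - F x) \<le> (3 * K) * (\<alpha> y - \<alpha> x)\<^sup>2" if xy: "a \<le> x" "x \<le> y" for x y
  proof -
    have pn: "p x y \<ge> 0" "r x y \<ge> 0"
      unfolding p_def r_def using xy by (auto intro!: integral_nonneg ni)
    have cmb: "integral {a..y} h - integral {a..x} h = integral {x..y} h"
      using Henstock_Kurzweil_Integration.integral_combine[of a x y h] hi'[of a y] xy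
      by (metis add_diff_cancel_left' order_trans)
    have I1: "integral {x..y} (\<lambda>t. B (u t - u x) (\<psi> t)) =
        integral {x..y} (\<lambda>t. B (u t) (\<psi> t)) - B (u x) (v y - v x)"
      and J1: "(\<lambda>t. B (u t - u x) (\<psi> t)) integrable_on {x..y}"
    proof -
      have "((\<lambda>t. B (u t) (\<psi> t) - B (u x) (\<psi> t)) has_integral
        (integral {x..y} (\<lambda>t. B (u t) (\<psi> t)) - B (u x) (v y - v x))) {x..y}"
        using i1[OF xy(2)] primD(2,3)[OF v xy(2)]
        by (intro has_integral_diff has_integral_linear[OF _ B.bounded_linear_right, unfolded o_def])
           (auto simp: has_integral_iff set_lebesgue_integral_eq_integral(1))
      then show "integral {x..y} (\<lambda>t. B (u t - u x) (\<psi> t)) =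
        integral {x..y} (\<lambda>t. B (u t) (\<psi> t)) - B (u x) (v y - v x)"
        "(\<lambda>t. B (u t - u x) (\<psi> t)) integrable_on {x..y}"
        by (auto simp: B.diff_left has_integral_iff)
    qed
    have I2: "integral {x..y} (\<lambda>t. B (\<phi> t) (v t - v x)) =
        integral {x..y} (\<lambda>t. B (\<phi> t) (v t)) - B (u y - u x) (v x)"
      and J2: "(\<lambda>t. B (\<phi> t) (v t - v x)) integrable_on {x..y}"
    proof -
      have "((\<lambda>t. B (\<phi> t) (v t) - B (\<phi> t) (v x)) has_integral
        (integral {x..y} (\<lambda>t. B (\<phi> t) (v t)) - B (u y - u x) (v x))) {x..y}"
        using i2[OF xy(2)] primD(2,3)[OF u xy(2)]
        by (intro has_integral_diff has_integral_linear[OF _ B.bounded_linear_left, unfolded o_def])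
           (auto simp: has_integral_iff set_lebesgue_integral_eq_integral(1))
      then show "integral {x..y} (\<lambda>t. B (\<phi> t) (v t - v x)) =
        integral {x..y} (\<lambda>t. B (\<phi> t) (v t)) - B (u y - u x) (v x)"
        "(\<lambda>t. B (\<phi> t) (v t - v x)) integrable_on {x..y}"
        by (auto simp: B.diff_right has_integral_iff)
    qed
    have E1: "norm (integral {x..y} (\<lambda>t. B (u t - u x) (\<psi> t))) \<le> K * p x y * r x y"
    proof -
      have "norm (integral {x..y} (\<lambda>t. B (u t - u x) (\<psi> t)))
          \<le> integral {x..y} (\<lambda>t. K * p x y * norm (\<psi> t))"
      proof (rule integral_norm_bound_integral[OF J1])
        show "(\<lambda>t. K * p x y * norm (\<psi> t)) integrable_on {x..y}"
          using ni(2)[OF xy(2)] by (rule integrable_on_mult_right)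
        fix t assume t: "t \<in> {x..y}"
        have "norm (u t - u x) \<le> p x y"
          using up[of x t] pr_mono(1)[of x t y] t by auto
        then have "norm (u t - u x) * norm (\<psi> t) * K \<le> p x y * norm (\<psi> t) * K"
          using \<open>K > 0\<close> by (intro mult_right_mono) auto
        then show "norm (B (u t - u x) (\<psi> t)) \<le> K * p x y * norm (\<psi> t)"
          using K[of "u t - u x" "\<psi> t"] by (simp add: mult_ac)
      qed
      then show ?thesis by (simp add: r_def)
    qed
    have E2: "norm (integral {x..y} (\<lambda>t. B (\<phi> t) (v t - v x))) \<le> K * p x y * r x y"
    proof -
      have "norm (integral {x..y} (\<lambda>t. B (\<phi> t) (v t - v x)))
          \<le> integral {x..y} (\<lambda>t. K * r x y * norm (\<phi> t))"
      proof (rule integral_norm_bound_integral[OF J2])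
        show "(\<lambda>t. K * r x y * norm (\<phi> t)) integrable_on {x..y}"
          using ni(1)[OF xy(2)] by (rule integrable_on_mult_right)
        fix t assume t: "t \<in> {x..y}"
        have "norm (v t - v x) \<le> r x y"
          using vr[of x t] pr_mono(2)[of x t y] t by auto
        then have "norm (\<phi> t) * norm (v t - v x) * K \<le> norm (\<phi> t) * r x y * K"
          using \<open>K > 0\<close> by (intro mult_right_mono mult_left_mono) auto
        then show "norm (B (\<phi> t) (v t - v x)) \<le> K * r x y * norm (\<phi> t)"
          using K[of "\<phi> t" "v t - v x"] by (simp add: mult_ac)
      qed
      then show ?thesis by (simp add: p_def mult_ac)
    qed
    have E3: "norm (B (u y - u x) (v y - v x)) \<le> K * p x y * r x y"
    proof -
      have "norm (u y - u x) * norm (v y - v x) * K \<le> p x y * r x y * K"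
        using up[OF xy(2)] vr[OF xy(2)] pn \<open>K > 0\<close> by (intro mult_right_mono mult_mono) auto
      then show ?thesis using K[of "u y - u x" "v y - v x"] by (simp add: mult_ac)
    qed
    have "integral {x..y} h = integral {x..y} (\<lambda>t. B (u t) (\<psi> t)) + integral {x..y} (\<lambda>t. B (\<phi> t) (v t))"
      unfolding h_def using i1[OF xy(2)] i2[OF xy(2)]
      by (intro integral_add) (auto simp: set_lebesgue_integral_eq_integral(1))
    then have "F y - F x = B (u y - u x) (v y - v x)
        - integral {x..y} (\<lambda>t. B (u t - u x) (\<psi> t)) - integral {x..y} (\<lambda>t. B (\<phi> t) (v t - v x))"
      unfolding I1 I2 using cmb by (simp add: F_def B.diff_left B.diff_right algebra_simps)
    also have "norm \<dots> \<le> K * p x y * r x y + K * p x y * r x y + K * p x y * r x y"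
      using E1 E2 E3 by (intro order_trans[OF norm_triangle_ineq4] add_mono) auto
    also have "\<dots> = 3 * K * (p x y * r x y)" by simp
    also have "\<dots> \<le> 3 * K * (p x y + r x y)\<^sup>2"
      using \<open>K > 0\<close> pn by (intro mult_left_mono) (auto simp: power2_eq_square algebra_simps)
    also have "p x y + r x y = \<alpha> y - \<alpha> x"
      using Henstock_Kurzweil_Integration.integral_combine[OF xy, of "\<lambda>t. norm (\<phi> t)"] Henstock_Kurzweil_Integration.integral_combine[OF xy, of "\<lambda>t. norm (\<psi> t)"]
        ni[of a y] xy by (auto simp: \<alpha>_def p_def r_def)
    finally show ?thesis .
  qed
  have "F b = F a"
  proof (rule const_if_quadratic_increments[where c="3 * K"])
    show "continuous_on {a..b} \<alpha>"
      unfolding \<alpha>_def p_def r_def using ab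
      by (intro continuous_intros indefinite_integral_continuous_1 ni) auto
    have "\<alpha> a = 0" by (simp add: \<alpha>_def p_def r_def)
    moreover have "\<alpha> b \<ge> 0"
      using ab unfolding \<alpha>_def p_def r_def by (intro add_nonneg_nonneg integral_nonneg ni) auto
    ultimately show "\<alpha> a \<le> \<alpha> b" by simp
  qed (use \<open>K > 0\<close> ab inc in auto)
  then show "(\<lambda>x. B (u x) (\<psi> x) + B (\<phi> x) (v x)) absolutely_integrable_on {a..b} \<and>
    integral {a..b} (\<lambda>x. B (u x) (\<psi> x) + B (\<phi> x) (v x)) = B (u b) (v b) - B (u a) (v a)"
    using hi[OF ab] by (simp add: F_def h_def algebra_simps)
qed

lemma prim_linear:
  assumes "bounded_linear L" "prim u \<phi>"
  shows "prim (\<lambda>x. L (u x)) (\<lambda>x. L (\<phi> x))"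
  unfolding prim_def
proof (intro allI impI conjI)
  fix a b :: real assume ab: "a \<le> b"
  interpret L: bounded_linear L by fact
  show "(\<lambda>x. L (\<phi> x)) absolutely_integrable_on {a..b}"
    using absolutely_integrable_linear[OF primD(1)[OF assms(2) ab] assms(1)] by (simp add: o_def)
  show "integral {a..b} (\<lambda>x. L (\<phi> x)) = L (u b) - L (u a)"
    using integral_linear[OF primD(2)[OF assms(2) ab] assms(1)] primD(3)[OF assms(2) ab]
    by (simp add: o_def L.diff)
qed

lemma prim_add:
  assumes "prim u \<phi>" "prim v \<psi>"
  shows "prim (\<lambda>x. u x + v x) (\<lambda>x. \<phi> x + \<psi> x)"
  unfolding prim_def using assms
  by (auto simp: primD integral_add intro!: set_integral_add)

lemma prim_minus:
  assumes "prim u \<phi>"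
  shows "prim (\<lambda>x. - u x) (\<lambda>x. - \<phi> x)"
  using prim_linear[OF bounded_linear_minus[OF bounded_linear_ident] assms] by simp

lemma prim_diff:
  assumes "prim u \<phi>" "prim v \<psi>"
  shows "prim (\<lambda>x. u x - v x) (\<lambda>x. \<phi> x - \<psi> x)"
  using prim_add[OF assms(1) prim_minus[OF assms(2)]] by simp

lemma prim_const: "prim (\<lambda>x. c) (\<lambda>x. 0)"
  by (simp add: prim_def)

lemma prim_reflect:
  assumes "prim u \<phi>"
  shows "prim (\<lambda>x. u (- x)) (\<lambda>x. - \<phi> (- x))"
  unfolding prim_def
proof (intro allI impI conjI)
  fix a b :: real assume ab: "a \<le> b"
  have "(\<lambda>x. \<phi> (- x)) absolutely_integrable_on {a..b}"
    using primD(1)[OF assms, of "-b" "-a"] ab absolutely_integrable_reflect_real[where f=\<phi> and a="-b" and b="-a"] by simp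
  then show "(\<lambda>x. - \<phi> (- x)) absolutely_integrable_on {a..b}"
    using absolutely_integrable_linear[where f="\<lambda>x. \<phi> (-x)" and s="{a..b}" and h=uminus]
    by (simp add: o_def bounded_linear_minus bounded_linear_ident)
  show "integral {a..b} (\<lambda>x. - \<phi> (- x)) = u (- b) - u (- a)"
    using primD(3)[OF assms, of "-b" "-a"] ab Henstock_Kurzweil_Integration.integral_reflect_real[where f=\<phi> and a="-b" and b="-a"] by simp
qed

lemma prim_cong_AE:
  assumes "prim u \<phi>" "AE x in lebesgue. \<phi> x = \<psi> x"
  shows "prim u \<psi>"
  unfolding prim_def
proof (intro allI impI conjI)
  fix a b :: real assume ab: "a \<le> b"
  from assms(2) obtain N where N: "negligible N" "\<And>x. x \<notin> N \<Longrightarrow> \<phi> x = \<psi> x"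
    by (auto simp: eventually_ae_filter negligible_iff_null_sets)
  show "\<psi> absolutely_integrable_on {a..b}"
    using absolutely_integrable_spike[OF primD(1)[OF assms(1) ab] N(1)] N(2) by auto
  show "integral {a..b} \<psi> = u b - u a"
    using integral_spike[OF N(1), of "{a..b}" \<psi> \<phi>] primD(3)[OF assms(1) ab] N(2) by auto
qed

lemma prim_if_has_vector_derivative:
  assumes "\<And>x. (u has_vector_derivative \<phi> x) (at x)" "continuous_on UNIV \<phi>"
  shows "prim u \<phi>"
  unfolding prim_def
proof (intro allI impI conjI)
  fix a b :: real assume ab: "a \<le> b"
  have c: "continuous_on {a..b} \<phi>"
    using assms(2) continuous_on_subset by blast
  show "\<phi> absolutely_integrable_on {a..b}"
    using c absolutely_integrable_continuous_real by blast
  show "integral {a..b} \<phi> = u b - u a"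
    using fundamental_theorem_of_calculus[OF ab, of u \<phi>] assms(1)
    by (auto intro!: integral_unique intro: has_vector_derivative_at_within)
qed

text \<open>Links the integral form to the \<open>vector_derivative\<close> in the definition of the
  coefficients. It applies to f_+ and f_- because their derivatives are themselves primitives, hence
  continuous.\<close>

lemma prim_has_vector_derivative:
  assumes u: "prim u \<phi>" and "continuous_on UNIV \<phi>"
  shows "(u has_vector_derivative \<phi> x) (at x)"
proof -
  have "((\<lambda>y. u (x-1) + integral {x-1..y} \<phi>) has_vector_derivative \<phi> x) (at x within {x-1..x+1})"
    using integral_has_vector_derivative[of "x-1" "x+1" \<phi> x] assms(2) continuous_on_subset
    by (auto intro!: derivative_eq_intros)
  then have "(u has_vector_derivative \<phi> x) (at x within {x-1..x+1})"
    by (rule has_vector_derivative_transform[rotated 2]) (use primD(3)[OF u] in auto)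
  moreover have "at x within {x-1..x+1} = at x"
    by (rule at_within_interior) simp
  ultimately show ?thesis by simp
qed

lemma prim_zero_const:
  assumes "prim u (\<lambda>x. 0)"
  shows "u x = u y"
  using primD(3)[OF assms, of x y] primD(3)[OF assms, of y x] by (cases "x \<le> y") auto

section \<open>Holomorphic matrix functions\<close>

text \<open>Cauchy's inequality on discs of radius r/4 turns the bound \<open>h\<close> on a ball
  into the bound 4 h / r for the derivative, hence for all difference quotients with k in the
  half-size ball; dominated convergence then differentiates under the integral.\<close>

lemma holomorphic_on_lebesgue_integral:
  fixes f :: "complex \<Rightarrow> 'a \<Rightarrow> complex"
  assumes hol: "\<And>t. (\<lambda>k. f k t) holomorphic_on U"
    and meas: "\<And>k. k \<in> U \<Longrightarrow> f k \<in> borel_measurable M"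
    and dom: "\<And>z. z \<in> U \<Longrightarrow> \<exists>r>0. \<exists>h. ball z r \<subseteq> U \<and> integrable M h \<and> (\<forall>k\<in>ball z r. \<forall>t. norm (f k t) \<le> h t)"
  shows "(\<lambda>k. \<integral>t. f k t \<partial>M) holomorphic_on U"
proof (rule holomorphic_onI)
  fix z assume "z \<in> U"
  from dom[OF this] obtain r h where "r > 0" and sub: "ball z r \<subseteq> U" and h: "integrable M h"
    and bnd: "\<And>k t. k \<in> ball z r \<Longrightarrow> norm (f k t) \<le> h t" by blast
  define d where "d = (\<lambda>t. deriv (\<lambda>k. f k t) z)"
  have fint: "integrable M (f k)" if "k \<in> ball z r" for k
  proof (rule Bochner_Integration.integrable_bound[OF h])
    show "f k \<in> borel_measurable M" using meas that sub by blast
    show "AE t in M. norm (f k t) \<le> norm (h t)"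
      using bnd[OF that] order_trans[OF _ abs_ge_self] by (intro AE_I2) auto
  qed
  have lip: "norm (f k t - f z t) \<le> 4 * h t / r * norm (k - z)" if k: "k \<in> ball z (r/2)" for k t
  proof (rule field_differentiable_bound[where S="ball z (r/2)" and f'="\<lambda>w. deriv (\<lambda>k. f k t) w"])
    fix w assume w: "w \<in> ball z (r/2)"
    have wr: "cball w (r/4) \<subseteq> ball z r"
    proof
      fix y assume "y \<in> cball w (r/4)"
      then show "y \<in> ball z r"
        using w \<open>r > 0\<close> dist_triangle[of z y w] by simp
    qed
    have holw: "(\<lambda>k. f k t) holomorphic_on ball z r"
      using hol sub holomorphic_on_subset by blast
    have "(\<lambda>k. f k t) field_differentiable at w"
      using holw w \<open>r > 0\<close> by (intro holomorphic_on_imp_differentiable_at[OF holw]) auto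
    then show "((\<lambda>k. f k t) has_field_derivative deriv (\<lambda>k. f k t) w) (at w within ball z (r/2))"
      using DERIV_deriv_iff_field_differentiable has_field_derivative_at_within by blast
    have "norm ((deriv ^^ 1) (\<lambda>k. f k t) w) \<le> fact 1 * h t / (r/4)^1"
    proof (rule Cauchy_inequality)
      show "(\<lambda>k. f k t) holomorphic_on ball w (r/4)"
        using holw wr holomorphic_on_subset ball_subset_cball by blast
      show "continuous_on (cball w (r/4)) (\<lambda>k. f k t)"
        using holomorphic_on_imp_continuous_on[OF holw] wr continuous_on_subset by blast
      show "norm (f x t) \<le> h t" if "norm (w - x) = r/4" for x
        using bnd[of x t] wr that by (force simp: dist_norm)
    qed (use \<open>r > 0\<close> in auto)
    then show "norm (deriv (\<lambda>k. f k t) w) \<le> 4 * h t / r"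
      by (simp add: field_simps)
  qed (use k \<open>r > 0\<close> in auto)
  have "((\<lambda>k. ((\<integral>t. f k t \<partial>M) - (\<integral>t. f z t \<partial>M)) / (k - z)) \<longlongrightarrow> (\<integral>t. d t \<partial>M)) (at z)"
    unfolding tendsto_at_iff_sequentially
  proof (intro allI impI)
    fix X assume X: "\<forall>i. X i \<in> UNIV - {z}" "X \<longlonglongrightarrow> z"
    obtain N where N: "\<And>n. n \<ge> N \<Longrightarrow> dist (X n) z < r/2"
      using X(2) \<open>r > 0\<close> by (metis half_gt_zero lim_sequentially)
    define Y where "Y = (\<lambda>n. X (n + N))"
    have Y: "Y n \<in> ball z (r/2)" "Y n \<noteq> z" "Y n \<in> ball z r" for n
      using N[of "n + N"] X(1) \<open>r > 0\<close> by (auto simp: Y_def dist_commute)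
    have Ylim: "Y \<longlonglongrightarrow> z"
      unfolding Y_def using X(2) by (rule LIMSEQ_ignore_initial_segment)
    have lim: "(\<lambda>n. (f (Y n) t - f z t) / (Y n - z)) \<longlonglongrightarrow> d t" for t
    proof -
      have "(\<lambda>k. f k t) field_differentiable at z"
        using sub \<open>r > 0\<close> hol by (intro holomorphic_on_imp_differentiable_at[of _ "ball z r"])
          (auto intro: holomorphic_on_subset)
      then have "((\<lambda>k. f k t) has_field_derivative d t) (at z)"
        by (simp add: d_def DERIV_deriv_iff_field_differentiable)
      then have "((\<lambda>k. (f k t - f z t) / (k - z)) \<longlongrightarrow> d t) (at z)"
        by (simp add: has_field_derivative_iff)
      then show ?thesis
        using Ylim Y(2) by (auto simp: tendsto_at_iff_sequentially o_def)
    qed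
    have qmeas: "(\<lambda>t. (f (Y n) t - f z t) / (Y n - z)) \<in> borel_measurable M" for n
      using meas[of "Y n"] meas[of z] Y(3)[of n] sub \<open>z \<in> U\<close>
      by (intro borel_measurable_divide borel_measurable_diff) auto
    have "(\<lambda>n. \<integral>t. (f (Y n) t - f z t) / (Y n - z) \<partial>M) \<longlonglongrightarrow> (\<integral>t. d t \<partial>M)"
    proof (rule integral_dominated_convergence[where w="\<lambda>t. 4 / r * h t"])
      show "d \<in> borel_measurable M"
        by (rule borel_measurable_LIMSEQ_metric[OF qmeas lim])
      show "integrable M (\<lambda>t. 4 / r * h t)" using h by simp
      show "AE t in M. norm ((f (Y n) t - f z t) / (Y n - z)) \<le> 4 / r * h t" for n
        using lip[OF Y(1)] Y(2)[of n] by (intro AE_I2) (simp add: norm_divide divide_le_eq)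
    qed (use lim qmeas in auto)
    moreover have "(\<integral>t. (f (Y n) t - f z t) / (Y n - z) \<partial>M)
        = ((\<integral>t. f (Y n) t \<partial>M) - (\<integral>t. f z t \<partial>M)) / (Y n - z)" for n
      using fint[OF Y(3)[of n]] fint[of z] \<open>r > 0\<close> by simp
    ultimately have "(\<lambda>n. ((\<integral>t. f (Y n) t \<partial>M) - (\<integral>t. f z t \<partial>M)) / (Y n - z)) \<longlonglongrightarrow> (\<integral>t. d t \<partial>M)"
      by (simp only:)
    then show "((\<lambda>k. ((\<integral>t. f k t \<partial>M) - (\<integral>t. f z t \<partial>M)) / (k - z)) \<circ> X) \<longlonglongrightarrow> (\<integral>t. d t \<partial>M)"
      unfolding o_def Y_def by (rule LIMSEQ_offset)
  qed
  then have "((\<lambda>k. \<integral>t. f k t \<partial>M) has_field_derivative (\<integral>t. d t \<partial>M)) (at z)"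
    by (simp add: has_field_derivative_iff)
  then show "(\<lambda>k. \<integral>t. f k t \<partial>M) field_differentiable at z within U"
    using field_differentiable_at_within field_differentiable_def by blast
qed

definition mhol :: "(complex \<Rightarrow> complex^'n^'m) \<Rightarrow> complex set \<Rightarrow> bool" where
  "mhol F U \<longleftrightarrow> (\<forall>i j. (\<lambda>k. F k $ i $ j) holomorphic_on U)"

lemma mholD: "mhol F U \<Longrightarrow> (\<lambda>k. F k $ i $ j) holomorphic_on U"
  by (simp add: mhol_def)

lemma mhol_subset: "mhol F U \<Longrightarrow> U' \<subseteq> U \<Longrightarrow> mhol F U'"
  using holomorphic_on_subset by (fastforce simp: mhol_def)

lemma mhol_const: "mhol (\<lambda>k. C) U"
  by (simp add: mhol_def)

lemma mhol_add: "mhol F U \<Longrightarrow> mhol G U \<Longrightarrow> mhol (\<lambda>k. F k + G k) U"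
  by (auto simp: mhol_def intro!: holomorphic_intros)

lemma mhol_diff: "mhol F U \<Longrightarrow> mhol G U \<Longrightarrow> mhol (\<lambda>k. F k - G k) U"
  by (auto simp: mhol_def intro!: holomorphic_intros)

lemma mhol_cscale: "c holomorphic_on U \<Longrightarrow> mhol F U \<Longrightarrow> mhol (\<lambda>k. c k \<odot> F k) U"
  by (auto simp: mhol_def intro!: holomorphic_intros)

lemma mhol_mult: "mhol F U \<Longrightarrow> mhol G U \<Longrightarrow> mhol (\<lambda>k. F k ** G k) U"
  by (auto simp: mhol_def matrix_matrix_mult_def intro!: holomorphic_intros)

lemma mhol_compose:
  assumes "mhol F U" "g holomorphic_on W" "g ` W \<subseteq> U"
  shows "mhol (\<lambda>k. F (g k)) W"
  using holomorphic_on_compose_gen[OF assms(2) _ assms(3), unfolded o_def] assms(1)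
  by (auto simp: mhol_def)

lemma mhol_madj_cnj:
  assumes "mhol F U" "open W" "cnj ` W \<subseteq> U"
  shows "mhol (\<lambda>k. madj (F (cnj k))) W"
  unfolding mhol_def
proof (intro allI)
  fix i j
  have "(\<lambda>k. F k $ j $ i) holomorphic_on cnj ` W"
    using mholD[OF assms(1)] assms(3) by (rule holomorphic_on_subset)
  then show "(\<lambda>k. madj (F (cnj k)) $ i $ j) holomorphic_on W"
    using holomorphic_on_compose_cnj_cnj[OF _ assms(2)] by (force simp: o_def)
qed

text \<open>The map k -> - cnj k preserves Im k, so this operation keeps a half-plane Im k >
  -\<gamma>. It is the form in which f_- enters \<open>coefA\<close>.\<close>

lemma mhol_madj_minus_cnj:
  assumes "mhol F U" "open W" "(\<lambda>k. - cnj k) ` W \<subseteq> U"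
  shows "mhol (\<lambda>k. madj (F (- cnj k))) W"
proof -
  have "mhol (\<lambda>k. F (- k)) (uminus ` U)"
    by (rule mhol_compose[OF assms(1)]) (auto intro!: holomorphic_intros)
  moreover have "cnj ` W \<subseteq> uminus ` U"
  proof
    fix k assume "k \<in> cnj ` W"
    then obtain w where "w \<in> W" "k = cnj w" by blast
    then show "k \<in> uminus ` U"
      using assms(3) by (intro image_eqI[of _ _ "- cnj w"]) auto
  qed
  ultimately show ?thesis
    by (rule mhol_madj_cnj[OF _ assms(2)])
qed

lemma holomorphic_on_det:
  assumes "mhol F U"
  shows "(\<lambda>k. det (F k)) holomorphic_on U"
  using assms unfolding det_def mhol_def by (auto intro!: holomorphic_intros)

text \<open>By Cramer's rule the entries of the inverse are quotients of determinants;
  \<open>N\<close> carries the j-th unit vector in column i.\<close>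

lemma mhol_matrix_inv:
  fixes F :: "complex \<Rightarrow> complex^'n^'n"
  assumes F: "mhol F U" and inv: "\<And>k. k \<in> U \<Longrightarrow> invertible (F k)"
  shows "mhol (\<lambda>k. matrix_inv (F k)) U"
  unfolding mhol_def
proof (intro allI)
  fix i j
  define N :: "complex \<Rightarrow> complex^'n^'n" where "N = (\<lambda>k. \<chi> a b. if b = i then mat 1 $ a $ j else F k $ a $ b)"
  have N: "mhol N U"
    unfolding mhol_def
  proof (intro allI)
    fix a b show "(\<lambda>k. N k $ a $ b) holomorphic_on U"
      using mholD[OF F] by (cases "b = i") (auto simp: N_def)
  qed
  have eq: "matrix_inv (F k) $ i $ j = det (N k) / det (F k)" if "k \<in> U" for k
  proof -
    have d: "det (F k) \<noteq> 0"
      using inv[OF that] by (simp add: invertible_det_nz)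
    define x where "x = (\<chi> a. matrix_inv (F k) $ a $ j)"
    have "F k *v x = (\<chi> a. mat 1 $ a $ j)"
      using matrix_inv_right_left(1)[OF inv[OF that]]
      by (simp add: x_def vec_eq_iff matrix_matrix_mult_def matrix_vector_mult_def)
    then have "x $ i = det (N k) / det (F k)"
      by (simp add: cramer[OF d] N_def if_distrib cong: if_cong)
    then show ?thesis by (simp add: x_def)
  qed
  have "(\<lambda>k. det (N k) / det (F k)) holomorphic_on U"
    using holomorphic_on_det[OF N] holomorphic_on_det[OF F] inv
    by (intro holomorphic_intros) (auto simp: invertible_det_nz)
  then show "(\<lambda>k. matrix_inv (F k) $ i $ j) holomorphic_on U"
    by (rule holomorphic_transform) (simp add: eq)
qed

lemma bounded_linear_entry: "bounded_linear (\<lambda>M :: complex^'n^'m. M $ i $ j)"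
  using bounded_linear_compose[OF bounded_linear_vec_nth bounded_linear_vec_nth] .

lemma mhol_lebesgue_integral:
  fixes f :: "complex \<Rightarrow> 'a \<Rightarrow> complex^'n^'m"
  assumes hol: "\<And>t. mhol (\<lambda>k. f k t) U"
    and meas: "\<And>k. k \<in> U \<Longrightarrow> f k \<in> borel_measurable M"
    and dom: "\<And>z. z \<in> U \<Longrightarrow> \<exists>r>0. \<exists>h. ball z r \<subseteq> U \<and> integrable M h \<and> (\<forall>k\<in>ball z r. \<forall>t. norm (f k t) \<le> h t)"
  shows "mhol (\<lambda>k. \<integral>t. f k t \<partial>M) U"
  unfolding mhol_def
proof (intro allI)
  fix i j
  have ent: "norm (M $ i $ j) \<le> norm M" for M :: "complex^'n^'m"
    by (rule norm_matrix_le)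
  have "(\<lambda>k. \<integral>t. f k t $ i $ j \<partial>M) holomorphic_on U"
  proof (rule holomorphic_on_lebesgue_integral)
    show "(\<lambda>t. f k t $ i $ j) \<in> borel_measurable M" if "k \<in> U" for k
      using meas[OF that] borel_measurable_continuous_onI[OF
          bounded_linear.continuous_on[OF bounded_linear_entry continuous_on_id]]
      by (rule measurable_compose)
    show "\<exists>r>0. \<exists>h. ball z r \<subseteq> U \<and> integrable M h \<and> (\<forall>k\<in>ball z r. \<forall>t. norm (f k t $ i $ j) \<le> h t)"
      if z: "z \<in> U" for z
    proof -
      from dom[OF z] obtain r h where "r > 0" "ball z r \<subseteq> U" "integrable M h"
        "\<And>k t. k \<in> ball z r \<Longrightarrow> norm (f k t) \<le> h t" by blast
      then show ?thesis
        by (intro exI[of _ r] conjI exI[of _ h]) (auto intro: order_trans[OF ent])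
    qed
  qed (use mholD[OF hol] in auto)
  moreover have "(\<integral>t. f k t \<partial>M) $ i $ j = (\<integral>t. f k t $ i $ j \<partial>M)" if "k \<in> U" for k
  proof -
    from dom[OF that] obtain r h where "r > 0" "integrable M h" "\<forall>k\<in>ball k r. \<forall>t. norm (f k t) \<le> h t"
      by blast
    then have "integrable M (f k)"
      using meas[OF that] by (intro Bochner_Integration.integrable_bound[of M h "f k"])
        (auto intro!: AE_I2 intro: order_trans[OF _ abs_ge_self])
    then show ?thesis
      using integral_bounded_linear[OF bounded_linear_entry] by metis
  qed
  ultimately show "(\<lambda>k. (\<integral>t. f k t \<partial>M) $ i $ j) holomorphic_on U"
    by (simp cong: holomorphic_cong)
qed

lemma mhol_suminf:
  fixes f :: "nat \<Rightarrow> complex \<Rightarrow> complex^'n^'m"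
  assumes "open U" and hol: "\<And>j. mhol (f j) U"
    and dom: "\<And>z. z \<in> U \<Longrightarrow> \<exists>r>0. \<exists>M. ball z r \<subseteq> U \<and> summable M \<and> (\<forall>k\<in>ball z r. \<forall>j. norm (f j k) \<le> M j)"
  shows "mhol (\<lambda>k. \<Sum>j. f j k) U"
  unfolding mhol_def
proof (intro allI)
  fix a b
  show "(\<lambda>k. (\<Sum>j. f j k) $ a $ b) holomorphic_on U"
  proof (rule holomorphic_uniform_sequence[OF \<open>open U\<close>])
    show "(\<lambda>k. (\<Sum>j<n. f j k) $ a $ b) holomorphic_on U" for n
      using mholD[OF hol] by (auto simp: intro!: holomorphic_intros)
    fix z assume "z \<in> U"
    from dom[OF this] obtain r M where r: "r > 0" "ball z r \<subseteq> U" and M: "summable M"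
      and bnd: "\<And>k j. k \<in> ball z r \<Longrightarrow> norm (f j k) \<le> M j" by blast
    have cb: "cball z (r/2) \<subseteq> ball z r" using \<open>r > 0\<close> by auto
    have "uniform_limit (cball z (r/2)) (\<lambda>n k. \<Sum>j<n. f j k) (\<lambda>k. \<Sum>j. f j k) sequentially"
      by (rule Weierstrass_m_test[OF _ M]) (use bnd cb in auto)
    then have "uniform_limit (cball z (r/2)) (\<lambda>n k. (\<Sum>j<n. f j k) $ a $ b) (\<lambda>k. (\<Sum>j. f j k) $ a $ b) sequentially"
      by (rule bounded_linear.uniform_limit[OF bounded_linear_entry])
    then show "\<exists>d>0. cball z d \<subseteq> U \<and>
        uniform_limit (cball z d) (\<lambda>n k. (\<Sum>j<n. f j k) $ a $ b) (\<lambda>k. (\<Sum>j. f j k) $ a $ b) sequentially"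
      using r cb by (intro exI[of _ "r/2"]) auto
  qed
qed

section \<open>The Volterra kernel\<close>

text \<open>With f = e^{ikx} m the kernel sin(ks)/k of the Jost equation becomes e^{iks} sin(ks)/k,
  which is this expression, with its limit s at k = 0. The value 0 for s \<le> 0 lets integrals over
  {x..} be written over the whole line and keeps the kernel continuous.\<close>

definition vker :: "complex \<Rightarrow> real \<Rightarrow> complex" where
  "vker k s = (if s \<le> 0 then 0 else if k = 0 then of_real s
     else (exp (2 * \<i> * k * of_real s) - 1) / (2 * \<i> * k))"

lemma vker_nonpos [simp]: "s \<le> 0 \<Longrightarrow> vker k s = 0"
  by (simp add: vker_def)

lemma vker_eq: "k \<noteq> 0 \<Longrightarrow> s \<ge> 0 \<Longrightarrow> vker k s = (exp (2 * \<i> * k * of_real s) - 1) / (2 * \<i> * k)"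
  by (auto simp: vker_def)

text \<open>For s > 0 this is a difference quotient at 0 of an entire function; the singularity at k
  = 0 is removable, and the value s there is the derivative.\<close>

lemma holomorphic_on_vker: "(\<lambda>k. vker k s) holomorphic_on U"
proof (cases "s \<le> 0")
  case False
  define g where "g = (\<lambda>k. exp (2 * \<i> * k * complex_of_real s) / (2 * \<i>))"
  have "(\<lambda>z. if z = 0 then deriv g 0 else (g z - g 0) / (z - 0)) holomorphic_on UNIV"
    by (rule pole_lemma) (auto simp: g_def intro!: holomorphic_intros)
  moreover have "deriv g 0 = of_real s"
    unfolding g_def by (rule DERIV_imp_deriv) (auto intro!: derivative_eq_intros simp: complex_eq_iff)
  moreover have "vker z s = (if z = 0 then of_real s else (g z - g 0) / (z - 0))" for z
    using False by (simp add: vker_def g_def field_simps)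
  ultimately have "(\<lambda>k. vker k s) holomorphic_on UNIV"
    by (simp only:)
  then show ?thesis
    by (rule holomorphic_on_subset) simp
qed simp

lemma continuous_on_vker: "continuous_on S (vker k)"
proof -
  have "vker k = (\<lambda>s. if k = 0 then complex_of_real (max s 0)
      else (exp (2 * \<i> * k * of_real (max s 0)) - 1) / (2 * \<i> * k))"
    by (rule ext) (auto simp: vker_def max_def)
  moreover have "continuous_on S (\<lambda>s. complex_of_real (max s 0))"
    by (intro continuous_intros)
  moreover have "continuous_on S (\<lambda>s. (exp (2 * \<i> * k * complex_of_real (max s 0)) - 1) / (2 * \<i> * k))"
    if "k \<noteq> 0" using that by (intro continuous_intros) auto
  ultimately show ?thesis
    by (cases "k = 0") auto
qed

lemma norm_exp_minus_one_le:
  assumes "Re z \<le> c" "0 \<le> c"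
  shows "norm (exp z - 1) \<le> exp c * norm z"
proof -
  have "norm (exp z - exp 0) \<le> exp c * norm (z - 0)"
  proof (rule field_differentiable_bound[where S="{w. Re w \<le> c}" and f'=exp])
    show "convex {w. Re w \<le> c}" by (rule convex_halfspace_Re_le)
    show "norm (exp w) \<le> exp c" if "w \<in> {w. Re w \<le> c}" for w
      using that by simp
  qed (use assms in \<open>auto intro!: derivative_eq_intros\<close>)
  then show ?thesis by simp
qed

lemma norm_vker_le:
  assumes "- \<eta> \<le> Im k" "0 \<le> \<eta>" "0 \<le> s"
  shows "norm (vker k s) \<le> s * exp (2 * \<eta> * s)"
proof (cases "k = 0 \<or> s = 0")
  case True
  then show ?thesis using assms by (auto simp: vker_def)
next
  case False
  have "Re (2 * \<i> * k * of_real s) \<le> 2 * \<eta> * s"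
    using assms mult_right_mono[of "- Im k" \<eta> "2 * s"] by simp
  then have "norm (exp (2 * \<i> * k * of_real s) - 1) \<le> exp (2 * \<eta> * s) * norm (2 * \<i> * k * of_real s)"
    using assms by (intro norm_exp_minus_one_le) auto
  then show ?thesis
    using False assms by (simp add: vker_eq norm_divide norm_mult divide_le_eq mult_ac)
qed

text \<open>The linear factor s of \<open>norm_vker_le\<close> is absorbed by the gap between
  \<open>\<eta>\<close> and \<open>\<gamma>\<close>; the bound stays finite at k = 0.\<close>

lemma norm_vker_le_exp:
  assumes "- \<eta> \<le> Im k" "0 \<le> \<eta>" "\<eta> < \<gamma>"
  shows "norm (vker k s) \<le> exp (2 * \<gamma> * max 0 s) / (2 * (\<gamma> - \<eta>))"
proof (cases "s \<le> 0")
  case False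
  have "2 * (\<gamma> - \<eta>) * s \<le> exp (2 * (\<gamma> - \<eta>) * s)"
    by (rule order_trans[OF _ exp_ge_add_one_self]) simp
  then have "2 * (\<gamma> - \<eta>) * s * exp (2 * \<eta> * s) \<le> exp (2 * (\<gamma> - \<eta>) * s) * exp (2 * \<eta> * s)"
    by (rule mult_right_mono) simp
  also have "\<dots> = exp (2 * \<gamma> * s)"
    by (simp add: mult_exp_exp algebra_simps)
  finally have "s * exp (2 * \<eta> * s) \<le> exp (2 * \<gamma> * s) / (2 * (\<gamma> - \<eta>))"
    using assms by (simp add: le_divide_eq mult_ac)
  then show ?thesis
    using norm_vker_le[OF assms(1,2), of s] False by simp
qed (use assms in auto)

text \<open>In the closed upper half-plane the exponential does not grow. The resulting decay in k
  is the source of the high energy estimates.\<close>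

lemma norm_vker_le_inverse:
  assumes "0 \<le> Im k" "k \<noteq> 0"
  shows "norm (vker k s) \<le> 1 / norm k"
proof (cases "s \<le> 0")
  case False
  have "norm (exp (2 * \<i> * k * of_real s)) \<le> 1"
    using assms False by simp
  then have "norm (exp (2 * \<i> * k * of_real s) - 1) \<le> 2"
    using norm_triangle_ineq4[of "exp (2 * \<i> * k * of_real s)" 1] by (simp del: norm_exp_eq_Re)
  then show ?thesis
    using False assms by (simp add: vker_eq norm_divide norm_mult divide_simps)
qed (use assms in auto)

lemma norm_exp_2ik_le:
  assumes "- \<gamma> \<le> Im k" "0 \<le> s"
  shows "norm (exp (2 * \<i> * k * complex_of_real s)) \<le> exp (2 * \<gamma> * s)"
  using assms mult_right_mono[of "- Im k" \<gamma> "2 * s"] by simp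

section \<open>Tails of integrals\<close>

lemma prim_tail:
  fixes \<phi> :: "real \<Rightarrow> 'a::euclidean_space"
  assumes int: "\<And>x. set_integrable lebesgue {x..} \<phi>"
  shows "prim (\<lambda>x. set_lebesgue_integral lebesgue {x..} \<phi>) (\<lambda>x. - \<phi> x)"
  unfolding prim_def
proof (intro allI impI conjI)
  fix a b :: real assume ab: "a \<le> b"
  have ai: "\<phi> absolutely_integrable_on {a..b}"
    using absolutely_integrable_on_subinterval[OF int[of a]] by auto
  then show "(\<lambda>x. - \<phi> x) absolutely_integrable_on {a..b}"
    by (rule absolutely_integrable_linear[OF _ bounded_linear_minus[OF bounded_linear_ident], unfolded o_def])
  have "(\<phi> has_integral (integral {a..b} \<phi> + integral {b..} \<phi>)) ({a..b} \<union> {b..})"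
  proof (rule has_integral_Un)
    show "(\<phi> has_integral integral {a..b} \<phi>) {a..b}"
      using ai by (simp add: set_lebesgue_integral_eq_integral(1) integrable_integral)
    show "(\<phi> has_integral integral {b..} \<phi>) {b..}"
      using int[of b] by (simp add: set_lebesgue_integral_eq_integral(1) integrable_integral)
    have "{a..b} \<inter> {b..} = {b}" using ab by auto
    then show "negligible ({a..b} \<inter> {b..})" by simp
  qed
  moreover have "{a..b} \<union> {b..} = {a..}" using ab by auto
  ultimately have "integral {a..} \<phi> = integral {a..b} \<phi> + integral {b..} \<phi>"
    by (simp add: integral_unique)
  then show "integral {a..b} (\<lambda>x. - \<phi> x) = set_lebesgue_integral lebesgue {b..} \<phi> - set_lebesgue_integral lebesgue {a..} \<phi>"
    using int by (simp add: set_lebesgue_integral_eq_integral(2))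
qed

lemma tail_tendsto_0:
  fixes \<phi> :: "real \<Rightarrow> 'a::euclidean_space"
  assumes int: "set_integrable lebesgue {a..} \<phi>"
  shows "((\<lambda>x. set_lebesgue_integral lebesgue {x..} \<phi>) \<longlongrightarrow> 0) at_top"
proof -
  \<comment> \<open>\<open>max a x\<close> keeps all domains inside {a..}, where the majorant is
    integrable; for large x it equals x.\<close>
  have "((\<lambda>x. \<integral>t. indicator {max a x..} t *\<^sub>R \<phi> t \<partial>lebesgue) \<longlongrightarrow> integral\<^sup>L lebesgue (\<lambda>t::real. 0)) at_top"
  proof (rule integral_dominated_convergence_at_top)
    show "integrable lebesgue (\<lambda>t. norm (indicator {a..} t *\<^sub>R \<phi> t))"
      using int unfolding set_integrable_def by (rule integrable_norm)
    show "(\<lambda>t. indicator {max a x..} t *\<^sub>R \<phi> t) \<in> borel_measurable lebesgue" for x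
    proof -
      have "set_integrable lebesgue {max a x..} \<phi>"
        by (rule set_integrable_subset[OF int]) auto
      then show ?thesis unfolding set_integrable_def by (rule borel_measurable_integrable)
    qed
    show "AE t in lebesgue. ((\<lambda>x. indicator {max a x..} t *\<^sub>R \<phi> t) \<longlongrightarrow> 0) at_top"
    proof (rule AE_I2)
      fix t
      have "\<forall>\<^sub>F x in at_top. indicator {max a x..} t *\<^sub>R \<phi> t = 0"
        using eventually_gt_at_top[of t] by eventually_elim auto
      then show "((\<lambda>x. indicator {max a x..} t *\<^sub>R \<phi> t) \<longlongrightarrow> 0) at_top"
        by (rule tendsto_eventually)
    qed
    show "\<forall>\<^sub>F x in at_top. AE t in lebesgue. norm (indicator {max a x..} t *\<^sub>R \<phi> t) \<le> norm (indicator {a..} t *\<^sub>R \<phi> t)"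
      by (intro always_eventually allI AE_I2) (auto simp: indicator_def)
  qed simp
  moreover have "\<forall>\<^sub>F x in at_top. (\<integral>t. indicator {max a x..} t *\<^sub>R \<phi> t \<partial>lebesgue) = set_lebesgue_integral lebesgue {x..} \<phi>"
    using eventually_ge_at_top[of a] by eventually_elim (simp add: set_lebesgue_integral_def max_def)
  ultimately show ?thesis
    using tendsto_cong by fastforce
qed

definition tail :: "(real \<Rightarrow> real) \<Rightarrow> real \<Rightarrow> real" where
  "tail q x = set_lebesgue_integral lebesgue {x..} q"

context
  fixes q :: "real \<Rightarrow> real"
  assumes q: "integrable lebesgue q" and q_nonneg: "\<And>t. 0 \<le> q t"
begin

lemma set_integrable_tail: "set_integrable lebesgue {x..} q"
  unfolding set_integrable_def using q by (intro integrable_mult_indicator) auto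

lemma tail_nonneg: "0 \<le> tail q x"
  unfolding tail_def set_lebesgue_integral_def by (intro Bochner_Integration.integral_nonneg) (simp add: q_nonneg)

lemma prim_tail_power: "prim (\<lambda>x. tail q x ^ Suc j) (\<lambda>x. - real (Suc j) * (q x * tail q x ^ j))"
proof (induction j)
  case 0
  show ?case using prim_tail[OF set_integrable_tail] by (simp add: tail_def)
next
  case (Suc j)
  have "prim (tail q) (\<lambda>x. - q x)"
    using prim_tail[OF set_integrable_tail] by (simp add: tail_def[abs_def])
  from prim_bilinear[OF bounded_bilinear_mult this Suc]
  have "prim (\<lambda>x. tail q x ^ Suc (Suc j))
      (\<lambda>x. tail q x * (- real (Suc j) * (q x * tail q x ^ j)) + - q x * tail q x ^ Suc j)"
    by simp
  moreover have "(\<lambda>x. tail q x * (- real (Suc j) * (q x * tail q x ^ j)) + - q x * tail q x ^ Suc j)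
      = (\<lambda>x. - real (Suc (Suc j)) * (q x * tail q x ^ Suc j))"
    by (rule ext) (simp add: algebra_simps)
  ultimately show ?case by (simp only:)
qed

lemma tail_le: "tail q x \<le> integral\<^sup>L lebesgue q"
  unfolding tail_def set_lebesgue_integral_def
  by (intro integral_mono integrable_mult_indicator q) (auto simp: q_nonneg indicator_def)

lemma continuous_on_tail: "continuous_on S (tail q)"
  using prim_continuous[OF prim_tail_power[of 0]] by simp

lemma integrable_tail_power: "integrable lebesgue (\<lambda>t. q t * tail q t ^ j)"
proof (rule Bochner_Integration.integrable_bound)
  show "integrable lebesgue (\<lambda>t. integral\<^sup>L lebesgue q ^ j * q t)"
    using q by simp
  show "(\<lambda>t. q t * tail q t ^ j) \<in> borel_measurable lebesgue"
    using q borel_measurable_lebesgue_continuous[OF continuous_on_tail] by measurable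
  show "AE t in lebesgue. norm (q t * tail q t ^ j) \<le> norm (integral\<^sup>L lebesgue q ^ j * q t)"
  proof (rule AE_I2)
    fix t
    have "tail q t ^ j \<le> integral\<^sup>L lebesgue q ^ j"
      by (rule power_mono[OF tail_le tail_nonneg])
    then show "norm (q t * tail q t ^ j) \<le> norm (integral\<^sup>L lebesgue q ^ j * q t)"
      using q_nonneg[of t] tail_nonneg[of t] tail_le[of t]
      by (simp add: abs_mult mult_left_mono mult.commute)
  qed
qed

text \<open>The integrand is the derivative of - tail^(j+1) / (j+1). Integrate over {x..x + n}, drop
  the nonnegative term at x + n and let n tend to infinity. The factors 1/(j+1) accumulate to 1/j!
  in the Volterra series.\<close>

lemma tail_power_integral:
  "(\<integral>t. indicator {x..} t * (q t * tail q t ^ j) \<partial>lebesgue) \<le> tail q x ^ Suc j / real (Suc j)"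
proof -
  let ?g = "\<lambda>t. q t * tail q t ^ j"
  have "(\<lambda>n. \<integral>t. indicator {x..x + real n} t *\<^sub>R ?g t \<partial>lebesgue) \<longlonglongrightarrow> (\<integral>t. indicator {x..} t *\<^sub>R ?g t \<partial>lebesgue)"
  proof (rule integral_dominated_convergence)
    show "integrable lebesgue (\<lambda>t. norm (?g t))"
      using integrable_tail_power by (rule integrable_norm)
    show "AE t in lebesgue. (\<lambda>n. indicator {x..x + real n} t *\<^sub>R ?g t) \<longlonglongrightarrow> indicator {x..} t *\<^sub>R ?g t"
    proof (rule AE_I2)
      fix t
      obtain N where N: "t - x \<le> real N" using real_arch_simple by blast
      then have "\<forall>\<^sub>F n in sequentially. indicator {x..x + real n} t *\<^sub>R ?g t = indicator {x..} t *\<^sub>R ?g t"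
        by (intro eventually_sequentiallyI[of N]) (auto simp: indicator_def)
      then show "(\<lambda>n. indicator {x..x + real n} t *\<^sub>R ?g t) \<longlonglongrightarrow> indicator {x..} t *\<^sub>R ?g t"
        by (rule tendsto_eventually)
    qed
    show "(\<lambda>t. indicator {x..x + real n} t *\<^sub>R ?g t) \<in> borel_measurable lebesgue" for n
      using integrable_mult_indicator[OF _ integrable_tail_power, of "{x..x + real n}"]
      by (intro borel_measurable_integrable) auto
    show "(\<lambda>t. indicator {x..} t *\<^sub>R ?g t) \<in> borel_measurable lebesgue"
      using integrable_mult_indicator[OF _ integrable_tail_power, of "{x..}"]
      by (intro borel_measurable_integrable) auto
    show "AE t in lebesgue. norm (indicator {x..x + real n} t *\<^sub>R ?g t) \<le> norm (?g t)" for n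
      by (intro AE_I2) (auto simp: indicator_def)
  qed
  moreover have "(\<integral>t. indicator {x..x + real n} t *\<^sub>R ?g t \<partial>lebesgue) \<le> tail q x ^ Suc j / real (Suc j)" for n
  proof -
    have si: "set_integrable lebesgue {x..x + real n} ?g"
      unfolding set_integrable_def by (intro integrable_mult_indicator integrable_tail_power) auto
    have "(\<integral>t. indicator {x..x + real n} t *\<^sub>R ?g t \<partial>lebesgue) = integral {x..x + real n} ?g"
      using set_lebesgue_integral_eq_integral(2)[OF si] by (simp add: set_lebesgue_integral_def)
    also have "\<dots> = (tail q x ^ Suc j - tail q (x + real n) ^ Suc j) / real (Suc j)"
    proof -
      have "integral {x..x + real n} (\<lambda>t. - real (Suc j) * ?g t) = - real (Suc j) * integral {x..x + real n} ?g"
        by (rule integral_mult_right)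
      then show ?thesis
        using primD(3)[OF prim_tail_power[of j], of x "x + real n"] by (simp add: field_simps)
    qed
    also have "\<dots> \<le> tail q x ^ Suc j / real (Suc j)"
      using tail_nonneg[of "x + real n"] by (intro divide_right_mono) auto
    finally show ?thesis .
  qed
  ultimately have "(\<integral>t. indicator {x..} t *\<^sub>R ?g t \<partial>lebesgue) \<le> tail q x ^ Suc j / real (Suc j)"
    by (intro LIMSEQ_le_const2) auto
  then show ?thesis by simp
qed

end

text \<open>A function that is not integrable has integral 0 by convention, so the integrable
  majorant alone gives the bound.\<close>

lemma norm_lebesgue_integral_le:
  fixes f :: "'a \<Rightarrow> 'b::{banach, second_countable_topology}"
  assumes "integrable M g" "\<And>t. norm (f t) \<le> g t"
  shows "norm (integral\<^sup>L M f) \<le> integral\<^sup>L M g"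
proof (cases "integrable M f")
  case True
  have "norm (integral\<^sup>L M f) \<le> (\<integral>t. norm (f t) \<partial>M)"
    by (rule integral_norm_bound)
  also have "\<dots> \<le> integral\<^sup>L M g"
    using True assms by (intro Bochner_Integration.integral_mono integrable_norm) auto
  finally show ?thesis .
next
  case False
  have "0 \<le> g t" for t using assms(2)[of t] norm_ge_zero order_trans by blast
  then show ?thesis
    using False by (simp add: not_integrable_integral_eq)
qed

section \<open>The Volterra series\<close>

abbreviation half_plane :: "real \<Rightarrow> complex set" where
  "half_plane \<gamma> \<equiv> {k. - \<gamma> < Im k}"

abbreviation hermitian :: "(real \<Rightarrow> complex^'n^'n) \<Rightarrow> bool" where
  "hermitian V \<equiv> AE x in lebesgue. madj (V x) = V x"

definition decays :: "real \<Rightarrow> (real \<Rightarrow> complex^'n^'n) \<Rightarrow> bool" where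
  "decays \<gamma> V \<longleftrightarrow> 0 < \<gamma> \<and> integrable lebesgue (\<lambda>t. exp (2 * \<gamma> * \<bar>t\<bar>) *\<^sub>R V t)"

lemma decays_measurable:
  assumes "decays \<gamma> V"
  shows "V \<in> borel_measurable lebesgue"
proof -
  have "(\<lambda>t. exp (- 2 * \<gamma> * \<bar>t\<bar>) *\<^sub>R exp (2 * \<gamma> * \<bar>t\<bar>) *\<^sub>R V t) \<in> borel_measurable lebesgue"
  proof (rule borel_measurable_scaleR)
    show "(\<lambda>t. exp (- 2 * \<gamma> * \<bar>t\<bar>)) \<in> borel_measurable lebesgue"
      by (intro borel_measurable_lebesgue_continuous continuous_intros)
    show "(\<lambda>t. exp (2 * \<gamma> * \<bar>t\<bar>) *\<^sub>R V t) \<in> borel_measurable lebesgue"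
      using assms by (auto simp: decays_def)
  qed
  then show ?thesis by (simp add: mult_exp_exp)
qed

lemma decays_norm_integrable:
  assumes "decays \<gamma> V"
  shows "integrable lebesgue (\<lambda>t. exp (2 * \<gamma> * \<bar>t\<bar>) * norm (V t))"
  using assms integrable_norm[of lebesgue "\<lambda>t. exp (2 * \<gamma> * \<bar>t\<bar>) *\<^sub>R V t"] by (simp add: decays_def)

lemma decays_integrable:
  assumes "decays \<gamma> V"
  shows "integrable lebesgue V"
proof (rule Bochner_Integration.integrable_bound[OF decays_norm_integrable[OF assms] decays_measurable[OF assms]])
  have "norm (V t) \<le> exp (2 * \<gamma> * \<bar>t\<bar>) * norm (V t)" for t
    using assms mult_right_mono[of 1 "exp (2 * \<gamma> * \<bar>t\<bar>)" "norm (V t)"] by (simp add: decays_def)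
  then show "AE t in lebesgue. norm (V t) \<le> norm (exp (2 * \<gamma> * \<bar>t\<bar>) * norm (V t))"
    by (intro AE_I2) simp
qed

text \<open>One integrable majorant for all x \<ge> x0 and Im k \<ge> -\<eta>: the summand 1 pays
  for the kernel exp(2ik(t-x)), the fraction for \<open>vker\<close>, and the two exponentials
  together dominate exp(2\<gamma>(t-x)).\<close>

definition vmaj :: "real \<Rightarrow> real \<Rightarrow> (real \<Rightarrow> complex^'n^'n) \<Rightarrow> real \<Rightarrow> real \<Rightarrow> real" where
  "vmaj \<eta> \<gamma> V x0 t = (1 + 1 / (2 * (\<gamma> - \<eta>))) * exp (2 * \<gamma> * \<bar>x0\<bar>) * (exp (2 * \<gamma> * \<bar>t\<bar>) * norm (V t))"

lemma vmaj_nonneg: "\<eta> < \<gamma> \<Longrightarrow> 0 \<le> vmaj \<eta> \<gamma> V x0 t"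
  by (simp add: vmaj_def)

lemma vmaj_integrable: "decays \<gamma> V \<Longrightarrow> integrable lebesgue (vmaj \<eta> \<gamma> V x0)"
  unfolding vmaj_def by (intro integrable_mult_right decays_norm_integrable)

lemma exp_max_le:
  fixes \<gamma> :: real
  assumes "0 < \<gamma>" "x0 \<le> x"
  shows "exp (2 * \<gamma> * max 0 (t - x)) \<le> exp (2 * \<gamma> * \<bar>x0\<bar>) * exp (2 * \<gamma> * \<bar>t\<bar>)"
proof -
  have "\<gamma> * max 0 (t - x) \<le> \<gamma> * (\<bar>x0\<bar> + \<bar>t\<bar>)"
    using assms by (intro mult_left_mono) auto
  then show ?thesis by (simp add: mult_exp_exp algebra_simps)
qed

lemma vker_le_vmaj:
  assumes "0 \<le> \<eta>" "\<eta> < \<gamma>" "- \<eta> \<le> Im k" "x0 \<le> x"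
  shows "norm (vker k (t - x)) * norm (V t) \<le> vmaj \<eta> \<gamma> V x0 t"
proof -
  have "norm (vker k (t - x)) \<le> exp (2 * \<gamma> * max 0 (t - x)) / (2 * (\<gamma> - \<eta>))"
    using assms by (intro norm_vker_le_exp) auto
  also have "\<dots> \<le> exp (2 * \<gamma> * \<bar>x0\<bar>) * exp (2 * \<gamma> * \<bar>t\<bar>) / (2 * (\<gamma> - \<eta>))"
    using assms by (intro divide_right_mono exp_max_le) auto
  also have "\<dots> \<le> (1 + 1 / (2 * (\<gamma> - \<eta>))) * exp (2 * \<gamma> * \<bar>x0\<bar>) * exp (2 * \<gamma> * \<bar>t\<bar>)"
    by (simp add: algebra_simps)
  finally have "norm (vker k (t - x)) * norm (V t)
      \<le> (1 + 1 / (2 * (\<gamma> - \<eta>))) * exp (2 * \<gamma> * \<bar>x0\<bar>) * exp (2 * \<gamma> * \<bar>t\<bar>) * norm (V t)"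
    by (rule mult_right_mono) simp
  then show ?thesis by (simp add: vmaj_def mult.assoc)
qed

lemma exp_le_vmaj:
  assumes "0 \<le> \<eta>" "\<eta> < \<gamma>" "- \<eta> \<le> Im k" "x0 \<le> x" "x \<le> t"
  shows "norm (exp (2 * \<i> * k * complex_of_real (t - x))) * norm (V t) \<le> vmaj \<eta> \<gamma> V x0 t"
proof -
  have "norm (exp (2 * \<i> * k * complex_of_real (t - x))) \<le> exp (2 * \<gamma> * max 0 (t - x))"
    using norm_exp_2ik_le[of \<gamma> k "t - x"] assms by simp
  also have "\<dots> \<le> exp (2 * \<gamma> * \<bar>x0\<bar>) * exp (2 * \<gamma> * \<bar>t\<bar>)"
    using assms by (intro exp_max_le) auto
  also have "\<dots> \<le> (1 + 1 / (2 * (\<gamma> - \<eta>))) * (exp (2 * \<gamma> * \<bar>x0\<bar>) * exp (2 * \<gamma> * \<bar>t\<bar>))"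
    using assms by (simp add: mult_right_mono[of 1 "1 + 1 / (2 * (\<gamma> - \<eta>))", simplified])
  also have "\<dots> = (1 + 1 / (2 * (\<gamma> - \<eta>))) * exp (2 * \<gamma> * \<bar>x0\<bar>) * exp (2 * \<gamma> * \<bar>t\<bar>)"
    by (simp only: mult.assoc)
  finally have "norm (exp (2 * \<i> * k * complex_of_real (t - x))) * norm (V t)
      \<le> (1 + 1 / (2 * (\<gamma> - \<eta>))) * exp (2 * \<gamma> * \<bar>x0\<bar>) * exp (2 * \<gamma> * \<bar>t\<bar>) * norm (V t)"
    by (rule mult_right_mono) simp
  then show ?thesis by (simp add: vmaj_def mult.assoc)
qed

definition volt :: "complex \<Rightarrow> (real \<Rightarrow> complex^'n^'n) \<Rightarrow> real \<Rightarrow> complex^'n^'n" where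
  "volt k G x = (\<integral>t. vker k (t - x) \<odot> G t \<partial>lebesgue)"

lemma vker_cscale_measurable:
  assumes "G \<in> borel_measurable lebesgue"
  shows "(\<lambda>t. vker k (t - x) \<odot> G t) \<in> borel_measurable lebesgue"
proof (rule borel_measurable_cscale[OF borel_measurable_lebesgue_continuous assms])
  show "continuous_on UNIV (\<lambda>t. vker k (t - x))"
    by (rule continuous_on_compose2[OF continuous_on_vker[of UNIV k]]) (auto intro!: continuous_intros)
qed

lemma continuous_on_volt:
  assumes G: "G \<in> borel_measurable lebesgue"
    and dom: "\<And>x0. \<exists>q. integrable lebesgue q \<and> (\<forall>x\<ge>x0. \<forall>t. norm (vker k (t - x)) * norm (G t) \<le> q t)"
  shows "continuous_on S (volt k G)"
  unfolding continuous_on_sequentially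
proof (intro allI ballI impI)
  fix X a assume "a \<in> S" and X: "(\<forall>n. X n \<in> S) \<and> X \<longlonglongrightarrow> a"
  then have "Bseq X" using convergentI convergent_imp_Bseq by blast
  then obtain B where B: "\<And>n. \<bar>X n\<bar> \<le> B" unfolding Bseq_def by auto
  obtain q where q: "integrable lebesgue q"
    "\<And>x t. x \<ge> -B \<Longrightarrow> norm (vker k (t - x)) * norm (G t) \<le> q t"
    using dom[of "-B"] by blast
  show "(volt k G \<circ> X) \<longlonglongrightarrow> volt k G a"
    unfolding volt_def o_def
  proof (rule integral_dominated_convergence[OF _ _ q(1)])
    show "AE t in lebesgue. (\<lambda>n. vker k (t - X n) \<odot> G t) \<longlonglongrightarrow> vker k (t - a) \<odot> G t"
    proof (rule AE_I2)
      fix t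
      have "isCont (vker k) (t - a)"
        using continuous_on_vker[of UNIV k] by (simp add: continuous_on_eq_continuous_at)
      then have "(\<lambda>n. vker k (t - X n)) \<longlonglongrightarrow> vker k (t - a)"
        using X by (intro isCont_tendsto_compose[of _ "vker k"]) (auto intro: tendsto_intros)
      then show "(\<lambda>n. vker k (t - X n) \<odot> G t) \<longlonglongrightarrow> vker k (t - a) \<odot> G t"
        by (intro cs.tendsto tendsto_const)
    qed
    show "AE t in lebesgue. norm (vker k (t - X n) \<odot> G t) \<le> q t" for n
      using q(2)[of "X n"] B[of n] by (intro AE_I2) auto
  qed (auto intro: vker_cscale_measurable[OF G])
qed

primrec vit :: "(real \<Rightarrow> complex^'n^'n) \<Rightarrow> complex \<Rightarrow> nat \<Rightarrow> real \<Rightarrow> complex^'n^'n" where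
  "vit V k 0 = (\<lambda>x. mat 1)"
| "vit V k (Suc j) = volt k (\<lambda>t. V t ** vit V k j t)"

text \<open>Since the kernel vanishes for t \<le> x, a bound of \<open>M\<close> on {x0..} dominates
  the integrand on the whole line.\<close>

lemma volterra_dominated:
  fixes V M :: "real \<Rightarrow> complex^'n^'n"
  assumes "norm (vker k (t - x)) * norm (V t) \<le> q t" and "x0 \<le> x" and "0 \<le> q t"
    and "\<And>t. t \<ge> x0 \<Longrightarrow> norm (M t) \<le> C"
  shows "norm (vker k (t - x)) * norm (V t ** M t) \<le> C * q t"
proof (cases "t \<le> x")
  case True
  have "0 \<le> C" using assms(4)[of x0] norm_ge_zero order_trans by blast
  then show ?thesis using True assms by simp
next
  case False
  have "norm (vker k (t - x)) * norm (V t ** M t) \<le> (norm (vker k (t - x)) * norm (V t)) * norm (M t)"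
    using mult_left_mono[OF norm_matrix_mult_le[of "V t" "M t"], of "norm (vker k (t - x))"]
    by (simp add: mult.assoc)
  also have "\<dots> \<le> q t * C"
    using assms False by (intro mult_mono) auto
  finally show ?thesis by (simp add: mult.commute)
qed

lemma vit_continuous_bounded:
  assumes V: "decays \<gamma> V" and k: "- \<gamma> < Im k"
  shows "continuous_on UNIV (vit V k j) \<and> (\<forall>x0. \<exists>C. \<forall>x\<ge>x0. norm (vit V k j x) \<le> C)"
proof (induction j)
  case (Suc j)
  define \<eta> where "\<eta> = max 0 (- Im k)"
  have \<eta>: "0 \<le> \<eta>" "\<eta> < \<gamma>" "- \<eta> \<le> Im k"
    using V k by (auto simp: \<eta>_def decays_def)
  have meas: "(\<lambda>t. V t ** vit V k j t) \<in> borel_measurable lebesgue"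
    using Suc by (intro borel_measurable_matrix_mult decays_measurable[OF V] borel_measurable_lebesgue_continuous) auto
  have dom: "\<exists>q. integrable lebesgue q \<and> (\<forall>x\<ge>x0. \<forall>t. norm (vker k (t - x)) * norm (V t ** vit V k j t) \<le> q t)" for x0
  proof -
    obtain C where C: "\<And>x. x \<ge> x0 \<Longrightarrow> norm (vit V k j x) \<le> C" using Suc by blast
    show ?thesis
    proof (intro exI conjI allI impI)
      show "integrable lebesgue (\<lambda>t. C * vmaj \<eta> \<gamma> V x0 t)"
        using vmaj_integrable[OF V] by simp
      show "norm (vker k (t - x)) * norm (V t ** vit V k j t) \<le> C * vmaj \<eta> \<gamma> V x0 t" if "x \<ge> x0" for x t
        using vker_le_vmaj[OF \<eta> that] that vmaj_nonneg[OF \<eta>(2)] C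
        by (rule volterra_dominated)
    qed
  qed
  show ?case
  proof (intro conjI allI)
    show "continuous_on UNIV (vit V k (Suc j))"
      using continuous_on_volt[OF meas dom] by simp
    fix x0
    from dom[of x0] obtain q where q: "integrable lebesgue q"
      "\<And>x t. x \<ge> x0 \<Longrightarrow> norm (vker k (t - x)) * norm (V t ** vit V k j t) \<le> q t"
      by auto
    have "norm (vit V k (Suc j) x) \<le> integral\<^sup>L lebesgue q" if "x \<ge> x0" for x
      unfolding vit.simps volt_def using q(2)[OF that] by (intro norm_lebesgue_integral_le q(1)) auto
    then show "\<exists>C. \<forall>x\<ge>x0. norm (vit V k (Suc j) x) \<le> C" by blast
  qed
qed auto

text \<open>Induction with \<open>tail_power_integral\<close> produces the factorial. The majorant
  \<open>q\<close> stays free because it is instantiated in two ways: by \<open>vmaj\<close>, valid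
  also below the real axis, and by norm (V t) / norm k in the closed upper half-plane.\<close>

lemma vit_bound:
  fixes V :: "real \<Rightarrow> complex^'n^'n"
  assumes V: "decays \<gamma> V" and k: "- \<gamma> < Im k"
    and q: "integrable lebesgue q" "\<And>t. 0 \<le> q t"
    and dom: "\<And>x t. x \<ge> x0 \<Longrightarrow> norm (vker k (t - x)) * norm (V t) \<le> q t"
    and "x \<ge> x0"
  shows "norm (vit V k j x) \<le> norm (mat 1 :: complex^'n^'n) * tail q x ^ j / fact j"
  using \<open>x \<ge> x0\<close>
proof (induction j arbitrary: x)
  case (Suc j)
  let ?N = "norm (mat 1 :: complex^'n^'n)"
  let ?h = "\<lambda>t. ?N / fact j * (indicator {x..} t * (q t * tail q t ^ j))"
  have int: "integrable lebesgue (\<lambda>t. indicator {x..} t *\<^sub>R (q t * tail q t ^ j))"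
    by (intro integrable_mult_indicator integrable_tail_power[OF q]) auto
  have le: "norm (vker k (t - x) \<odot> (V t ** vit V k j t)) \<le> ?h t" for t
  proof (cases "t \<le> x")
    case False
    have "norm (vker k (t - x) \<odot> (V t ** vit V k j t)) \<le> (norm (vker k (t - x)) * norm (V t)) * norm (vit V k j t)"
      using mult_left_mono[OF norm_matrix_mult_le[of "V t" "vit V k j t"], of "norm (vker k (t - x))"]
      by (simp add: mult.assoc)
    also have "\<dots> \<le> q t * (?N * tail q t ^ j / fact j)"
      using dom[OF Suc.prems, of t] Suc.IH[of t] False Suc.prems q(2)[of t]
      by (intro mult_mono) auto
    finally show ?thesis using False by (simp add: mult_ac)
  qed (simp add: q tail_nonneg[OF q])
  have "norm (vit V k (Suc j) x) \<le> (\<integral>t. ?h t \<partial>lebesgue)"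
    unfolding vit.simps volt_def
    by (rule norm_lebesgue_integral_le) (use int le in auto)
  also have "\<dots> = ?N / fact j * (\<integral>t. indicator {x..} t * (q t * tail q t ^ j) \<partial>lebesgue)"
    by (rule integral_mult_right_zero)
  also have "\<dots> \<le> ?N / fact j * (tail q x ^ Suc j / real (Suc j))"
    by (intro mult_left_mono tail_power_integral[OF q]) auto
  also have "\<dots> = ?N * tail q x ^ Suc j / fact (Suc j)"
    by (simp add: divide_simps)
  finally show ?case .
qed simp

text \<open>\<open>vm V k x\<close> is \<open>e\<^sup>-\<^sup>i\<^sup>k\<^sup>x f\<^sub>+(k,x)\<close>. The kernel \<open>vker\<close> is entire in \<open>k\<close>, so this Volterra
  series makes sense for all \<open>k\<close> with \<open>Im k > - \<gamma>\<close>, including \<open>k = 0\<close>.\<close>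

definition vm :: "(real \<Rightarrow> complex^'n^'n) \<Rightarrow> complex \<Rightarrow> real \<Rightarrow> complex^'n^'n" where
  "vm V k x = (\<Sum>j. vit V k j x)"

lemma vit_sum_bounds:
  fixes V :: "real \<Rightarrow> complex^'n^'n"
  assumes V: "decays \<gamma> V" and k: "- \<gamma> < Im k"
    and q: "integrable lebesgue q" "\<And>t. 0 \<le> q t"
    and dom: "\<And>x t. x \<ge> x0 \<Longrightarrow> norm (vker k (t - x)) * norm (V t) \<le> q t"
    and x: "x \<ge> x0"
  shows "summable (\<lambda>j. norm (vit V k j x))"
    and "norm (\<Sum>j<n. vit V k j x) \<le> norm (mat 1 :: complex^'n^'n) * exp (integral\<^sup>L lebesgue q)"
    and "norm (vm V k x) \<le> norm (mat 1 :: complex^'n^'n) * exp (integral\<^sup>L lebesgue q)"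
proof -
  let ?N = "norm (mat 1 :: complex^'n^'n)" and ?T = "integral\<^sup>L lebesgue q"
  have b: "norm (vit V k j x) \<le> ?N * (?T ^ j /\<^sub>R fact j)" for j
  proof -
    have "tail q x ^ j \<le> ?T ^ j"
      by (rule power_mono[OF tail_le[OF q] tail_nonneg[OF q]])
    then have "?N * tail q x ^ j / fact j \<le> ?N * ?T ^ j / fact j"
      by (intro divide_right_mono mult_left_mono) auto
    then show ?thesis
      using vit_bound[OF V k q dom x, of j] by (simp add: field_simps)
  qed
  have s: "(\<lambda>j. ?N * (?T ^ j /\<^sub>R fact j)) sums (?N * exp ?T)"
    by (intro sums_mult exp_converges)
  show *: "summable (\<lambda>j. norm (vit V k j x))"
    by (rule summable_comparison_test'[OF sums_summable[OF s]]) (use b in auto)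
  have le: "(\<Sum>j. norm (vit V k j x)) \<le> ?N * exp ?T"
    using suminf_le[OF b * sums_summable[OF s]] sums_unique[OF s] by simp
  show "norm (\<Sum>j<n. vit V k j x) \<le> ?N * exp ?T"
    using sum_norm_le[of "{..<n}" "\<lambda>j. vit V k j x" "\<lambda>j. norm (vit V k j x)"] le
      sum_le_suminf[OF *, of "{..<n}"] by fastforce
  show "norm (vm V k x) \<le> ?N * exp ?T"
    unfolding vm_def using summable_norm[OF *] le by linarith
qed

definition vbound :: "real \<Rightarrow> real \<Rightarrow> (real \<Rightarrow> complex^'n^'n) \<Rightarrow> real \<Rightarrow> real" where
  "vbound \<eta> \<gamma> V x0 = norm (mat 1 :: complex^'n^'n) * exp (integral\<^sup>L lebesgue (vmaj \<eta> \<gamma> V x0))"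

lemma vit_sums_vm:
  assumes V: "decays \<gamma> V" and k: "- \<gamma> < Im k"
  shows "(\<lambda>j. vit V k j x) sums vm V k x"
proof -
  define \<eta> where "\<eta> = max 0 (- Im k)"
  have \<eta>: "0 \<le> \<eta>" "\<eta> < \<gamma>" "- \<eta> \<le> Im k"
    using V k by (auto simp: \<eta>_def decays_def)
  have "summable (\<lambda>j. norm (vit V k j x))"
    using vit_sum_bounds(1)[OF V k vmaj_integrable[OF V] vmaj_nonneg[OF \<eta>(2)] vker_le_vmaj[OF \<eta>] order_refl] .
  then show ?thesis
    unfolding vm_def by (rule summable_sums[OF summable_norm_cancel])
qed

lemma vm_le_vbound:
  assumes V: "decays \<gamma> V" and \<eta>: "0 \<le> \<eta>" "\<eta> < \<gamma>" "- \<eta> \<le> Im k" and "x0 \<le> x"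
  shows "norm (vm V k x) \<le> vbound \<eta> \<gamma> V x0"
  unfolding vbound_def
  by (rule vit_sum_bounds(3)[OF V _ vmaj_integrable[OF V] vmaj_nonneg[OF \<eta>(2)] vker_le_vmaj[OF \<eta>] \<open>x0 \<le> x\<close>])
     (use \<eta> in auto)

lemma vm_measurable:
  assumes V: "decays \<gamma> V" and k: "- \<gamma> < Im k"
  shows "vm V k \<in> borel_measurable lebesgue"
proof (rule borel_measurable_LIMSEQ_metric)
  show "(\<lambda>x. \<Sum>j<n. vit V k j x) \<in> borel_measurable lebesgue" for n
    using vit_continuous_bounded[OF V k] by (intro borel_measurable_lebesgue_continuous continuous_intros) auto
  show "(\<lambda>n. \<Sum>j<n. vit V k j x) \<longlonglongrightarrow> vm V k x" for x
    using vit_sums_vm[OF V k] by (simp add: sums_def)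
qed

lemma vm_dominated:
  assumes V: "decays \<gamma> V" and \<eta>: "0 \<le> \<eta>" "\<eta> < \<gamma>" "- \<eta> \<le> Im k" and "x0 \<le> x"
  shows "norm (vker k (t - x)) * norm (V t ** vm V k t) \<le> vbound \<eta> \<gamma> V x0 * vmaj \<eta> \<gamma> V x0 t"
  using vker_le_vmaj[OF \<eta> \<open>x0 \<le> x\<close>] \<open>x0 \<le> x\<close> vmaj_nonneg[OF \<eta>(2)] vm_le_vbound[OF V \<eta>]
  by (rule volterra_dominated)

text \<open>Applying the Volterra operator to a partial sum shifts its index by one; a bound on the
  partial sums that is uniform in their length allows the limit under the integral.\<close>

lemma vm_volterra:
  fixes V :: "real \<Rightarrow> complex^'n^'n"
  assumes V: "decays \<gamma> V" and k: "- \<gamma> < Im k"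
  shows "vm V k x = mat 1 + volt k (\<lambda>t. V t ** vm V k t) x"
proof -
  define \<eta> where "\<eta> = max 0 (- Im k)"
  have \<eta>: "0 \<le> \<eta>" "\<eta> < \<gamma>" "- \<eta> \<le> Im k"
    using V k by (auto simp: \<eta>_def decays_def)
  have vitm: "vit V k j \<in> borel_measurable lebesgue" for j
    using vit_continuous_bounded[OF V k] by (intro borel_measurable_lebesgue_continuous) auto
  have meas: "(\<lambda>t. vker k (t - x) \<odot> (V t ** vit V k j t)) \<in> borel_measurable lebesgue" for j
    by (intro vker_cscale_measurable borel_measurable_matrix_mult decays_measurable[OF V] vitm)
  have int: "integrable lebesgue (\<lambda>t. vker k (t - x) \<odot> (V t ** vit V k j t))" for j
  proof -
    obtain C where C: "\<And>t. t \<ge> x \<Longrightarrow> norm (vit V k j t) \<le> C"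
      using vit_continuous_bounded[OF V k] by blast
    show ?thesis
    proof (rule Bochner_Integration.integrable_bound[OF _ meas])
      show "integrable lebesgue (\<lambda>t. C * vmaj \<eta> \<gamma> V x t)"
        using vmaj_integrable[OF V] by simp
      have "norm (vker k (t - x)) * norm (V t ** vit V k j t) \<le> C * vmaj \<eta> \<gamma> V x t" for t
        using vker_le_vmaj[OF \<eta> order_refl] order_refl vmaj_nonneg[OF \<eta>(2)] C
        by (rule volterra_dominated)
      then show "AE t in lebesgue. norm (vker k (t - x) \<odot> (V t ** vit V k j t)) \<le> norm (C * vmaj \<eta> \<gamma> V x t)"
        by (intro AE_I2) (auto intro: order_trans[OF _ abs_ge_self])
    qed
  qed
  let ?S = "\<lambda>n t. \<Sum>j<n. vit V k j t"
  have "(\<lambda>n. \<integral>t. vker k (t - x) \<odot> (V t ** ?S n t) \<partial>lebesgue)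
      \<longlonglongrightarrow> (\<integral>t. vker k (t - x) \<odot> (V t ** vm V k t) \<partial>lebesgue)"
  proof (rule integral_dominated_convergence)
    show "integrable lebesgue (\<lambda>t. vbound \<eta> \<gamma> V x * vmaj \<eta> \<gamma> V x t)"
      using vmaj_integrable[OF V] by simp
    show "(\<lambda>t. vker k (t - x) \<odot> (V t ** vm V k t)) \<in> borel_measurable lebesgue"
      by (intro vker_cscale_measurable borel_measurable_matrix_mult decays_measurable[OF V] vm_measurable[OF V k])
    show "(\<lambda>t. vker k (t - x) \<odot> (V t ** ?S n t)) \<in> borel_measurable lebesgue" for n
      by (intro vker_cscale_measurable borel_measurable_matrix_mult decays_measurable[OF V] borel_measurable_sum vitm)
    show "AE t in lebesgue. (\<lambda>n. vker k (t - x) \<odot> (V t ** ?S n t)) \<longlonglongrightarrow> vker k (t - x) \<odot> (V t ** vm V k t)"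
      using vit_sums_vm[OF V k] by (intro AE_I2 cs.tendsto mm.tendsto tendsto_const) (simp add: sums_def)
    have Sb: "norm (?S n t) \<le> vbound \<eta> \<gamma> V x" if "t \<ge> x" for n t
      unfolding vbound_def
      by (rule vit_sum_bounds(2)[OF V k vmaj_integrable[OF V] vmaj_nonneg[OF \<eta>(2)] vker_le_vmaj[OF \<eta>] that])
    have "norm (vker k (t - x)) * norm (V t ** ?S n t) \<le> vbound \<eta> \<gamma> V x * vmaj \<eta> \<gamma> V x t" for n t
      using vker_le_vmaj[OF \<eta> order_refl] order_refl vmaj_nonneg[OF \<eta>(2)] Sb
      by (rule volterra_dominated)
    then show "AE t in lebesgue. norm (vker k (t - x) \<odot> (V t ** ?S n t)) \<le> vbound \<eta> \<gamma> V x * vmaj \<eta> \<gamma> V x t" for n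
      by (intro AE_I2) simp
  qed
  moreover have "(\<integral>t. vker k (t - x) \<odot> (V t ** ?S n t) \<partial>lebesgue) = (\<Sum>j<n. vit V k (Suc j) x)" for n
  proof -
    have "(\<integral>t. vker k (t - x) \<odot> (V t ** ?S n t) \<partial>lebesgue) = (\<integral>t. (\<Sum>j<n. vker k (t - x) \<odot> (V t ** vit V k j t)) \<partial>lebesgue)"
      by (simp only: mm.sum_right cs.sum_right)
    also have "\<dots> = (\<Sum>j<n. vit V k (Suc j) x)"
      unfolding vit.simps volt_def by (rule Bochner_Integration.integral_sum) (rule int)
    finally show ?thesis .
  qed
  ultimately have "(\<lambda>j. vit V k (Suc j) x) sums volt k (\<lambda>t. V t ** vm V k t) x"
    by (simp only: sums_def volt_def)
  then have "(\<lambda>j. vit V k j x) sums (volt k (\<lambda>t. V t ** vm V k t) x + vit V k 0 x)"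
    by (rule sums_Suc)
  then show ?thesis
    using vit_sums_vm[OF V k, of x] sums_unique2 by (fastforce simp: add.commute)
qed

text \<open>Unlike \<open>vbound\<close>, this bound is uniform in x on the whole line and stays
  bounded as k tends to infinity, at the price of Im k \<ge> 0.\<close>

lemma vm_upper_bound:
  fixes V :: "real \<Rightarrow> complex^'n^'n"
  assumes V: "decays \<gamma> V" and k: "0 \<le> Im k" "k \<noteq> 0"
  shows "norm (vm V k x) \<le> norm (mat 1 :: complex^'n^'n) * exp ((\<integral>t. norm (V t) \<partial>lebesgue) / norm k)"
proof -
  have "norm (vm V k x) \<le> norm (mat 1 :: complex^'n^'n) * exp (\<integral>t. norm (V t) / norm k \<partial>lebesgue)"
  proof (rule vit_sum_bounds(3)[OF V _ _ _ _ order_refl])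
    show "- \<gamma> < Im k" using V k by (simp add: decays_def)
    show "integrable lebesgue (\<lambda>t. norm (V t) / norm k)"
      using integrable_norm[OF decays_integrable[OF V]] by simp
    show "norm (vker k (t - y)) * norm (V t) \<le> norm (V t) / norm k" for y t
      using mult_right_mono[OF norm_vker_le_inverse[OF k, of "t - y"], of "norm (V t)"] by simp
  qed auto
  then show ?thesis by simp
qed

text \<open>The x-derivative of \<open>vm V k\<close>: differentiating \<open>vker k (t - x)\<close>
  in x leaves - exp(2ik(t-x)).\<close>

definition vn :: "(real \<Rightarrow> complex^'n^'n) \<Rightarrow> complex \<Rightarrow> real \<Rightarrow> complex^'n^'n" where
  "vn V k x = - (LINT t:{x..}|lebesgue. exp (2 * \<i> * k * of_real (t - x)) \<odot> (V t ** vm V k t))"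

lemma exp_cscale_measurable:
  assumes "G \<in> borel_measurable lebesgue"
  shows "(\<lambda>t. exp (2 * \<i> * k * complex_of_real (t - x)) \<odot> G t) \<in> borel_measurable lebesgue"
  by (rule borel_measurable_cscale[OF borel_measurable_lebesgue_continuous assms]) (intro continuous_intros)

lemma vn_integrand_measurable:
  assumes V: "decays \<gamma> V" and k: "- \<gamma> < Im k"
  shows "(\<lambda>t. indicator {x..} t *\<^sub>R (exp (2 * \<i> * k * complex_of_real (t - y)) \<odot> (V t ** vm V k t))) \<in> borel_measurable lebesgue"
proof -
  have "(\<lambda>t. exp (2 * \<i> * k * complex_of_real (t - y)) \<odot> (V t ** vm V k t)) \<in> borel_measurable lebesgue"
    by (intro exp_cscale_measurable borel_measurable_matrix_mult decays_measurable[OF V] vm_measurable[OF V k])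
  then show ?thesis by (intro borel_measurable_scaleR borel_measurable_indicator) auto
qed

lemma vn_dominated:
  assumes V: "decays \<gamma> V" and \<eta>: "0 \<le> \<eta>" "\<eta> < \<gamma>" "- \<eta> \<le> Im k"
  shows "norm (indicator {x..} t *\<^sub>R (exp (2 * \<i> * k * complex_of_real (t - x)) \<odot> (V t ** vm V k t)))
     \<le> vbound \<eta> \<gamma> V x * vmaj \<eta> \<gamma> V x t"
proof (cases "x \<le> t")
  case True
  have "norm (exp (2 * \<i> * k * complex_of_real (t - x)) \<odot> (V t ** vm V k t))
      \<le> (norm (exp (2 * \<i> * k * complex_of_real (t - x))) * norm (V t)) * norm (vm V k t)"
    using mult_left_mono[OF norm_matrix_mult_le[of "V t" "vm V k t"], of "norm (exp (2 * \<i> * k * complex_of_real (t - x)))"]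
    by (simp only: norm_cscale mult.assoc) (simp add: mult.assoc)
  also have "\<dots> \<le> vmaj \<eta> \<gamma> V x t * vbound \<eta> \<gamma> V x"
    using exp_le_vmaj[OF \<eta> order_refl True, of V] vm_le_vbound[OF V \<eta> True] vmaj_nonneg[OF \<eta>(2)]
    by (intro mult_mono) auto
  finally show ?thesis using True by (simp add: mult.commute)
next
  case False
  have "0 \<le> vbound \<eta> \<gamma> V x * vmaj \<eta> \<gamma> V x t"
    using vmaj_nonneg[OF \<eta>(2)] unfolding vbound_def by (intro mult_nonneg_nonneg) auto
  then show ?thesis using False by simp
qed

lemma vn_set_integrable:
  assumes V: "decays \<gamma> V" and k: "- \<gamma> < Im k"
  shows "set_integrable lebesgue {x..} (\<lambda>t. exp (2 * \<i> * k * complex_of_real (t - x)) \<odot> (V t ** vm V k t))"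
proof -
  define \<eta> where "\<eta> = max 0 (- Im k)"
  have \<eta>: "0 \<le> \<eta>" "\<eta> < \<gamma>" "- \<eta> \<le> Im k"
    using V k by (auto simp: \<eta>_def decays_def)
  show ?thesis
    unfolding set_integrable_def
  proof (rule Bochner_Integration.integrable_bound[OF _ vn_integrand_measurable[OF V k]])
    show "integrable lebesgue (\<lambda>t. vbound \<eta> \<gamma> V x * vmaj \<eta> \<gamma> V x t)"
      using vmaj_integrable[OF V] by simp
    show "AE t in lebesgue. norm (indicator {x..} t *\<^sub>R (exp (2 * \<i> * k * complex_of_real (t - x)) \<odot> (V t ** vm V k t)))
        \<le> norm (vbound \<eta> \<gamma> V x * vmaj \<eta> \<gamma> V x t)"
      by (intro AE_I2 order_trans[OF vn_dominated[OF V \<eta>]]) simp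
  qed
qed

text \<open>Local uniformity for the holomorphy proofs: \<open>r\<close> is half the distance of z
  to the boundary line, so Im k stays above some -\<eta> > -\<gamma> on the ball and
  \<open>vmaj \<eta>\<close> serves for all its points.\<close>

lemma strip_ball:
  assumes "- \<gamma> < Im z" "0 < \<gamma>"
  obtains r \<eta> where "0 < r" "0 \<le> \<eta>" "\<eta> < \<gamma>" "ball z r \<subseteq> half_plane \<gamma>" "\<And>k. k \<in> ball z r \<Longrightarrow> - \<eta> \<le> Im k"
proof
  define r where "r = (\<gamma> + Im z) / 2"
  define \<eta> where "\<eta> = max 0 ((\<gamma> - Im z) / 2)"
  show "0 < r" "0 \<le> \<eta>" "\<eta> < \<gamma>" using assms by (auto simp: r_def \<eta>_def)
  have *: "(Im z - \<gamma>) / 2 < Im k" if "k \<in> ball z r" for k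
    using abs_Im_le_cmod[of "z - k"] that by (auto simp: r_def dist_norm field_simps)
  show "ball z r \<subseteq> half_plane \<gamma>"
  proof
    fix k assume "k \<in> ball z r"
    then show "k \<in> half_plane \<gamma>" using *[of k] assms by simp
  qed
  show "- \<eta> \<le> Im k" if "k \<in> ball z r" for k
    using *[OF that] by (simp add: \<eta>_def max_def field_simps)
qed

lemma open_half_plane: "open (half_plane \<gamma>)"
  by (rule open_halfspace_Im_gt)

lemma mhol_vit:
  fixes V :: "real \<Rightarrow> complex^'n^'n"
  assumes V: "decays \<gamma> V"
  shows "mhol (\<lambda>k. vit V k j x) (half_plane \<gamma>)"
proof (induction j arbitrary: x)
  case (Suc j)
  show ?case
    unfolding vit.simps volt_def
  proof (rule mhol_lebesgue_integral)
    show "mhol (\<lambda>k. vker k (t - x) \<odot> (V t ** vit V k j t)) (half_plane \<gamma>)" for t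
      by (intro mhol_cscale holomorphic_on_vker mhol_mult mhol_const Suc)
    show "(\<lambda>t. vker k (t - x) \<odot> (V t ** vit V k j t)) \<in> borel_measurable lebesgue"
      if "k \<in> half_plane \<gamma>" for k
      using vit_continuous_bounded[OF V, of k] that
      by (intro vker_cscale_measurable borel_measurable_matrix_mult decays_measurable[OF V]
          borel_measurable_lebesgue_continuous) auto
    fix z assume z: "z \<in> half_plane \<gamma>"
    then obtain r \<eta> where r: "0 < r" "0 \<le> \<eta>" "\<eta> < \<gamma>" "ball z r \<subseteq> half_plane \<gamma>"
      "\<And>k. k \<in> ball z r \<Longrightarrow> - \<eta> \<le> Im k"
      using V by (auto simp: decays_def elim: strip_ball[of \<gamma> z])
    let ?q = "vmaj \<eta> \<gamma> V x"
    let ?C = "norm (mat 1 :: complex^'n^'n) * integral\<^sup>L lebesgue ?q ^ j / fact j"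
    have q: "integrable lebesgue ?q" "\<And>t. 0 \<le> ?q t"
      using vmaj_integrable[OF V] vmaj_nonneg[OF r(3)] by auto
    have "norm (vker k (t - x)) * norm (V t ** vit V k j t) \<le> ?C * ?q t" if k: "k \<in> ball z r" for k t
      using vker_le_vmaj[OF r(2,3) r(5)[OF k] order_refl] order_refl q(2)
    proof (rule volterra_dominated)
      fix t assume "x \<le> t"
      have "- \<gamma> < Im k" using r(4) k by auto
      from vit_bound[OF V this q vker_le_vmaj[OF r(2,3) r(5)[OF k]] \<open>x \<le> t\<close>, of j]
      have "norm (vit V k j t) \<le> norm (mat 1 :: complex^'n^'n) * tail ?q t ^ j / fact j" .
      also have "\<dots> \<le> ?C"
        by (intro divide_right_mono mult_left_mono power_mono tail_le[OF q] tail_nonneg[OF q]) auto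
      finally show "norm (vit V k j t) \<le> ?C" .
    qed
    then show "\<exists>r>0. \<exists>h. ball z r \<subseteq> half_plane \<gamma> \<and> integrable lebesgue h \<and>
        (\<forall>k\<in>ball z r. \<forall>t. norm (vker k (t - x) \<odot> (V t ** vit V k j t)) \<le> h t)"
      using r q by (intro exI[of _ r] conjI exI[of _ "\<lambda>t. ?C * ?q t"]) auto
  qed
qed (simp add: mhol_const)

lemma mhol_vm:
  fixes V :: "real \<Rightarrow> complex^'n^'n"
  assumes V: "decays \<gamma> V"
  shows "mhol (\<lambda>k. vm V k x) (half_plane \<gamma>)"
  unfolding vm_def
proof (rule mhol_suminf[OF open_half_plane mhol_vit[OF V]])
  fix z assume z: "z \<in> half_plane \<gamma>"
  then obtain r \<eta> where r: "0 < r" "0 \<le> \<eta>" "\<eta> < \<gamma>" "ball z r \<subseteq> half_plane \<gamma>"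
    "\<And>k. k \<in> ball z r \<Longrightarrow> - \<eta> \<le> Im k"
    using V by (auto simp: decays_def elim: strip_ball[of \<gamma> z])
  let ?q = "vmaj \<eta> \<gamma> V x"
  let ?M = "\<lambda>j. norm (mat 1 :: complex^'n^'n) * (tail ?q x ^ j /\<^sub>R fact j)"
  have q: "integrable lebesgue ?q" "\<And>t. 0 \<le> ?q t"
    using vmaj_integrable[OF V] vmaj_nonneg[OF r(3)] by auto
  have "summable ?M"
    by (rule sums_summable[OF sums_mult[OF exp_converges]])
  moreover have "norm (vit V k j x) \<le> ?M j" if k: "k \<in> ball z r" for k j
  proof -
    have "- \<gamma> < Im k" using r(4) k by auto
    then have "norm (vit V k j x) \<le> norm (mat 1 :: complex^'n^'n) * tail ?q x ^ j / fact j"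
      by (rule vit_bound[OF V _ q vker_le_vmaj[OF r(2,3) r(5)[OF k]] order_refl])
    then show ?thesis by (simp add: divide_inverse mult_ac)
  qed
  ultimately show "\<exists>r>0. \<exists>M. ball z r \<subseteq> half_plane \<gamma> \<and> summable M \<and> (\<forall>k\<in>ball z r. \<forall>j. norm (vit V k j x) \<le> M j)"
    using r by (intro exI[of _ r] conjI exI[of _ ?M]) auto
qed

lemma mhol_vn:
  fixes V :: "real \<Rightarrow> complex^'n^'n"
  assumes V: "decays \<gamma> V"
  shows "mhol (\<lambda>k. vn V k x) (half_plane \<gamma>)"
proof -
  have "mhol (\<lambda>k. \<integral>t. indicator {x..} t *\<^sub>R (exp (2 * \<i> * k * complex_of_real (t - x)) \<odot> (V t ** vm V k t)) \<partial>lebesgue)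
      (half_plane \<gamma>)"
  proof (rule mhol_lebesgue_integral)
    fix t
    have "mhol (\<lambda>k. exp (2 * \<i> * k * complex_of_real (t - x)) \<odot> (V t ** vm V k t)) (half_plane \<gamma>)"
      by (intro mhol_cscale mhol_mult mhol_const mhol_vm[OF V] holomorphic_intros)
    then show "mhol (\<lambda>k. indicator {x..} t *\<^sub>R (exp (2 * \<i> * k * complex_of_real (t - x)) \<odot> (V t ** vm V k t))) (half_plane \<gamma>)"
      by (cases "x \<le> t") (auto simp: mhol_const)
  next
    fix z assume z: "z \<in> half_plane \<gamma>"
    then obtain r \<eta> where r: "0 < r" "0 \<le> \<eta>" "\<eta> < \<gamma>" "ball z r \<subseteq> half_plane \<gamma>"
      "\<And>k. k \<in> ball z r \<Longrightarrow> - \<eta> \<le> Im k"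
      using V by (auto simp: decays_def elim: strip_ball[of \<gamma> z])
    show "\<exists>r>0. \<exists>h. ball z r \<subseteq> half_plane \<gamma> \<and> integrable lebesgue h \<and> (\<forall>k\<in>ball z r. \<forall>t.
        norm (indicator {x..} t *\<^sub>R (exp (2 * \<i> * k * complex_of_real (t - x)) \<odot> (V t ** vm V k t))) \<le> h t)"
    proof (intro exI[of _ r] conjI exI[of _ "\<lambda>t. vbound \<eta> \<gamma> V x * vmaj \<eta> \<gamma> V x t"] ballI allI)
      show "integrable lebesgue (\<lambda>t. vbound \<eta> \<gamma> V x * vmaj \<eta> \<gamma> V x t)"
        using vmaj_integrable[OF V] by simp
      show "norm (indicator {x..} t *\<^sub>R (exp (2 * \<i> * k * complex_of_real (t - x)) \<odot> (V t ** vm V k t)))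
          \<le> vbound \<eta> \<gamma> V x * vmaj \<eta> \<gamma> V x t" if "k \<in> ball z r" for k t
        by (rule vn_dominated[OF V r(2,3) r(5)[OF that]])
    qed (use r in auto)
  qed (use vn_integrand_measurable[OF V] in auto)
  then have "mhol (\<lambda>k. (-1) \<odot> (\<integral>t. indicator {x..} t *\<^sub>R (exp (2 * \<i> * k * complex_of_real (t - x)) \<odot> (V t ** vm V k t)) \<partial>lebesgue))
      (half_plane \<gamma>)"
    by (intro mhol_cscale) auto
  moreover have "(-1) \<odot> M = - M" for M :: "complex^'n^'n"
    by (simp add: vec_eq_iff)
  ultimately show ?thesis
    by (simp add: vn_def set_lebesgue_integral_def)
qed

declare cs.zero_left [simp] cs.zero_right [simp] mm.zero_left [simp] mm.zero_right [simp]

section \<open>The Jost solutions\<close>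

lemma prim_exp: "prim (\<lambda>x. exp (c * complex_of_real x)) (\<lambda>x. c * exp (c * complex_of_real x))"
proof (rule prim_if_has_vector_derivative)
  fix x
  have "((\<lambda>z. exp (c * z)) has_field_derivative c * exp (c * complex_of_real x)) (at (complex_of_real x))"
    by (auto intro!: derivative_eq_intros)
  then show "((\<lambda>x. exp (c * complex_of_real x)) has_vector_derivative c * exp (c * complex_of_real x)) (at x)"
    by (rule has_vector_derivative_real_field)
qed (intro continuous_intros)

lemma vm_set_integrable:
  assumes V: "decays \<gamma> V" and k: "- \<gamma> < Im k"
  shows "set_integrable lebesgue {x..} (\<lambda>t. V t ** vm V k t)"
proof -
  define \<eta> where "\<eta> = max 0 (- Im k)"
  have \<eta>: "0 \<le> \<eta>" "\<eta> < \<gamma>" "- \<eta> \<le> Im k"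
    using V k by (auto simp: \<eta>_def decays_def)
  show ?thesis
    unfolding set_integrable_def
  proof (rule Bochner_Integration.integrable_bound)
    show "integrable lebesgue (\<lambda>t. vbound \<eta> \<gamma> V x * norm (V t))"
      using integrable_norm[OF decays_integrable[OF V]] by simp
    show "(\<lambda>t. indicator {x..} t *\<^sub>R (V t ** vm V k t)) \<in> borel_measurable lebesgue"
      by (intro borel_measurable_scaleR borel_measurable_indicator borel_measurable_matrix_mult
          decays_measurable[OF V] vm_measurable[OF V k]) auto
    have "norm (indicator {x..} t *\<^sub>R (V t ** vm V k t)) \<le> vbound \<eta> \<gamma> V x * norm (V t)" for t
    proof (cases "x \<le> t")
      case True
      have "norm (V t ** vm V k t) \<le> norm (V t) * norm (vm V k t)"
        by (rule norm_matrix_mult_le)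
      also have "\<dots> \<le> norm (V t) * vbound \<eta> \<gamma> V x"
        using vm_le_vbound[OF V \<eta> True] by (intro mult_left_mono) auto
      finally show ?thesis using True by (simp add: mult.commute)
    next
      case False
      have "0 \<le> vbound \<eta> \<gamma> V x" by (simp add: vbound_def)
      then show ?thesis using False by simp
    qed
    then show "AE t in lebesgue. norm (indicator {x..} t *\<^sub>R (V t ** vm V k t)) \<le> norm (vbound \<eta> \<gamma> V x * norm (V t))"
      by (intro AE_I2) (auto intro: order_trans[OF _ abs_ge_self])
  qed
qed

lemma set_integral_cscale:
  fixes f :: "real \<Rightarrow> complex^'n^'n"
  assumes "set_integrable lebesgue S f"
  shows "(LINT t:S|lebesgue. c \<odot> f t) = c \<odot> (LINT t:S|lebesgue. f t)"
    and "set_integrable lebesgue S (\<lambda>t. c \<odot> f t)"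
proof -
  have i: "integrable lebesgue (\<lambda>t. indicator S t *\<^sub>R f t)"
    using assms by (simp add: set_integrable_def)
  have e: "indicator S t *\<^sub>R (c \<odot> f t) = c \<odot> (indicator S t *\<^sub>R f t)" for t
    by (simp add: cs.scaleR_right)
  show "(LINT t:S|lebesgue. c \<odot> f t) = c \<odot> (LINT t:S|lebesgue. f t)"
    unfolding set_lebesgue_integral_def e by (rule integral_bounded_linear[OF cs.bounded_linear_right i])
  show "set_integrable lebesgue S (\<lambda>t. c \<odot> f t)"
    unfolding set_integrable_def e by (rule integrable_bounded_linear[OF cs.bounded_linear_right i])
qed

context
  fixes V :: "real \<Rightarrow> complex^'n^'n" and \<gamma> :: real and k :: complex
  assumes V: "decays \<gamma> V" and k: "- \<gamma> < Im k" and k0: "k \<noteq> 0"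
begin

text \<open>Splitting \<open>vker\<close> into its exponential and its constant part leaves
  \<open>vn\<close> and an integral whose integrand is free of x; both can be differentiated as
  tails.\<close>

lemma vm_eq_vn:
  "vm V k x = mat 1 + (1 / (2 * \<i> * k)) \<odot> (- vn V k x - (LINT t:{x..}|lebesgue. V t ** vm V k t))"
proof -
  let ?G = "\<lambda>t. V t ** vm V k t" and ?E = "\<lambda>t. exp (2 * \<i> * k * complex_of_real (t - x))"
  have "volt k ?G x = (LINT t:{x..}|lebesgue. (1 / (2 * \<i> * k)) \<odot> (?E t \<odot> ?G t - ?G t))"
    unfolding volt_def set_lebesgue_integral_def
  proof (rule Bochner_Integration.integral_cong[OF refl])
    fix t
    show "vker k (t - x) \<odot> ?G t = indicator {x..} t *\<^sub>R ((1 / (2 * \<i> * k)) \<odot> (?E t \<odot> ?G t - ?G t))"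
    proof (cases "x \<le> t")
      case True
      then have v: "vker k (t - x) = (1 / (2 * \<i> * k)) * (?E t - 1)"
        using vker_eq[OF k0, of "t - x"] by simp
      show ?thesis
        unfolding v cscale_cscale[symmetric] cs.diff_left cscale_one using True by simp
    qed simp
  qed
  also have "\<dots> = (1 / (2 * \<i> * k)) \<odot> (LINT t:{x..}|lebesgue. ?E t \<odot> ?G t - ?G t)"
    by (rule set_integral_cscale(1)[OF set_integral_diff(1)[OF vn_set_integrable[OF V k] vm_set_integrable[OF V k]]])
  also have "(LINT t:{x..}|lebesgue. ?E t \<odot> ?G t - ?G t) = - vn V k x - (LINT t:{x..}|lebesgue. ?G t)"
    unfolding vn_def by (simp only: set_integral_diff(2)[OF vn_set_integrable[OF V k] vm_set_integrable[OF V k]] minus_minus)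
  finally show ?thesis
    using vm_volterra[OF V k, of x] by simp
qed

lemma prim_vn: "prim (vn V k) (\<lambda>x. V x ** vm V k x - (2 * \<i> * k) \<odot> vn V k x)"
proof -
  let ?G = "\<lambda>t. V t ** vm V k t"
  \<comment> \<open>Pulling exp(-2ikx) out of \<open>vn\<close> leaves a tail whose integrand does
    not depend on x, so \<open>prim_tail\<close> and the product rule apply.\<close>
  define P where "P = (\<lambda>x. LINT t:{x..}|lebesgue. exp (2 * \<i> * k * complex_of_real t) \<odot> ?G t)"
  have si: "set_integrable lebesgue {x..} (\<lambda>t. exp (2 * \<i> * k * complex_of_real t) \<odot> ?G t)" for x
  proof -
    have "set_integrable lebesgue {x..} (\<lambda>t. exp (2 * \<i> * k * complex_of_real x) \<odot> exp (2 * \<i> * k * complex_of_real (t - x)) \<odot> ?G t)"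
      by (rule set_integral_cscale(2)[OF vn_set_integrable[OF V k]])
    then show ?thesis by (simp add: mult_exp_exp algebra_simps)
  qed
  have vn_eq: "vn V k x = - (exp (- 2 * \<i> * k * complex_of_real x) \<odot> P x)" for x
  proof -
    have "exp (2 * \<i> * k * complex_of_real (t - x)) \<odot> ?G t
       = exp (- 2 * \<i> * k * complex_of_real x) \<odot> (exp (2 * \<i> * k * complex_of_real t) \<odot> ?G t)" for t
      by (simp add: mult_exp_exp algebra_simps)
    then show ?thesis
      unfolding vn_def P_def by (simp only: set_integral_cscale(1)[OF si])
  qed
  have "prim P (\<lambda>t. - (exp (2 * \<i> * k * complex_of_real t) \<odot> ?G t))"
    unfolding P_def by (rule prim_tail[OF si])
  from prim_minus[OF prim_bilinear[OF cs.bounded_bilinear_axioms prim_exp[of "- 2 * \<i> * k"] this]]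
  have 1: "prim (vn V k) (\<lambda>x. - (exp (- 2 * \<i> * k * complex_of_real x) \<odot> - (exp (2 * \<i> * k * complex_of_real x) \<odot> ?G x)
      + (- 2 * \<i> * k * exp (- 2 * \<i> * k * complex_of_real x)) \<odot> P x))"
    by (simp only: vn_eq[abs_def])
  have 2: "- (exp (- 2 * \<i> * k * complex_of_real x) \<odot> - (exp (2 * \<i> * k * complex_of_real x) \<odot> ?G x)
      + (- 2 * \<i> * k * exp (- 2 * \<i> * k * complex_of_real x)) \<odot> P x) = ?G x - (2 * \<i> * k) \<odot> vn V k x" for x
  proof -
    have e: "exp (- 2 * \<i> * k * complex_of_real x) * exp (2 * \<i> * k * complex_of_real x) = 1"
      by (simp add: mult_exp_exp)
    show ?thesis
      unfolding vn_eq cs.minus_right cscale_cscale e by (simp add: vec_eq_iff algebra_simps)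
  qed
  show ?thesis using 1 unfolding 2 .
qed

lemma prim_vm: "prim (vm V k) (vn V k)"
proof -
  have "prim (\<lambda>x. mat 1 + (1 / (2 * \<i> * k)) \<odot> (- vn V k x - (LINT t:{x..}|lebesgue. V t ** vm V k t)))
     (\<lambda>x. 0 + (1 / (2 * \<i> * k)) \<odot> (- (V x ** vm V k x - (2 * \<i> * k) \<odot> vn V k x) - - (V x ** vm V k x)))"
    by (intro prim_add prim_const prim_linear[OF cs.bounded_linear_right] prim_diff prim_minus prim_vn
        prim_tail vm_set_integrable[OF V k])
  moreover have "0 + (1 / (2 * \<i> * k)) \<odot> (- (V x ** vm V k x - (2 * \<i> * k) \<odot> vn V k x) - - (V x ** vm V k x)) = vn V k x" for x
    using k0 by (simp add: vec_eq_iff field_simps)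
  ultimately show ?thesis
    by (simp only: vm_eq_vn[symmetric])
qed

end

text \<open>\<open>jf\<close> is \<open>f\<^sub>+\<close> and \<open>jf'\<close> its derivative; likewise \<open>gm\<close> and \<open>gm'\<close> below for \<open>f\<^sub>-\<close>, which is the
  \<open>f\<^sub>+\<close> of the reflected potential.\<close>

definition jf :: "(real \<Rightarrow> complex^'n^'n) \<Rightarrow> complex \<Rightarrow> real \<Rightarrow> complex^'n^'n" where
  "jf V k x = exp (\<i> * k * of_real x) \<odot> vm V k x"

definition jf' :: "(real \<Rightarrow> complex^'n^'n) \<Rightarrow> complex \<Rightarrow> real \<Rightarrow> complex^'n^'n" where
  "jf' V k x = exp (\<i> * k * of_real x) \<odot> ((\<i> * k) \<odot> vm V k x + vn V k x)"

text \<open>The equation -y'' + V y = k^2 y as a first-order system. The derivative is carried as a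
  separate function, so that Wronskians are built from pointwise data only.\<close>

definition solves :: "(real \<Rightarrow> complex^'n^'n) \<Rightarrow> complex \<Rightarrow> (real \<Rightarrow> complex^'n^'n) \<Rightarrow> (real \<Rightarrow> complex^'n^'n) \<Rightarrow> bool" where
  "solves V k y y' \<longleftrightarrow> prim y y' \<and> prim y' (\<lambda>x. V x ** y x - k\<^sup>2 \<odot> y x)"

lemma solves_jf:
  assumes V: "decays \<gamma> V" and k: "- \<gamma> < Im k" and k0: "k \<noteq> 0"
  shows "solves V k (jf V k) (jf' V k)"
  unfolding solves_def
proof
  let ?e = "\<lambda>x. exp (\<i> * k * complex_of_real x)"
  note vm = prim_vm[OF V k k0] and vn = prim_vn[OF V k k0]
  have "prim (\<lambda>x. ?e x \<odot> vm V k x) (\<lambda>x. ?e x \<odot> vn V k x + (\<i> * k * ?e x) \<odot> vm V k x)"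
    by (rule prim_bilinear[OF cs.bounded_bilinear_axioms prim_exp vm])
  moreover have "?e x \<odot> vn V k x + (\<i> * k * ?e x) \<odot> vm V k x = jf' V k x" for x
    by (simp add: jf'_def vec_eq_iff algebra_simps)
  ultimately show "prim (jf V k) (jf' V k)"
    by (simp only: jf_def[abs_def])
  have "prim (\<lambda>x. ?e x \<odot> ((\<i> * k) \<odot> vm V k x + vn V k x))
     (\<lambda>x. ?e x \<odot> ((\<i> * k) \<odot> vn V k x + (V x ** vm V k x - (2 * \<i> * k) \<odot> vn V k x))
        + (\<i> * k * ?e x) \<odot> ((\<i> * k) \<odot> vm V k x + vn V k x))"
    by (intro prim_bilinear[OF cs.bounded_bilinear_axioms prim_exp] prim_add
        prim_linear[OF cs.bounded_linear_right] vm vn)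
  moreover have "?e x \<odot> ((\<i> * k) \<odot> vn V k x + (V x ** vm V k x - (2 * \<i> * k) \<odot> vn V k x))
        + (\<i> * k * ?e x) \<odot> ((\<i> * k) \<odot> vm V k x + vn V k x) = V x ** jf V k x - k\<^sup>2 \<odot> jf V k x" for x
    unfolding jf_def cscale_mult_right by (simp add: vec_eq_iff power2_eq_square algebra_simps)
  ultimately show "prim (jf' V k) (\<lambda>x. V x ** jf V k x - k\<^sup>2 \<odot> jf V k x)"
    by (simp only: jf'_def[abs_def])
qed

lemma jf_has_vector_derivative:
  assumes V: "decays \<gamma> V" and k: "- \<gamma> < Im k" and k0: "k \<noteq> 0"
  shows "(jf V k has_vector_derivative jf' V k x) (at x)"
  using solves_jf[OF assms] unfolding solves_def
  by (intro prim_has_vector_derivative prim_continuous) auto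

lemma jost_kernel_eq_vker:
  assumes "k \<noteq> 0" "x \<le> t"
  shows "jost_kernel k (t - x) = exp (\<i> * k * of_real x) * vker k (t - x) * exp (- (\<i> * k * of_real t))"
proof -
  have "exp (\<i> * k * of_real x) * (exp (2 * \<i> * k * of_real (t - x)) - 1) * exp (- (\<i> * k * of_real t))
    = exp (\<i> * (k * of_real (t - x))) - exp (- (\<i> * (k * of_real (t - x))))"
    by (simp add: algebra_simps mult_exp_exp)
  then show ?thesis
    using assms by (simp add: jost_kernel_def vker_eq sin_exp_eq divide_simps) (simp add: mult_ac)
qed

lemma is_jost_plus_jf:
  assumes V: "decays \<gamma> V" and k: "0 \<le> Im k" and k0: "k \<noteq> 0"
  shows "is_jost_plus V k (jf V k)"
  unfolding is_jost_plus_def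
proof (intro conjI allI)
  have \<gamma>: "0 < \<gamma>" and k': "- \<gamma> < Im k" using V k by (auto simp: decays_def)
  fix x
  let ?h = "\<lambda>t. vker k (t - x) \<odot> (V t ** vm V k t)"
  have "integrable lebesgue ?h"
  proof (rule Bochner_Integration.integrable_bound)
    show "integrable lebesgue (\<lambda>t. vbound 0 \<gamma> V x * vmaj 0 \<gamma> V x t)"
      using vmaj_integrable[OF V] by simp
    show "?h \<in> borel_measurable lebesgue"
      by (intro vker_cscale_measurable borel_measurable_matrix_mult decays_measurable[OF V] vm_measurable[OF V k'])
    show "AE t in lebesgue. norm (?h t) \<le> norm (vbound 0 \<gamma> V x * vmaj 0 \<gamma> V x t)"
      using vm_dominated[OF V order_refl \<gamma> _ order_refl, of k] k
      by (intro AE_I2) (auto intro: order_trans[OF _ abs_ge_self])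
  qed
  then have "(?h has_integral volt k (\<lambda>t. V t ** vm V k t) x) UNIV"
    unfolding volt_def by (rule has_integral_integral_lebesgue)
  then have "((\<lambda>t. exp (\<i> * k * of_real x) \<odot> ?h t) has_integral exp (\<i> * k * of_real x) \<odot> volt k (\<lambda>t. V t ** vm V k t) x) UNIV"
    by (rule has_integral_linear[OF _ cs.bounded_linear_right, unfolded o_def])
  moreover have "exp (\<i> * k * of_real x) \<odot> volt k (\<lambda>t. V t ** vm V k t) x = jf V k x - mat (exp (\<i> * k * of_real x))"
    using vm_volterra[OF V k', of x] by (simp add: jf_def cs.add_right mat_eq_cscale[of "exp (\<i> * k * of_real x)"])
  \<comment> \<open>The cut-off of \<open>vker\<close> at t = x turns the integral over the line
    into the integral over {x..} of the Jost equation.\<close>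
  moreover have "exp (\<i> * k * of_real x) \<odot> ?h t = (if t \<in> {x..} then mat (jost_kernel k (t - x)) ** V t ** jf V k t else 0)" for t
  proof (cases "x \<le> t")
    case True
    have "jost_kernel k (t - x) * exp (\<i> * k * of_real t)
        = exp (\<i> * k * of_real x) * vker k (t - x) * (exp (- (\<i> * k * of_real t)) * exp (\<i> * k * of_real t))"
      unfolding jost_kernel_eq_vker[OF k0 True] by (simp only: mult.assoc)
    then have "jost_kernel k (t - x) * exp (\<i> * k * of_real t) = exp (\<i> * k * of_real x) * vker k (t - x)"
      by (simp add: mult_exp_exp)
    then show ?thesis using True by (simp add: jf_def mult.commute)
  qed simp
  ultimately have "((\<lambda>t. if t \<in> {x..} then mat (jost_kernel k (t - x)) ** V t ** jf V k t else 0)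
      has_integral (jf V k x - mat (exp (\<i> * k * of_real x)))) UNIV"
    by (simp only:)
  then show "((\<lambda>t. mat (jost_kernel k (t - x)) ** V t ** jf V k t) has_integral (jf V k x - mat (exp (\<i> * k * of_real x)))) {x..}"
    by (simp only: has_integral_restrict_UNIV)
next
  have "mat (exp (- \<i> * k * of_real x)) ** jf V k x = vm V k x" for x
    by (simp add: jf_def mult_exp_exp)
  then show "bounded ((\<lambda>x. mat (exp (- \<i> * k * of_real x)) ** jf V k x) ` {0..})"
    using vm_upper_bound[OF V k k0] by (auto simp: bounded_iff)
qed

section \<open>Uniqueness of the Jost solutions\<close>

text \<open>Iterating the homogeneous equation improves the bound C to C tail^j / j! for every j.
  The gauge integral is kept, as in the definition of a Jost solution.\<close>

lemma volterra_zero: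
  fixes V w :: "real \<Rightarrow> complex^'n^'n"
  assumes V: "decays \<gamma> V" and k: "0 \<le> Im k" and k0: "k \<noteq> 0"
    and bnd: "\<And>x. x \<ge> x0 \<Longrightarrow> norm (w x) \<le> C"
    and eq: "\<And>x. x \<ge> x0 \<Longrightarrow> ((\<lambda>t. vker k (t - x) \<odot> (V t ** w t)) has_integral w x) {x..}"
    and x: "x \<ge> x0"
  shows "w x = 0"
proof -
  define q where "q = (\<lambda>t. norm (V t) / norm k)"
  have q: "integrable lebesgue q" "\<And>t. 0 \<le> q t"
    using integrable_norm[OF decays_integrable[OF V]] by (auto simp: q_def)
  have "norm (w x) \<le> C * tail q x ^ j / fact j" if "x \<ge> x0" for j x
    using that
  proof (induction j arbitrary: x)
    case (Suc j)
    let ?g = "\<lambda>t. C / fact j * (q t * tail q t ^ j)"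
    have si: "set_integrable lebesgue {x..} (\<lambda>t. q t * tail q t ^ j)"
      unfolding set_integrable_def by (intro integrable_mult_indicator integrable_tail_power[OF q]) auto
    then have gi: "?g integrable_on {x..}"
      using set_lebesgue_integral_eq_integral(1) integrable_on_mult_right by blast
    have "norm (integral {x..} (\<lambda>t. vker k (t - x) \<odot> (V t ** w t))) \<le> integral {x..} ?g"
    proof (rule Henstock_Kurzweil_Integration.integral_norm_bound_integral[OF _ gi])
      show "(\<lambda>t. vker k (t - x) \<odot> (V t ** w t)) integrable_on {x..}"
        using eq[OF Suc.prems] by blast
      fix t assume "t \<in> {x..}"
      then have t: "x0 \<le> t" using Suc.prems by simp
      have "norm (vker k (t - x) \<odot> (V t ** w t)) \<le> norm (vker k (t - x)) * (norm (V t) * norm (w t))"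
        by (simp add: mult_left_mono norm_matrix_mult_le)
      also have "\<dots> \<le> 1 / norm k * (norm (V t) * (C * tail q t ^ j / fact j))"
        using norm_vker_le_inverse[OF k k0] Suc.IH[OF t] by (intro mult_mono) auto
      finally show "norm (vker k (t - x) \<odot> (V t ** w t)) \<le> ?g t"
        by (simp add: q_def mult_ac)
    qed
    then have "norm (w x) \<le> C / fact j * integral {x..} (\<lambda>t. q t * tail q t ^ j)"
      using integral_unique[OF eq[OF Suc.prems]] by simp
    also have "integral {x..} (\<lambda>t. q t * tail q t ^ j) = (\<integral>t. indicator {x..} t * (q t * tail q t ^ j) \<partial>lebesgue)"
      using set_lebesgue_integral_eq_integral(2)[OF si] by (simp add: set_lebesgue_integral_def)
    also have "C / fact j * \<dots> \<le> C / fact j * (tail q x ^ Suc j / real (Suc j))"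
    proof (intro mult_left_mono tail_power_integral[OF q])
      show "0 \<le> C / fact j"
        using order_trans[OF norm_ge_zero bnd[OF Suc.prems]] by simp
    qed
    also have "\<dots> = C * tail q x ^ Suc j / fact (Suc j)"
      by (simp add: divide_simps)
    finally show ?case .
  qed (use bnd in auto)
  then have *: "norm (w x) \<le> C * (tail q x ^ j /\<^sub>R fact j)" for j
    using x by (simp add: divide_inverse mult_ac)
  have "(\<lambda>j. tail q x ^ j /\<^sub>R fact j) \<longlonglongrightarrow> 0"
    by (rule summable_LIMSEQ_zero[OF sums_summable[OF exp_converges]])
  then have "(\<lambda>j. C * (tail q x ^ j /\<^sub>R fact j)) \<longlonglongrightarrow> C * 0"
    by (intro tendsto_mult tendsto_const)
  then have "norm (w x) \<le> C * 0"
    by (rule LIMSEQ_le_const) (use * in auto)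
  then show ?thesis by simp
qed

text \<open>As functions of t all kernels sin(k(t-x))/k lie in the space spanned by those at x0 and
  x0 - \<delta>; this is the identity sin(a-b) sin d = sin(b+d) sin a - sin b sin(a+d).\<close>

lemma jost_kernel_addition:
  assumes "k \<noteq> 0" and s: "sin (k * of_real \<delta>) \<noteq> 0"
  shows "jost_kernel k (t - x) = sin (k * of_real (x - x0 + \<delta>)) / sin (k * of_real \<delta>) * jost_kernel k (t - x0)
     - sin (k * of_real (x - x0)) / sin (k * of_real \<delta>) * jost_kernel k (t - (x0 - \<delta>))"
proof -
  let ?a = "k * complex_of_real (t - x0)" and ?b = "k * complex_of_real (x - x0)" and ?d = "k * complex_of_real \<delta>"
  have "sin (a - b) * sin d = sin (b + d) * sin a - sin b * sin (a + d)" for a b d :: complex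
    by (simp add: sin_add sin_diff algebra_simps)
  from this[of ?a ?b ?d] have "sin (?a - ?b) * sin ?d = sin (?b + ?d) * sin ?a - sin ?b * sin (?a + ?d)" .
  moreover have "k * complex_of_real (t - x) = ?a - ?b" "k * complex_of_real (x - x0 + \<delta>) = ?b + ?d"
    "k * complex_of_real (t - (x0 - \<delta>)) = ?a + ?d"
    by (simp_all add: algebra_simps)
  ultimately show ?thesis
    using assms by (simp only: jost_kernel_def if_False) (simp add: divide_simps)
qed

text \<open>The gauge integral in the Volterra equation does not provide local boundedness of a
  solution; it follows because the kernels at two base points generate all others.\<close>

lemma is_jost_plus_unique:
  fixes V :: "real \<Rightarrow> complex^'n^'n"
  assumes V: "decays \<gamma> V" and k: "0 \<le> Im k" and k0: "k \<noteq> 0"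
    and f1: "is_jost_plus V k f1" and f2: "is_jost_plus V k f2"
  shows "f1 = f2"
proof -
  define g where "g = (\<lambda>x. f1 x - f2 x)"
  define G where "G = (\<lambda>t. V t ** g t)"
  define w where "w = (\<lambda>x. exp (- (\<i> * k * of_real x)) \<odot> g x)"
  have gint: "((\<lambda>t. jost_kernel k (t - x) \<odot> G t) has_integral g x) {x..}" for x
  proof -
    have "((\<lambda>t. mat (jost_kernel k (t - x)) ** V t ** f1 t - mat (jost_kernel k (t - x)) ** V t ** f2 t) has_integral
       (f1 x - mat (exp (\<i> * k * of_real x))) - (f2 x - mat (exp (\<i> * k * of_real x)))) {x..}"
      using f1 f2 unfolding is_jost_plus_def by (intro has_integral_diff) auto
    then show ?thesis
      by (simp add: g_def G_def mm.diff_right cs.diff_right)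
  qed
  have weq: "((\<lambda>t. vker k (t - x) \<odot> (V t ** w t)) has_integral w x) {x..}" for x
  proof -
    have "((\<lambda>t. exp (- (\<i> * k * of_real x)) \<odot> jost_kernel k (t - x) \<odot> G t) has_integral w x) {x..}"
      unfolding w_def by (rule has_integral_linear[OF gint cs.bounded_linear_right, unfolded o_def])
    then show ?thesis
    proof (rule has_integral_eq[rotated])
      fix t assume "t \<in> {x..}"
      then have "exp (- (\<i> * k * of_real x)) * jost_kernel k (t - x) = vker k (t - x) * exp (- (\<i> * k * of_real t))"
        using jost_kernel_eq_vker[OF k0, of x t] by (simp flip: mult.assoc add: mult_exp_exp)
      then show "exp (- (\<i> * k * of_real x)) \<odot> jost_kernel k (t - x) \<odot> G t = vker k (t - x) \<odot> (V t ** w t)"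
        by (simp add: G_def w_def)
    qed
  qed
  obtain C1 where C1: "\<And>x. x \<ge> 0 \<Longrightarrow> norm (exp (- (\<i> * k * of_real x)) \<odot> f1 x) \<le> C1"
    using f1 unfolding is_jost_plus_def bounded_iff by auto
  obtain C2 where C2: "\<And>x. x \<ge> 0 \<Longrightarrow> norm (exp (- (\<i> * k * of_real x)) \<odot> f2 x) \<le> C2"
    using f2 unfolding is_jost_plus_def bounded_iff by auto
  \<comment> \<open>On the positive half-line boundedness is part of the definition of a Jost
    solution.\<close>
  have w0: "w x = 0" if "x \<ge> 0" for x
  proof (rule volterra_zero[OF V k k0 _ weq that])
    fix x :: real assume "x \<ge> 0"
    have e: "w x = exp (- (\<i> * k * of_real x)) \<odot> f1 x - exp (- (\<i> * k * of_real x)) \<odot> f2 x"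
      by (simp add: w_def g_def cs.diff_right)
    show "norm (w x) \<le> C1 + C2"
      unfolding e using norm_triangle_ineq4[of "exp (- (\<i> * k * of_real x)) \<odot> f1 x" "exp (- (\<i> * k * of_real x)) \<odot> f2 x"]
        C1[OF \<open>x \<ge> 0\<close>] C2[OF \<open>x \<ge> 0\<close>] by linarith
  qed
  have gw: "g x = exp (\<i> * k * of_real x) \<odot> w x" for x
    by (simp add: w_def mult_exp_exp)
  have "w x0 = 0" if "x0 < 0" for x0
  proof -
    \<comment> \<open>Then |k \<delta>| = 1 < pi, while the zeros of sin are the integer multiples
      of pi, so sin(k \<delta>) is not 0.\<close>
    define \<delta> where "\<delta> = 1 / norm k"
    have "\<delta> > 0" using k0 by (simp add: \<delta>_def)
    have s: "sin (k * of_real \<delta>) \<noteq> 0"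
    proof
      assume "sin (k * of_real \<delta>) = 0"
      then obtain n :: int where "k * of_real \<delta> = of_real (n * pi)" by (auto simp: sin_eq_0)
      then have "norm (k * of_real \<delta>) = \<bar>of_int n\<bar> * pi" by (simp add: norm_mult)
      moreover have "norm (k * of_real \<delta>) = 1" using k0 by (simp add: \<delta>_def norm_mult norm_divide)
      ultimately have "\<bar>of_int n\<bar> * pi = 1" by simp
      moreover have "n \<noteq> 0" using calculation by auto
      then have "1 \<le> \<bar>of_int n :: real\<bar>" by linarith
      then have "pi \<le> \<bar>of_int n\<bar> * pi" by simp
      ultimately show False using pi_gt3 by linarith
    qed
    have sub: "((\<lambda>t. jost_kernel k (t - y) \<odot> G t) integrable_on {x0..0})" if "y \<le> x0" for y
      by (rule integrable_on_subinterval[of _ "{y..}"]) (use gint that in auto)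
    define I where "I = (\<lambda>y x. integral {x..0} (\<lambda>t. jost_kernel k (t - y) \<odot> G t))"
    \<comment> \<open>The integrands on the right are fixed functions of t and only the lower limit
      x moves, so this formula makes \<open>g\<close> continuous, hence bounded, on {x0..0}. The
      upper limit is 0 because \<open>G\<close> vanishes on the positive half-line.\<close>
    have gx: "g x = (sin (k * of_real (x - x0 + \<delta>)) / sin (k * of_real \<delta>)) \<odot> I x0 x
        - (sin (k * of_real (x - x0)) / sin (k * of_real \<delta>)) \<odot> I (x0 - \<delta>) x" if x: "x \<in> {x0..0}" for x
    proof -
      have "G t = 0" if "t > 0" for t
        using w0[of t] that by (simp add: G_def gw)
      then have eq: "(\<lambda>t. if t \<in> {x..} then jost_kernel k (t - x) \<odot> G t else 0) = (\<lambda>t. if t \<in> {x..0} then jost_kernel k (t - x) \<odot> G t else 0)"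
        by auto
      have "((\<lambda>t. if t \<in> {x..} then jost_kernel k (t - x) \<odot> G t else 0) has_integral g x) UNIV"
        using gint[of x] by (simp only: has_integral_restrict_UNIV)
      then have 1: "((\<lambda>t. jost_kernel k (t - x) \<odot> G t) has_integral g x) {x..0}"
        unfolding eq by (simp only: has_integral_restrict_UNIV)
      have int: "((\<lambda>t. jost_kernel k (t - y) \<odot> G t) has_integral I y x) {x..0}" if "y \<le> x0" for y
        unfolding I_def by (rule integrable_integral, rule integrable_on_subinterval[OF sub[OF that]]) (use x in auto)
      have 2: "((\<lambda>t. (sin (k * of_real (x - x0 + \<delta>)) / sin (k * of_real \<delta>)) \<odot> (jost_kernel k (t - x0) \<odot> G t)
        - (sin (k * of_real (x - x0)) / sin (k * of_real \<delta>)) \<odot> (jost_kernel k (t - (x0 - \<delta>)) \<odot> G t)) has_integral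
         ((sin (k * of_real (x - x0 + \<delta>)) / sin (k * of_real \<delta>)) \<odot> I x0 x
        - (sin (k * of_real (x - x0)) / sin (k * of_real \<delta>)) \<odot> I (x0 - \<delta>) x)) {x..0}"
        using \<open>\<delta> > 0\<close>
        by (intro has_integral_diff has_integral_linear[OF int cs.bounded_linear_right, unfolded o_def]) auto
      have 3: "(sin (k * of_real (x - x0 + \<delta>)) / sin (k * of_real \<delta>)) \<odot> (jost_kernel k (t - x0) \<odot> G t)
        - (sin (k * of_real (x - x0)) / sin (k * of_real \<delta>)) \<odot> (jost_kernel k (t - (x0 - \<delta>)) \<odot> G t)
        = jost_kernel k (t - x) \<odot> G t" for t
        unfolding jost_kernel_addition[OF k0 s, of t x x0] by (simp only: cs.diff_left cscale_cscale)
      show ?thesis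
        using has_integral_unique[OF 1 2[unfolded 3]] .
    qed
    have Ic: "continuous_on {x0..0} (I y)" if "y \<le> x0" for y
      unfolding I_def by (rule indefinite_integral_continuous_1'[OF sub[OF that]])
    have "continuous_on {x0..0} (\<lambda>x. (sin (k * of_real (x - x0 + \<delta>)) / sin (k * of_real \<delta>)) \<odot> I x0 x
        - (sin (k * of_real (x - x0)) / sin (k * of_real \<delta>)) \<odot> I (x0 - \<delta>) x)"
      using s \<open>\<delta> > 0\<close> by (intro continuous_on_diff cs.continuous_on Ic continuous_intros) auto
    then have gc: "continuous_on {x0..0} g"
      by (rule continuous_on_eq) (use gx in auto)
    have "continuous_on {x0..0} w"
      unfolding w_def by (intro cs.continuous_on gc continuous_intros)
    then have "bounded (w ` {x0..0})"
      by (intro compact_imp_bounded compact_continuous_image) auto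
    then obtain C where "\<forall>y\<in>w ` {x0..0}. norm y \<le> C"
      unfolding bounded_iff by blast
    then have C: "norm (w x) \<le> C" if "x \<in> {x0..0}" for x
      using that by blast
    have "norm (w x) \<le> max C 0" if "x \<ge> x0" for x
      using C[of x] w0[of x] that by (cases "x \<ge> 0") auto
    then show "w x0 = 0"
      by (rule volterra_zero[OF V k k0 _ weq order_refl])
  qed
  with w0 have "w x = 0" for x by (meson not_le)
  then have "g x = 0" for x by (simp add: gw)
  then show ?thesis by (auto simp: g_def fun_eq_iff)
qed

lemma jost_plus_eq:
  assumes V: "decays \<gamma> V" and k: "0 \<le> Im k" and k0: "k \<noteq> 0"
  shows "jost_plus V k = jf V k"
  unfolding jost_plus_def
proof (rule the_equality)
  show "is_jost_plus V k (jf V k)" by (rule is_jost_plus_jf[OF assms])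
  show "f = jf V k" if "is_jost_plus V k f" for f
    using is_jost_plus_unique[OF assms that is_jost_plus_jf[OF assms]] .
qed

section \<open>Reflection of the line and the left Jost solution\<close>

definition refl_pot :: "(real \<Rightarrow> complex^'n^'n) \<Rightarrow> real \<Rightarrow> complex^'n^'n" where
  "refl_pot V x = V (- x)"

lemma decays_refl_pot:
  assumes "decays \<gamma> V"
  shows "decays \<gamma> (refl_pot V)"
  using assms lebesgue_integrable_real_affine[of "\<lambda>t. exp (2 * \<gamma> * \<bar>t\<bar>) *\<^sub>R V t" "-1" 0]
  by (simp add: decays_def refl_pot_def)

lemma has_integral_reflect_UNIV:
  fixes f :: "real \<Rightarrow> 'a::euclidean_space"
  assumes "(f has_integral y) UNIV"
  shows "((\<lambda>x. f (- x)) has_integral y) UNIV"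
proof (subst has_integral_alt', intro conjI allI impI)
  note * = assms[unfolded has_integral_alt'[of f y UNIV]]
  fix a b :: real
  show "(\<lambda>x. if x \<in> UNIV then f (- x) else 0) integrable_on cbox a b"
    using * integrable_reflect[of f "-a" "-b"] by simp
next
  note * = assms[unfolded has_integral_alt'[of f y UNIV]]
  fix e :: real assume "e > 0"
  then obtain B where B: "B > 0" "\<And>a b. ball 0 B \<subseteq> cbox a b \<Longrightarrow> norm (integral (cbox a b) f - y) < e"
    using * by auto
  show "\<exists>B>0. \<forall>a b. ball 0 B \<subseteq> cbox a b \<longrightarrow> norm (integral (cbox a b) (\<lambda>x. if x \<in> UNIV then f (- x) else 0) - y) < e"
  proof (intro exI[of _ B] conjI allI impI)
    fix a b :: real assume ab: "ball 0 B \<subseteq> cbox a b"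
    have "ball 0 B \<subseteq> cbox (- b) (- a)"
    proof
      fix x :: real assume "x \<in> ball 0 B"
      then have "- x \<in> ball 0 B" by simp
      then have "- x \<in> cbox a b" using ab by blast
      then show "x \<in> cbox (- b) (- a)" by auto
    qed
    then show "norm (integral (cbox a b) (\<lambda>x. if x \<in> UNIV then f (- x) else 0) - y) < e"
      using B(2) Henstock_Kurzweil_Integration.integral_reflect[where a="-b" and b="-a" and f=f] by simp
  qed (rule B(1))
qed

lemma has_integral_reflect_atMost:
  fixes f :: "real \<Rightarrow> 'a::euclidean_space"
  shows "(f has_integral y) {..x} \<longleftrightarrow> ((\<lambda>t. f (- t)) has_integral y) {- x..}"
proof -
  let ?F = "\<lambda>t. if t \<in> {..x} then f t else 0"
  have "(f has_integral y) {..x} \<longleftrightarrow> (?F has_integral y) UNIV"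
    by (simp only: has_integral_restrict_UNIV)
  also have "\<dots> \<longleftrightarrow> ((\<lambda>t. ?F (- t)) has_integral y) UNIV"
    using has_integral_reflect_UNIV[of ?F y] has_integral_reflect_UNIV[of "\<lambda>t. ?F (- t)" y]
    unfolding minus_minus by blast
  also have "(\<lambda>t. ?F (- t)) = (\<lambda>t. if t \<in> {- x..} then f (- t) else 0)"
    by (auto simp: fun_eq_iff)
  finally show ?thesis by (simp only: has_integral_restrict_UNIV)
qed

lemma is_jost_minus_iff: "is_jost_minus V k f \<longleftrightarrow> is_jost_plus (refl_pot V) k (\<lambda>x. f (- x))"
proof -
  have 1: "(\<forall>x. ((\<lambda>t. mat (jost_kernel k (x - t)) ** V t ** f t) has_integral (f x - mat (exp (- \<i> * k * of_real x)))) {..x})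
    \<longleftrightarrow> (\<forall>x. ((\<lambda>t. mat (jost_kernel k (t - x)) ** refl_pot V t ** f (- t)) has_integral (f (- x) - mat (exp (\<i> * k * of_real x)))) {x..})"
    (is "(\<forall>x. ?P x) \<longleftrightarrow> (\<forall>x. ?Q x)")
  proof -
    have *: "?P (- x) \<longleftrightarrow> ?Q x" for x
      unfolding has_integral_reflect_atMost[of _ _ "- x"] by (simp add: refl_pot_def add.commute)
    show ?thesis
    proof (intro iffI allI)
      fix x assume "\<forall>x. ?P x"
      then show "?Q x" using * by blast
    next
      fix x assume "\<forall>x. ?Q x"
      then have "?Q (- x)" by blast
      then show "?P x" using *[of "- x"] unfolding minus_minus by blast
    qed
  qed
  have 2: "(\<lambda>x. mat (exp (\<i> * k * of_real x)) ** f x) ` {..0} = (\<lambda>x. mat (exp (- \<i> * k * of_real x)) ** f (- x)) ` {0..}"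
    (is "?g ` _ = ?h ` _")
  proof -
    have "{..0::real} = uminus ` {0..}" by simp
    then show ?thesis
      by (simp only: image_image of_real_minus mult_minus_left mult_minus_right)
  qed
  show ?thesis
    unfolding is_jost_minus_def is_jost_plus_def 1 2 ..
qed

lemma jost_minus_eq:
  assumes V: "decays \<gamma> V" and k: "0 \<le> Im k" and k0: "k \<noteq> 0"
  shows "jost_minus V k = (\<lambda>x. jf (refl_pot V) k (- x))"
  unfolding jost_minus_def
proof (rule the_equality)
  note V' = decays_refl_pot[OF V]
  show "is_jost_minus V k (\<lambda>x. jf (refl_pot V) k (- x))"
    using is_jost_plus_jf[OF V' k k0] by (simp add: is_jost_minus_iff)
  fix f assume "is_jost_minus V k f"
  then have "(\<lambda>x. f (- x)) = jf (refl_pot V) k"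
    using is_jost_plus_unique[OF V' k k0 _ is_jost_plus_jf[OF V' k k0]] by (simp add: is_jost_minus_iff)
  then show "f = (\<lambda>x. jf (refl_pot V) k (- x))"
    by (metis minus_minus)
qed

section \<open>Bounds and limits at infinity in the closed upper half-plane\<close>

definition vC :: "(real \<Rightarrow> complex^'n^'n) \<Rightarrow> complex \<Rightarrow> real" where
  "vC V k = norm (mat 1 :: complex^'n^'n) * exp ((\<integral>t. norm (V t) \<partial>lebesgue) / norm k)"

lemma vC_nonneg: "0 \<le> vC V k"
  by (simp add: vC_def)

context
  fixes V :: "real \<Rightarrow> complex^'n^'n" and \<gamma> :: real and k :: complex
  assumes V: "decays \<gamma> V" and k: "0 \<le> Im k" and k0: "k \<noteq> 0"
begin

lemma norm_mult_vm_le: "norm (V t ** vm V k t) \<le> vC V k * norm (V t)"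
proof -
  have "norm (V t ** vm V k t) \<le> norm (V t) * norm (vm V k t)"
    by (rule norm_matrix_mult_le)
  also have "\<dots> \<le> norm (V t) * vC V k"
    using vm_upper_bound[OF V k k0, of t] by (intro mult_left_mono) (auto simp: vC_def)
  finally show ?thesis by (simp add: mult.commute)
qed

lemma vm_sub_one_le_tail:
  "norm (vm V k x - mat 1) \<le> vC V k / norm k * tail (\<lambda>t. norm (V t)) x"
proof -
  have k': "- \<gamma> < Im k" using V k by (auto simp: decays_def)
  have "norm (volt k (\<lambda>t. V t ** vm V k t) x) \<le> (\<integral>t. vC V k / norm k * (indicator {x..} t *\<^sub>R norm (V t)) \<partial>lebesgue)"
    unfolding volt_def
  proof (rule norm_lebesgue_integral_le)
    show "integrable lebesgue (\<lambda>t. vC V k / norm k * (indicator {x..} t *\<^sub>R norm (V t)))"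
      using integrable_norm[OF decays_integrable[OF V]]
      by (intro integrable_mult_right integrable_mult_indicator) auto
    show "norm (vker k (t - x) \<odot> (V t ** vm V k t)) \<le> vC V k / norm k * (indicator {x..} t *\<^sub>R norm (V t))" for t
    proof (cases "x \<le> t")
      case True
      have "norm (vker k (t - x)) * norm (V t ** vm V k t) \<le> 1 / norm k * (vC V k * norm (V t))"
        using norm_vker_le_inverse[OF k k0] norm_mult_vm_le by (intro mult_mono) auto
      then show ?thesis using True by simp
    qed simp
  qed
  also have "\<dots> = vC V k / norm k * tail (\<lambda>t. norm (V t)) x"
    by (simp add: tail_def set_lebesgue_integral_def)
  finally show ?thesis
    using vm_volterra[OF V k', of x] by simp
qed

lemma vn_le_tail: "norm (vn V k x) \<le> vC V k * tail (\<lambda>t. norm (V t)) x"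
proof -
  have "norm (vn V k x) \<le> (\<integral>t. vC V k * (indicator {x..} t *\<^sub>R norm (V t)) \<partial>lebesgue)"
    unfolding vn_def set_lebesgue_integral_def norm_minus_cancel
  proof (rule norm_lebesgue_integral_le)
    show "integrable lebesgue (\<lambda>t. vC V k * (indicator {x..} t *\<^sub>R norm (V t)))"
      using integrable_norm[OF decays_integrable[OF V]]
      by (intro integrable_mult_right integrable_mult_indicator) auto
    show "norm (indicator {x..} t *\<^sub>R exp (2 * \<i> * k * complex_of_real (t - x)) \<odot> (V t ** vm V k t))
        \<le> vC V k * (indicator {x..} t *\<^sub>R norm (V t))" for t
    proof (cases "x \<le> t")
      case True
      have "norm (exp (2 * \<i> * k * complex_of_real (t - x))) \<le> 1"
        using True k by simp
      then have "norm (exp (2 * \<i> * k * complex_of_real (t - x))) * norm (V t ** vm V k t) \<le> 1 * (vC V k * norm (V t))"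
        using norm_mult_vm_le by (intro mult_mono) auto
      then show ?thesis using True by (simp del: norm_exp_eq_Re)
    qed simp
  qed
  also have "\<dots> = vC V k * tail (\<lambda>t. norm (V t)) x"
    by (simp add: tail_def set_lebesgue_integral_def)
  finally show ?thesis .
qed

lemma tail_norm_tendsto_0: "((\<lambda>x. c * tail (\<lambda>t. norm (V t)) x) \<longlongrightarrow> 0) at_top"
proof -
  have "set_integrable lebesgue {0..} (\<lambda>t. norm (V t))"
    using integrable_norm[OF decays_integrable[OF V]] by (intro set_integrable_tail) auto
  from tendsto_mult[OF tendsto_const[of c] tail_tendsto_0[OF this]]
  show ?thesis by (simp add: tail_def)
qed

lemma vm_tendsto: "(vm V k \<longlongrightarrow> mat 1) at_top"
proof (rule Lim_null[THEN iffD2], rule Lim_null_comparison[OF _ tail_norm_tendsto_0])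
  show "\<forall>\<^sub>F x in at_top. norm (vm V k x - mat 1) \<le> vC V k / norm k * tail (\<lambda>t. norm (V t)) x"
    by (intro always_eventually allI vm_sub_one_le_tail)
qed

lemma vn_tendsto: "(vn V k \<longlongrightarrow> 0) at_top"
proof (rule Lim_null_comparison[OF _ tail_norm_tendsto_0])
  show "\<forall>\<^sub>F x in at_top. norm (vn V k x) \<le> vC V k * tail (\<lambda>t. norm (V t)) x"
    by (intro always_eventually allI vn_le_tail)
qed

lemma tail_norm_le: "tail (\<lambda>t. norm (V t)) x \<le> (\<integral>t. norm (V t) \<partial>lebesgue)"
  using integrable_norm[OF decays_integrable[OF V]] by (intro tail_le) auto

lemma vm_sub_one_le: "norm (vm V k x - mat 1) \<le> vC V k / norm k * (\<integral>t. norm (V t) \<partial>lebesgue)"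
  by (rule order_trans[OF vm_sub_one_le_tail mult_left_mono[OF tail_norm_le]]) (simp add: vC_nonneg)

lemma vn_le: "norm (vn V k x) \<le> vC V k * (\<integral>t. norm (V t) \<partial>lebesgue)"
  by (rule order_trans[OF vn_le_tail mult_left_mono[OF tail_norm_le]]) (simp add: vC_nonneg)

end

section \<open>Wronskians\<close>

definition wr :: "complex^'n^'n \<Rightarrow> complex^'n^'n \<Rightarrow> complex^'n^'n \<Rightarrow> complex^'n^'n \<Rightarrow> complex^'n^'n" where
  "wr y y' z z' = madj y ** z' - madj y' ** z"

lemma madj_zero [simp]: "madj 0 = 0"
  by (simp add: vec_eq_iff)

lemma madj_add: "madj (A + B) = madj A + madj B"
  by (simp add: vec_eq_iff)

lemma madj_diff: "madj (A - B) = madj A - madj B"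
  by (simp add: vec_eq_iff)

lemma madj_minus: "madj (- A) = - madj A"
  by (simp add: vec_eq_iff)

lemma wr_comb_right:
  "wr y y' (z ** A + w ** B) (z' ** A + w' ** B) = wr y y' z z' ** A + wr y y' w w' ** B"
  by (simp add: wr_def mm.add_right mm.diff_left matrix_mul_assoc)

lemma wr_comb_left:
  "wr (y ** A + z ** B) (y' ** A + z' ** B) u u' = madj A ** wr y y' u u' + madj B ** wr z z' u u'"
  by (simp add: wr_def madj_add madj_mult mm.add_left mm.diff_right matrix_mul_assoc)

text \<open>The potential terms cancel where \<open>V x\<close> is hermitian, which holds almost
  everywhere; \<open>prim_cong_AE\<close> discards the exceptional set.\<close>

lemma prim_wr:
  assumes herm: "hermitian V"
    and y: "solves V k y y'" and z: "solves V l z z'"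
  shows "prim (\<lambda>x. wr (y x) (y' x) (z x) (z' x)) (\<lambda>x. (cnj (k\<^sup>2) - l\<^sup>2) \<odot> (madj (y x) ** z x))"
proof -
  note b = mm.bounded_bilinear_axioms and adj = prim_linear[OF bounded_linear_madj]
  have "prim (\<lambda>x. madj (y x) ** z' x - madj (y' x) ** z x)
     (\<lambda>x. (madj (y x) ** (V x ** z x - l\<^sup>2 \<odot> z x) + madj (y' x) ** z' x)
        - (madj (y' x) ** z' x + madj (V x ** y x - k\<^sup>2 \<odot> y x) ** z x))"
    using y z unfolding solves_def by (intro prim_diff prim_bilinear[OF b] adj) auto
  then have "prim (\<lambda>x. madj (y x) ** z' x - madj (y' x) ** z x) (\<lambda>x. (cnj (k\<^sup>2) - l\<^sup>2) \<odot> (madj (y x) ** z x))"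
  proof (rule prim_cong_AE)
    show "AE x in lebesgue. (madj (y x) ** (V x ** z x - l\<^sup>2 \<odot> z x) + madj (y' x) ** z' x)
        - (madj (y' x) ** z' x + madj (V x ** y x - k\<^sup>2 \<odot> y x) ** z x) = (cnj (k\<^sup>2) - l\<^sup>2) \<odot> (madj (y x) ** z x)"
      using herm
    proof eventually_elim
      fix x assume h: "madj (V x) = V x"
      show "(madj (y x) ** (V x ** z x - l\<^sup>2 \<odot> z x) + madj (y' x) ** z' x)
        - (madj (y' x) ** z' x + madj (V x ** y x - k\<^sup>2 \<odot> y x) ** z x) = (cnj (k\<^sup>2) - l\<^sup>2) \<odot> (madj (y x) ** z x)"
        unfolding madj_diff madj_mult h mm.diff_right mm.diff_left madj_cscale cscale_mult_left cscale_mult_right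
          matrix_mul_assoc cs.diff_left by simp
    qed
  qed
  then show ?thesis by (simp add: wr_def)
qed

lemma wr_const:
  assumes herm: "hermitian V"
    and y: "solves V k y y'" and z: "solves V l z z'" and kl: "cnj (k\<^sup>2) = l\<^sup>2"
  shows "wr (y x) (y' x) (z x) (z' x) = wr (y x0) (y' x0) (z x0) (z' x0)"
  using prim_wr[OF herm y z] kl by (intro prim_zero_const[where u="\<lambda>x. wr (y x) (y' x) (z x) (z' x)"]) simp

text \<open>A constant Wronskian is computed at plus infinity, where \<open>vm\<close> tends to 1
  and \<open>vn\<close> to 0.\<close>

lemma wr_eq_limit:
  assumes "hermitian V"
    and "solves V k y y'" and "solves V l z z'" and "cnj (k\<^sup>2) = l\<^sup>2"
    and lim: "((\<lambda>x. wr (y x) (y' x) (z x) (z' x)) \<longlongrightarrow> L) at_top"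
  shows "wr (y x) (y' x) (z x) (z' x) = L"
proof -
  have "(\<lambda>t. wr (y t) (y' t) (z t) (z' t)) = (\<lambda>_. wr (y x) (y' x) (z x) (z' x))"
    by (rule ext) (rule wr_const[OF assms(1-4)])
  then have "((\<lambda>_::real. wr (y x) (y' x) (z x) (z' x)) \<longlongrightarrow> L) at_top"
    using lim by (simp only:)
  then show ?thesis by (simp add: tendsto_const_iff)
qed

lemma tendsto_madj: "(f \<longlongrightarrow> L) F \<Longrightarrow> ((\<lambda>x. madj (f x)) \<longlongrightarrow> madj L) F"
  by (rule bounded_linear.tendsto[OF bounded_linear_madj])

lemma cnj_exp_ik: "cnj (exp (\<i> * (- cnj k) * of_real x)) = exp (\<i> * k * of_real x)"
  by (simp add: exp_cnj)

text \<open>Both factors carry the same exponential and the terms with ik cancel, so what multiplies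
  exp(2ikx) tends to 0 because \<open>vn\<close> does. For real k the exponential is only bounded,
  and this suffices.\<close>

lemma wr_jf_minus_cnj:
  assumes herm: "hermitian V"
    and V: "decays \<gamma> V" and k: "0 \<le> Im k" and k0: "k \<noteq> 0"
  shows "wr (jf V (- cnj k) x) (jf' V (- cnj k) x) (jf V k x) (jf' V k x) = 0"
proof (rule wr_eq_limit[OF herm, where y="jf V (- cnj k)" and z="jf V k"])
  let ?l = "- cnj k"
  have l: "0 \<le> Im ?l" "?l \<noteq> 0" using k k0 by auto
  have \<gamma>: "- \<gamma> < Im k" "- \<gamma> < Im ?l" using V k by (auto simp: decays_def)
  show "solves V ?l (jf V ?l) (jf' V ?l)" by (rule solves_jf[OF V \<gamma>(2) l(2)])
  show "solves V k (jf V k) (jf' V k)" by (rule solves_jf[OF V \<gamma>(1) k0])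
  show "cnj (?l\<^sup>2) = k\<^sup>2" by simp
  have eq: "wr (jf V ?l x) (jf' V ?l x) (jf V k x) (jf' V k x)
     = exp (2 * \<i> * k * of_real x) \<odot> (madj (vm V ?l x) ** vn V k x - madj (vn V ?l x) ** vm V k x)" for x
  proof -
    have 1: "exp (2 * \<i> * k * of_real x) = exp (\<i> * k * of_real x) * exp (\<i> * k * of_real x)"
      by (simp add: mult_exp_exp mult.assoc)
    have 2: "cnj (\<i> * ?l) = \<i> * k" by simp
    show ?thesis
      unfolding wr_def jf_def jf'_def madj_cscale madj_add cnj_exp_ik 1 2 mm.add_left mm.add_right cscale_mult_left
        cscale_mult_right cs.add_right cs.diff_right cscale_cscale
      by (simp add: algebra_simps exp_cnj)
  qed
  have "((\<lambda>x. madj (vm V ?l x) ** vn V k x - madj (vn V ?l x) ** vm V k x) \<longlongrightarrow> madj (mat 1) ** 0 - madj 0 ** mat 1) at_top"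
    by (intro tendsto_diff mm.tendsto tendsto_madj vm_tendsto[OF V] vn_tendsto[OF V] k k0 l)
  then have "((\<lambda>x. madj (vm V ?l x) ** vn V k x - madj (vn V ?l x) ** vm V k x) \<longlongrightarrow> 0) at_top"
    by (simp add: madj_zero)
  then have lim: "((\<lambda>x. norm (madj (vm V ?l x) ** vn V k x - madj (vn V ?l x) ** vm V k x)) \<longlongrightarrow> 0) at_top"
    by (rule tendsto_norm_zero)
  show "((\<lambda>x. wr (jf V ?l x) (jf' V ?l x) (jf V k x) (jf' V k x)) \<longlongrightarrow> 0) at_top"
  proof (rule Lim_null_comparison[OF _ lim])
    show "\<forall>\<^sub>F x in at_top. norm (wr (jf V ?l x) (jf' V ?l x) (jf V k x) (jf' V k x))
        \<le> norm (madj (vm V ?l x) ** vn V k x - madj (vn V ?l x) ** vm V k x)"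
      using eventually_ge_at_top[of "0::real"]
    proof eventually_elim
      fix x :: real assume "0 \<le> x"
      then have "norm (exp (2 * \<i> * k * of_real x)) \<le> 1" using k by simp
      then show "norm (wr (jf V ?l x) (jf' V ?l x) (jf V k x) (jf' V k x))
        \<le> norm (madj (vm V ?l x) ** vn V k x - madj (vn V ?l x) ** vm V k x)"
        unfolding eq norm_cscale by (intro mult_left_le_one_le) auto
    qed
  qed
qed

text \<open>For real k the exponentials of the two factors are inverse to each other, and the terms
  with ik add up instead of cancelling.\<close>

lemma wr_jf_real:
  fixes V :: "real \<Rightarrow> complex^'n^'n"
  assumes herm: "hermitian V"
    and V: "decays \<gamma> V" and k0: "k \<noteq> (0::real)"
  shows "wr (jf V k x) (jf' V k x) (jf V k x) (jf' V k x) = mat (2 * \<i> * k)"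
proof (rule wr_eq_limit[OF herm, where y="jf V k" and z="jf V k"])
  have k: "0 \<le> Im (of_real k)" "of_real k \<noteq> (0::complex)" "- \<gamma> < Im (of_real k)"
    using k0 V by (auto simp: decays_def)
  show "solves V k (jf V k) (jf' V k)" "solves V k (jf V k) (jf' V k)"
    by (rule solves_jf[OF V k(3,2)])+
  show "cnj ((complex_of_real k)\<^sup>2) = (of_real k)\<^sup>2" by simp
  have eq: "wr (jf V k x) (jf' V k x) (jf V k x) (jf' V k x)
     = (2 * \<i> * k) \<odot> (madj (vm V k x) ** vm V k x) + (madj (vm V k x) ** vn V k x - madj (vn V k x) ** vm V k x)" for x
  proof -
    have 1: "cnj (exp (\<i> * of_real k * of_real x)) = exp (- (\<i> * of_real k * of_real x))"
      by (simp add: exp_cnj)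
    have 2: "exp (- (\<i> * of_real k * of_real x)) * exp (\<i> * of_real k * of_real x) = 1"
      by (simp add: mult_exp_exp)
    have 3: "cnj (\<i> * complex_of_real k) = - (\<i> * of_real k)" by simp
    have "wr (jf V k x) (jf' V k x) (jf V k x) (jf' V k x) = (exp (- (\<i> * of_real k * of_real x)) * exp (\<i> * of_real k * of_real x)) \<odot>
       (madj (vm V k x) ** ((\<i> * of_real k) \<odot> vm V k x + vn V k x) - madj ((\<i> * of_real k) \<odot> vm V k x + vn V k x) ** vm V k x)"
      unfolding wr_def jf_def jf'_def madj_cscale 1 cscale_mult_left cscale_mult_right cs.diff_right cscale_cscale
      by (simp only: mult.commute)
    also have "\<dots> = (2 * \<i> * k) \<odot> (madj (vm V k x) ** vm V k x) + (madj (vm V k x) ** vn V k x - madj (vn V k x) ** vm V k x)"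
      unfolding 2 cscale_one madj_add madj_cscale 3 mm.add_left mm.add_right cscale_mult_left cscale_mult_right
      by (simp add: vec_eq_iff algebra_simps)
    finally show ?thesis .
  qed
  have "((\<lambda>x. (2 * \<i> * k) \<odot> (madj (vm V k x) ** vm V k x) + (madj (vm V k x) ** vn V k x - madj (vn V k x) ** vm V k x))
    \<longlongrightarrow> (2 * \<i> * k) \<odot> (madj (mat 1) ** mat 1) + (madj (mat 1) ** 0 - madj 0 ** mat 1)) at_top"
    by (intro tendsto_add tendsto_diff mm.tendsto cs.tendsto tendsto_const tendsto_madj vm_tendsto[OF V] vn_tendsto[OF V] k)
  moreover have "(2 * \<i> * k) \<odot> (madj (mat 1) ** mat 1) + (madj (mat 1) ** 0 - madj 0 ** mat 1) = (mat (2 * \<i> * k) :: complex^'n^'n)"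
    by (simp flip: mat_eq_cscale)
  ultimately show "((\<lambda>x. wr (jf V k x) (jf' V k x) (jf V k x) (jf' V k x)) \<longlongrightarrow> mat (2 * \<i> * k)) at_top"
    unfolding eq by (simp only:)
qed

definition gm :: "(real \<Rightarrow> complex^'n^'n) \<Rightarrow> complex \<Rightarrow> real \<Rightarrow> complex^'n^'n" where
  "gm V k x = jf (refl_pot V) k (- x)"

definition gm' :: "(real \<Rightarrow> complex^'n^'n) \<Rightarrow> complex \<Rightarrow> real \<Rightarrow> complex^'n^'n" where
  "gm' V k x = - jf' (refl_pot V) k (- x)"

lemma solves_gm:
  assumes V: "decays \<gamma> V" and k: "- \<gamma> < Im k" and k0: "k \<noteq> 0"
  shows "solves V k (gm V k) (gm' V k)"
proof -
  note s = solves_jf[OF decays_refl_pot[OF V] k k0, unfolded solves_def]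
  have "prim (\<lambda>x. jf (refl_pot V) k (- x)) (\<lambda>x. - jf' (refl_pot V) k (- x))"
    using s by (intro prim_reflect) auto
  moreover have "prim (\<lambda>x. - jf' (refl_pot V) k (- x))
      (\<lambda>x. - (- (refl_pot V (- x) ** jf (refl_pot V) k (- x) - k\<^sup>2 \<odot> jf (refl_pot V) k (- x))))"
    using s by (intro prim_minus prim_reflect) auto
  ultimately show ?thesis
    by (simp add: solves_def gm_def[abs_def] gm'_def[abs_def] refl_pot_def)
qed

lemma gm_has_vector_derivative:
  assumes V: "decays \<gamma> V" and k: "- \<gamma> < Im k" and k0: "k \<noteq> 0"
  shows "(gm V k has_vector_derivative gm' V k x) (at x)"
  using solves_gm[OF assms] unfolding solves_def
  by (intro prim_has_vector_derivative prim_continuous) auto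

lemma AE_lebesgue_reflect:
  assumes "AE x in lebesgue. P (x::real)"
  shows "AE x in lebesgue. P (- x)"
proof -
  from assms obtain N where N: "negligible N" "\<And>x. x \<notin> N \<Longrightarrow> P x"
    by (auto simp: eventually_ae_filter negligible_iff_null_sets)
  have "((\<lambda>x. indicat_real N (- x)) has_integral 0) UNIV"
    using N(1) unfolding negligible_UNIV by (rule has_integral_reflect_UNIV)
  moreover have "(\<lambda>x. indicat_real N (- x)) = indicat_real {x. - x \<in> N}"
    by (auto simp: indicator_def)
  ultimately have "negligible {x. - x \<in> N}"
    unfolding negligible_UNIV by simp
  then have "AE x in lebesgue. x \<notin> {x. - x \<in> N}"
    by (simp only: negligible_iff_null_sets AE_not_in)
  then show ?thesis
    by eventually_elim (use N(2) in auto)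
qed

lemma herm_refl_pot:
  assumes "hermitian V"
  shows "hermitian (refl_pot V)"
  using AE_lebesgue_reflect[OF assms] by (simp add: refl_pot_def)

lemma wr_uminus: "wr y (- y') z (- z') = - wr y y' z z'"
  by (simp add: wr_def madj_minus mm.minus_left mm.minus_right)

lemma wr_gm_minus_cnj:
  assumes "hermitian V" "decays \<gamma> V" "0 \<le> Im k" "k \<noteq> 0"
  shows "wr (gm V (- cnj k) x) (gm' V (- cnj k) x) (gm V k x) (gm' V k x) = 0"
  unfolding gm_def gm'_def wr_uminus wr_jf_minus_cnj[OF herm_refl_pot[OF assms(1)] decays_refl_pot[OF assms(2)] assms(3,4)]
  by simp

lemma wr_gm_real:
  assumes "hermitian V" "decays \<gamma> V" "k \<noteq> (0::real)"
  shows "wr (gm V k x) (gm' V k x) (gm V k x) (gm' V k x) = mat (- 2 * \<i> * k)"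
  unfolding gm_def gm'_def wr_uminus wr_jf_real[OF herm_refl_pot[OF assms(1)] decays_refl_pot[OF assms(2)] assms(3)]
  by (simp add: vec_eq_iff mat_def)

section \<open>The transition coefficients\<close>

lemma coefA_eq:
  assumes herm: "hermitian V"
    and V: "decays \<gamma> V" and k: "0 \<le> Im k" and k0: "k \<noteq> 0"
  shows "coefA V k = (1 / (2 * \<i> * k)) \<odot> wr (gm V (- cnj k) x) (gm' V (- cnj k) x) (jf V k x) (jf' V k x)"
proof -
  let ?l = "- cnj k"
  have l: "0 \<le> Im ?l" "?l \<noteq> 0" using k k0 by auto
  have \<gamma>: "- \<gamma> < Im k" "- \<gamma> < Im ?l" using V k by (auto simp: decays_def)
  have j: "jost_minus V ?l = gm V ?l"
    using jost_minus_eq[OF V l] by (simp add: gm_def[abs_def])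
  have d1: "vector_derivative (\<lambda>x. madj (gm V ?l x)) (at 0) = madj (gm' V ?l 0)"
    by (intro vector_derivative_at bounded_linear.has_vector_derivative[OF bounded_linear_madj]
        gm_has_vector_derivative[OF V \<gamma>(2) l(2)])
  have d2: "vector_derivative (jf V k) (at 0) = jf' V k 0"
    by (intro vector_derivative_at jf_has_vector_derivative[OF V \<gamma>(1) k0])
  have "coefA V k = (1 / (2 * \<i> * k)) \<odot> wr (gm V ?l 0) (gm' V ?l 0) (jf V k 0) (jf' V k 0)"
    unfolding coefA_def wronsk_def jost_plus_eq[OF V k k0] j d1 d2 by (simp add: wr_def)
  moreover have "cnj (?l\<^sup>2) = k\<^sup>2" by simp
  ultimately show ?thesis
    using wr_const[OF herm solves_gm[OF V \<gamma>(2) l(2)] solves_jf[OF V \<gamma>(1) k0], of 0 x] by simp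
qed

lemma coefB_eq:
  assumes herm: "hermitian V"
    and V: "decays \<gamma> V" and k0: "k \<noteq> (0::real)"
  shows "coefB V k = (- 1 / (2 * \<i> * k)) \<odot> wr (gm V k x) (gm' V k x) (jf V k x) (jf' V k x)"
proof -
  have k: "0 \<le> Im (of_real k)" "of_real k \<noteq> (0::complex)" "- \<gamma> < Im (of_real k)"
    using k0 V by (auto simp: decays_def)
  have j: "jost_minus V k = gm V k"
    using jost_minus_eq[OF V k(1,2)] by (simp add: gm_def[abs_def])
  have d1: "vector_derivative (\<lambda>x. madj (gm V k x)) (at 0) = madj (gm' V k 0)"
    by (intro vector_derivative_at bounded_linear.has_vector_derivative[OF bounded_linear_madj]
        gm_has_vector_derivative[OF V k(3,2)])
  have d2: "vector_derivative (jf V k) (at 0) = jf' V k 0"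
    by (intro vector_derivative_at jf_has_vector_derivative[OF V k(3,2)])
  have "coefB V k = (- 1 / (2 * \<i> * k)) \<odot> wr (gm V k 0) (gm' V k 0) (jf V k 0) (jf' V k 0)"
    unfolding coefB_def wronsk_def jost_plus_eq[OF V k(1,2)] complex_cnj_complex_of_real j d1 d2 by (simp add: wr_def)
  then show ?thesis
    using wr_const[OF herm solves_gm[OF V k(3,2)] solves_jf[OF V k(3,2)], of 0 x] by simp
qed

text \<open>Four n by n blocks are packed into one square matrix indexed by the sum type, for which
  a left inverse is also a right inverse.\<close>

lemma block_left_inverse_is_right_inverse:
  fixes a b c d p q r s :: "complex^'n^'n"
  assumes "p ** a + q ** c = mat 1" "p ** b + q ** d = 0" "r ** a + s ** c = 0" "r ** b + s ** d = mat 1"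
  shows "a ** p + b ** r = mat 1" "a ** q + b ** s = 0" "c ** p + d ** r = 0" "c ** q + d ** s = mat 1"
proof -
  define blk :: "complex^'n^'n \<Rightarrow> complex^'n^'n \<Rightarrow> complex^'n^'n \<Rightarrow> complex^'n^'n \<Rightarrow> complex^('n+'n)^('n+'n)"
    where "blk = (\<lambda>a b c d. \<chi> i j. case i of
        Inl i \<Rightarrow> (case j of Inl j \<Rightarrow> a $ i $ j | Inr j \<Rightarrow> b $ i $ j)
      | Inr i \<Rightarrow> (case j of Inl j \<Rightarrow> c $ i $ j | Inr j \<Rightarrow> d $ i $ j))"
  have sum: "(\<Sum>k\<in>UNIV. f k) = (\<Sum>k\<in>UNIV. f (Inl k)) + (\<Sum>k\<in>UNIV. f (Inr k))" for f :: "'n + 'n \<Rightarrow> complex"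
    by (subst UNIV_Plus_UNIV[symmetric], subst sum.Plus) auto
  have mult: "blk a b c d ** blk a' b' c' d' = blk (a ** a' + b ** c') (a ** b' + b ** d') (c ** a' + d ** c') (c ** b' + d ** d')"
    for a b c d a' b' c' d'
    by (simp add: vec_eq_iff blk_def matrix_matrix_mult_def sum split: sum.split)
  have one: "blk (mat 1) 0 0 (mat 1) = mat 1"
    by (simp add: vec_eq_iff blk_def mat_def split: sum.split)
  have inj: "blk a b c d = blk a' b' c' d' \<Longrightarrow> a = a' \<and> b = b' \<and> c = c' \<and> d = d'" for a b c d a' b' c' d'
    by (simp add: vec_eq_iff blk_def split: sum.split_asm)
  have "blk p q r s ** blk a b c d = mat 1"
    using assms by (simp add: mult one)
  then have "blk a b c d ** blk p q r s = blk (mat 1) 0 0 (mat 1)"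
    using matrix_left_right_inverse one by metis
  then show "a ** p + b ** r = mat 1" "a ** q + b ** s = 0" "c ** p + d ** r = 0" "c ** q + d ** s = mat 1"
    unfolding mult by (auto dest!: inj)
qed

text \<open>On the real axis the Wronskian relations of \<open>gm (-k)\<close> and \<open>gm k\<close> say that a certain
  block matrix is a left inverse of the fundamental matrix; it is then also a right inverse,
  which gives the expansion of any pair \<open>(f, f')\<close> in that basis.\<close>

lemma jf_connection:
  fixes V :: "real \<Rightarrow> complex^'n^'n" and k :: real
  assumes herm: "hermitian V"
    and V: "decays \<gamma> V" and k0: "k \<noteq> 0"
  shows "jf V k x = gm V (- k) x ** coefA V k + gm V k x ** coefB V k"
    and "jf' V k x = gm' V (- k) x ** coefA V k + gm' V k x ** coefB V k"
proof -
  let ?c = "1 / (2 * \<i> * complex_of_real k)"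
  let ?y = "gm V (- k) x" and ?y' = "gm' V (- k) x" and ?z = "gm V k x" and ?z' = "gm' V k x"
  let ?f = "jf V k x" and ?f' = "jf' V k x"
  have k: "0 \<le> Im (of_real k)" "of_real k \<noteq> (0::complex)" "0 \<le> Im (- of_real k)" "- of_real k \<noteq> (0::complex)"
    using k0 by auto
  have yy: "wr ?y ?y' ?y ?y' = mat (2 * \<i> * k)"
    using wr_gm_real[OF herm V, of "- k" x] k0 by simp
  have zz: "wr ?z ?z' ?z ?z' = mat (- 2 * \<i> * k)"
    using wr_gm_real[OF herm V k0, of x] by simp
  have yz: "wr ?y ?y' ?z ?z' = 0"
    using wr_gm_minus_cnj[OF herm V k(1,2), of x] by simp
  have zy: "wr ?z ?z' ?y ?y' = 0"
    using wr_gm_minus_cnj[OF herm V k(3,4), of x] by simp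
  \<comment> \<open>The blocks of the inverse, read off from the Wronskians with f_-(-k) and f_-(k)
    and normalised by 2ik; the opposite signs come from \<open>wr_gm_real\<close> at -k and
    k.\<close>
  define p where "p = (- ?c) \<odot> madj ?y'"
  define q where "q = ?c \<odot> madj ?y"
  define r where "r = ?c \<odot> madj ?z'"
  define s where "s = (- ?c) \<odot> madj ?z"
  have pq: "p ** u + q ** u' = ?c \<odot> wr ?y ?y' u u'" and rs: "r ** u + s ** u' = (- ?c) \<odot> wr ?z ?z' u u'" for u u'
    by (simp_all add: p_def q_def r_def s_def wr_def cs.diff_right cs.minus_left mm.minus_left)
  have "p ** ?y + q ** ?y' = mat 1" "p ** ?z + q ** ?z' = 0" "r ** ?y + s ** ?y' = 0" "r ** ?z + s ** ?z' = mat 1"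
    unfolding pq rs yy yz zy zz mat_eq_cscale[of "2 * \<i> * k"] mat_eq_cscale[of "- 2 * \<i> * k"] using k0 by simp_all
  note inv = block_left_inverse_is_right_inverse[OF this]
  have A: "p ** ?f + q ** ?f' = coefA V k"
    unfolding pq using coefA_eq[OF herm V k(1,2), of x] by simp
  have B: "r ** ?f + s ** ?f' = coefB V k"
    unfolding rs using coefB_eq[OF herm V k0, of x] by simp
  have "?y ** (p ** ?f + q ** ?f') + ?z ** (r ** ?f + s ** ?f')
      = (?y ** p + ?z ** r) ** ?f + (?y ** q + ?z ** s) ** ?f'"
    by (simp only: mm.add_left mm.add_right matrix_mul_assoc add_ac)
  then show "jf V k x = ?y ** coefA V k + ?z ** coefB V k"
    unfolding A B inv by simp
  have "?y' ** (p ** ?f + q ** ?f') + ?z' ** (r ** ?f + s ** ?f')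
      = (?y' ** p + ?z' ** r) ** ?f + (?y' ** q + ?z' ** s) ** ?f'"
    by (simp only: mm.add_left mm.add_right matrix_mul_assoc add_ac)
  then show "jf' V k x = ?y' ** coefA V k + ?z' ** coefB V k"
    unfolding A B inv by simp
qed

text \<open>Inserting the expansion of \<open>jf_connection\<close> into the Wronskian of f_+(k)
  with itself gives the first identity, into that of f_+(-k) with f_+(k) the second.\<close>

lemma coef_relations:
  fixes V :: "real \<Rightarrow> complex^'n^'n" and k :: real
  assumes herm: "hermitian V"
    and V: "decays \<gamma> V" and k0: "k \<noteq> 0"
  shows "madj (coefA V k) ** coefA V k = mat 1 + madj (coefB V k) ** coefB V k"
    and "madj (coefA V (- k)) ** coefB V k = madj (coefB V (- k)) ** coefA V k"
proof -
  let ?y = "gm V (- k) 0" and ?y' = "gm' V (- k) 0" and ?z = "gm V k 0" and ?z' = "gm' V k 0"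
  let ?A = "coefA V k" and ?B = "coefB V k" and ?A' = "coefA V (- k)" and ?B' = "coefB V (- k)"
  have k: "0 \<le> Im (of_real k)" "of_real k \<noteq> (0::complex)" "0 \<le> Im (- of_real k)" "- of_real k \<noteq> (0::complex)"
    using k0 by auto
  have yy: "wr ?y ?y' ?y ?y' = mat (2 * \<i> * k)"
    using wr_gm_real[OF herm V, of "- k" 0] k0 by simp
  have zz: "wr ?z ?z' ?z ?z' = mat (- 2 * \<i> * k)"
    using wr_gm_real[OF herm V k0, of 0] by simp
  have yz: "wr ?y ?y' ?z ?z' = 0"
    using wr_gm_minus_cnj[OF herm V k(1,2), of 0] by simp
  have zy: "wr ?z ?z' ?y ?y' = 0"
    using wr_gm_minus_cnj[OF herm V k(3,4), of 0] by simp
  note f = jf_connection[OF herm V k0, of 0]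
  have f': "jf V (- k) 0 = ?z ** ?A' + ?y ** ?B'" "jf' V (- k) 0 = ?z' ** ?A' + ?y' ** ?B'"
    using jf_connection[OF herm V, of "- k" 0] k0 by simp_all
  have "mat (2 * \<i> * k) = wr (?y ** ?A + ?z ** ?B) (?y' ** ?A + ?z' ** ?B) (?y ** ?A + ?z ** ?B) (?y' ** ?A + ?z' ** ?B)"
    using wr_jf_real[OF herm V k0, of 0] unfolding f by simp
  also have "\<dots> = (2 * \<i> * k) \<odot> (madj ?A ** ?A - madj ?B ** ?B)"
    unfolding wr_comb_left wr_comb_right yy yz zy zz by (simp add: cs.diff_right cs.minus_left mm.minus_left mm.minus_right)
  finally have "(1 / (2 * \<i> * k)) \<odot> (mat (2 * \<i> * k) :: complex^'n^'n)
      = (1 / (2 * \<i> * k)) \<odot> (2 * \<i> * k) \<odot> (madj ?A ** ?A - madj ?B ** ?B)"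
    by (rule arg_cong)
  then have "mat 1 = madj ?A ** ?A - madj ?B ** ?B"
    using k0 by (simp add: mat_eq_cscale[of "2 * \<i> * k"])
  then show "madj ?A ** ?A = mat 1 + madj ?B ** ?B"
    by simp
  have "0 = wr (?z ** ?A' + ?y ** ?B') (?z' ** ?A' + ?y' ** ?B') (?y ** ?A + ?z ** ?B) (?y' ** ?A + ?z' ** ?B)"
    using wr_jf_minus_cnj[OF herm V k(1,2), of 0] f unfolding f[symmetric] f'[symmetric] by simp
  also have "\<dots> = (2 * \<i> * k) \<odot> (madj ?B' ** ?A - madj ?A' ** ?B)"
    unfolding wr_comb_left wr_comb_right yy yz zy zz by (simp add: cs.diff_right cs.minus_left mm.minus_left mm.minus_right)
  finally have "(1 / (2 * \<i> * k)) \<odot> (0 :: complex^'n^'n) = (1 / (2 * \<i> * k)) \<odot> (2 * \<i> * k) \<odot> (madj ?B' ** ?A - madj ?A' ** ?B)"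
    by (rule arg_cong)
  then show "madj ?A' ** ?B = madj ?B' ** ?A"
    using k0 by simp
qed

section \<open>Invertibility of A(k) away from the imaginary axis\<close>

lemma madj_self_mult_diag: "Re ((madj M ** M) $ j $ j) = (\<Sum>i\<in>UNIV. (cmod (M $ i $ j))\<^sup>2)"
  for M :: "complex^'n^'n"
proof -
  have "Re (cnj z * z) = (cmod z)\<^sup>2" for z
    unfolding cmod_power2 by (simp add: power2_eq_square)
  then show ?thesis by (simp add: matrix_matrix_mult_def)
qed

text \<open>The real part of the trace. It sends M^H M to the squared norm of M, so that matrix
  identities yield scalar ones.\<close>

definition retr :: "complex^'n^'n \<Rightarrow> real" where
  "retr M = (\<Sum>j\<in>UNIV. Re (M $ j $ j))"

lemma bounded_linear_retr: "bounded_linear (retr :: complex^'n^'n \<Rightarrow> real)"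
  unfolding retr_def
  by (intro bounded_linear_sum bounded_linear_compose[OF bounded_linear_Re bounded_linear_entry])

lemma retr_madj_self: "retr (madj M ** M) = (norm M)\<^sup>2" for M :: "complex^'n^'n"
proof -
  have "(norm M)\<^sup>2 = (\<Sum>i\<in>UNIV. \<Sum>j\<in>UNIV. (cmod (M $ i $ j))\<^sup>2)"
    unfolding norm_vec_def L2_set_def by (simp add: sum_nonneg)
  then show ?thesis
    unfolding retr_def madj_self_mult_diag by (subst sum.swap) simp
qed

text \<open>A^H A = 1 + B^H B is at least 1, so A U = 0 forces the squared norm of U to
  vanish.\<close>

lemma invertible_coefA_real:
  fixes V :: "real \<Rightarrow> complex^'n^'n" and k :: real
  assumes herm: "hermitian V"
    and V: "decays \<gamma> V" and k0: "k \<noteq> 0"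
  shows "invertible (coefA V k)"
proof (rule invertible_if_mult_eq_0)
  fix U :: "complex^'n^'n" assume "coefA V k ** U = 0"
  then have "0 = madj U ** (madj (coefA V k) ** coefA V k) ** U"
    by (simp flip: matrix_mul_assoc)
  also have "\<dots> = madj U ** U + madj (coefB V k ** U) ** (coefB V k ** U)"
    unfolding coef_relations(1)[OF herm V k0] madj_mult mm.add_left mm.add_right by (simp add: matrix_mul_assoc)
  finally have "0 = retr (madj U ** U + madj (coefB V k ** U) ** (coefB V k ** U))"
    by (simp add: retr_def)
  then have "0 = (norm U)\<^sup>2 + (norm (coefB V k ** U))\<^sup>2"
    unfolding linear_add[OF bounded_linear.linear[OF bounded_linear_retr]] retr_madj_self .
  then have "(norm U)\<^sup>2 = 0"
    by (smt (verit) zero_le_power2)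
  then show "U = 0" by simp
qed

text \<open>The second identity of \<open>coef_relations\<close>, multiplied by the inverse of A(k)
  on the right and by the adjoint of the inverse of A(-k) on the left.\<close>

lemma refl_minus_symmetric:
  fixes V :: "real \<Rightarrow> complex^'n^'n" and k :: real
  assumes herm: "hermitian V"
    and V: "decays \<gamma> V" and k0: "k \<noteq> 0"
  shows "madj (refl_minus V (- k)) = refl_minus V k"
proof -
  let ?A = "coefA V k" and ?B = "coefB V k" and ?A' = "coefA V (- k)" and ?B' = "coefB V (- k)"
  note i = matrix_inv_right_left[OF invertible_coefA_real[OF herm V k0]]
  have "invertible ?A'"
    using invertible_coefA_real[OF herm V, of "- k"] k0 by simp
  note i' = matrix_inv_right_left[OF this]
  have "madj (?A' ** matrix_inv ?A') = mat 1"
    unfolding i' by simp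
  then have i'': "madj (matrix_inv ?A') ** madj ?A' = mat 1"
    by (simp add: madj_mult)
  have "?B ** matrix_inv ?A = (madj (matrix_inv ?A') ** madj ?A') ** ?B ** matrix_inv ?A"
    unfolding i'' by simp
  also have "\<dots> = madj (matrix_inv ?A') ** (madj ?A' ** ?B) ** matrix_inv ?A"
    by (simp only: matrix_mul_assoc)
  also have "\<dots> = madj (matrix_inv ?A') ** madj ?B' ** (?A ** matrix_inv ?A)"
    unfolding coef_relations(2)[OF herm V k0] by (simp only: matrix_mul_assoc)
  also have "\<dots> = madj (?B' ** matrix_inv ?A')"
    unfolding i by (simp add: madj_mult)
  finally show ?thesis by (simp add: refl_minus_def)
qed

text \<open>Up to a constant, \<open>weyl_form V k x\<close> is the imaginary part of the Weyl function at \<open>x\<close>. If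
  \<open>A(k) U = 0\<close>, the half-lines to the right and to the left of \<open>0\<close> give values of opposite sign.\<close>

definition weyl_form :: "(real \<Rightarrow> complex^'n^'n) \<Rightarrow> complex \<Rightarrow> real \<Rightarrow> complex^'n^'n \<Rightarrow> real" where
  "weyl_form V k x U = retr ((1 / (cnj (k\<^sup>2) - k\<^sup>2)) \<odot> wr (jf V k x ** U) (jf' V k x ** U) (jf V k x ** U) (jf' V k x ** U))"

text \<open>Divided by cnj (k^2) - k^2, which is nonzero because Re k and Im k are, the form has
  x-derivative norm (f_+ U)^2 and tends to 0 at infinity through the factor exp(-2 Im k x). Its
  value at 0 is therefore minus the integral of norm (f_+ U)^2 over the positive half-line.\<close>

lemma weyl_form:
  fixes V :: "real \<Rightarrow> complex^'n^'n"
  assumes herm: "hermitian V"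
    and V: "decays \<gamma> V" and k: "0 < Im k" and re: "Re k \<noteq> 0"
  shows "weyl_form V k 0 U \<le> 0" and "weyl_form V k 0 U = 0 \<Longrightarrow> U = 0"
proof -
  have k0: "k \<noteq> 0" "- \<gamma> < Im k" "0 \<le> Im k" using k V by (auto simp: decays_def)
  define c where "c = cnj (k\<^sup>2) - k\<^sup>2"
  have "Im c \<noteq> 0" using k re by (simp add: c_def power2_eq_square)
  then have c: "c \<noteq> 0" by auto
  define g where "g = (\<lambda>x. jf V k x ** U)"
  define W where "W = (\<lambda>x. wr (jf V k x) (jf' V k x) (jf V k x) (jf' V k x))"
  have eq: "weyl_form V k x U = retr ((1 / c) \<odot> (madj U ** W x ** U))" for x
  proof -
    have "wr (jf V k x ** U) (jf' V k x ** U) (jf V k x ** U) (jf' V k x ** U) = madj U ** W x ** U"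
      by (simp add: wr_def W_def madj_mult mm.diff_left mm.diff_right matrix_mul_assoc)
    then show ?thesis by (simp add: weyl_form_def c_def)
  qed
  have bl: "bounded_linear (\<lambda>M. retr ((1 / c) \<odot> (madj U ** M ** U)))"
    by (rule bounded_linear_compose[OF bounded_linear_retr bounded_linear_compose[OF cs.bounded_linear_right
        bounded_linear_compose[OF mm.bounded_linear_left mm.bounded_linear_right]]])
  have "prim W (\<lambda>x. c \<odot> (madj (jf V k x) ** jf V k x))"
    unfolding W_def c_def using solves_jf[OF V k0(2,1)] by (intro prim_wr[OF herm])
  from prim_linear[OF bl this]
  have "prim (\<lambda>x. weyl_form V k x U) (\<lambda>x. retr ((1 / c) \<odot> (madj U ** (c \<odot> (madj (jf V k x) ** jf V k x)) ** U)))"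
    by (simp only: eq)
  moreover have "retr ((1 / c) \<odot> (madj U ** (c \<odot> (madj (jf V k x) ** jf V k x)) ** U)) = (norm (g x))\<^sup>2" for x
    unfolding g_def retr_madj_self[symmetric] madj_mult using c by (simp add: matrix_mul_assoc)
  ultimately have pr: "prim (\<lambda>x. weyl_form V k x U) (\<lambda>x. (norm (g x))\<^sup>2)"
    by (simp only:)
  have "((\<lambda>x. weyl_form V k x U) \<longlongrightarrow> retr ((1 / c) \<odot> (madj U ** 0 ** U))) at_top"
    unfolding eq
  proof (rule bounded_linear.tendsto[OF bl])
    let ?b = "\<lambda>x. madj (vm V k x) ** ((\<i> * k) \<odot> vm V k x + vn V k x) - madj ((\<i> * k) \<odot> vm V k x + vn V k x) ** vm V k x"
    have b: "(?b \<longlongrightarrow> madj (mat 1) ** ((\<i> * k) \<odot> mat 1 + 0) - madj ((\<i> * k) \<odot> mat 1 + 0) ** mat 1) at_top"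
      by (intro tendsto_add tendsto_diff mm.tendsto cs.tendsto tendsto_const tendsto_madj vm_tendsto[OF V] vn_tendsto[OF V] k0)
    have e: "((\<lambda>x. cnj (exp (\<i> * k * of_real x)) * exp (\<i> * k * of_real x)) \<longlongrightarrow> 0) at_top"
    proof (rule tendsto_norm_zero_cancel)
      have "filterlim (\<lambda>x. 2 * Im k * x) at_top at_top"
        using k by (intro filterlim_tendsto_pos_mult_at_top[OF tendsto_const]) (auto intro: filterlim_ident)
      then have "((\<lambda>x. exp (- (2 * Im k * x))) \<longlongrightarrow> 0) at_top"
        by (intro filterlim_compose[OF exp_at_bot] filterlim_compose[OF filterlim_uminus_at_bot_at_top])
      moreover have "norm (cnj (exp (\<i> * k * of_real x)) * exp (\<i> * k * of_real x)) = exp (- (2 * Im k * x))" for x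
        by (simp add: norm_mult mult_exp_exp)
      ultimately show "((\<lambda>x. norm (cnj (exp (\<i> * k * of_real x)) * exp (\<i> * k * of_real x))) \<longlongrightarrow> 0) at_top"
        by simp
    qed
    have "W = (\<lambda>x. (cnj (exp (\<i> * k * of_real x)) * exp (\<i> * k * of_real x)) \<odot> ?b x)"
      unfolding W_def wr_def jf_def jf'_def madj_cscale cscale_mult_left cscale_mult_right cs.diff_right cscale_cscale
      by (simp only: mult.commute)
    with cs.tendsto[OF e b] show "(W \<longlongrightarrow> 0) at_top"
      by simp
  qed
  then have lim: "((\<lambda>x. weyl_form V k x U) \<longlongrightarrow> 0) at_top"
    by (simp add: retr_def)
  have mono: "weyl_form V k x U \<le> weyl_form V k y U" if "x \<le> y" for x y
  proof -
    have "0 \<le> integral {x..y} (\<lambda>x. (norm (g x))\<^sup>2)"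
      using primD(2)[OF pr that] by (intro Henstock_Kurzweil_Integration.integral_nonneg) auto
    then show ?thesis using primD(3)[OF pr that] by simp
  qed
  have le0: "weyl_form V k x U \<le> 0" for x
  proof (rule tendsto_lowerbound[OF lim])
    show "\<forall>\<^sub>F y in at_top. weyl_form V k x U \<le> weyl_form V k y U"
      using eventually_ge_at_top[of x] by eventually_elim (rule mono)
  qed simp
  show "weyl_form V k 0 U \<le> 0" by (rule le0)
  assume z: "weyl_form V k 0 U = 0"
  have "g x = 0" if x: "0 < x" for x
  proof -
    have w0: "weyl_form V k y U = 0" if "0 \<le> y" for y
      using mono[OF that] le0[of y] z by simp
    have "integral {0..x} (\<lambda>x. (norm (g x))\<^sup>2) = 0"
      using primD(3)[OF pr, of 0 x] w0[of x] w0[of 0] x by simp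
    moreover have "continuous_on {0..x} (\<lambda>x. (norm (g x))\<^sup>2)"
      unfolding g_def using solves_jf[OF V k0(2,1)]
      by (intro continuous_intros mm.continuous_on prim_continuous) (auto simp: solves_def)
    ultimately have "(norm (g x))\<^sup>2 = 0"
      using integral_eq_0_iff[of 0 x "\<lambda>x. (norm (g x))\<^sup>2"] x by auto
    then show ?thesis by simp
  qed
  then have v0: "vm V k x ** U = 0" if "0 < x" for x
  proof -
    have "exp (- (\<i> * k * of_real x)) \<odot> g x = vm V k x ** U"
      by (simp add: g_def jf_def mult_exp_exp)
    then show ?thesis using \<open>\<And>x. 0 < x \<Longrightarrow> g x = 0\<close>[OF that] by simp
  qed
  \<comment> \<open>As \<open>vm\<close> tends to 1, the vanishing of f_+ U for x > 0 passes to
    U.\<close>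
  have "((\<lambda>x. vm V k x ** U) \<longlongrightarrow> mat 1 ** U) at_top"
    by (intro mm.tendsto tendsto_const vm_tendsto[OF V k0(3,1)])
  moreover have "((\<lambda>x. vm V k x ** U) \<longlongrightarrow> 0) at_top"
    by (rule tendsto_eventually, rule eventually_mono[OF eventually_gt_at_top[of 0] v0])
  ultimately have "mat 1 ** U = 0"
    by (rule tendsto_unique[rotated]) simp
  then show "U = 0" by simp
qed

text \<open>A kernel vector would make the non-real number k^2 a Dirichlet eigenvalue of the
  half-line problem.\<close>

lemma invertible_jf_0:
  fixes V :: "real \<Rightarrow> complex^'n^'n"
  assumes herm: "hermitian V"
    and V: "decays \<gamma> V" and k: "0 < Im k" and re: "Re k \<noteq> 0"
  shows "invertible (jf V k 0)"
proof (rule invertible_if_mult_eq_0)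
  fix U :: "complex^'n^'n" assume "jf V k 0 ** U = 0"
  then have "weyl_form V k 0 U = 0"
    by (simp add: weyl_form_def wr_def retr_def)
  then show "U = 0" by (rule weyl_form(2)[OF assms])
qed

text \<open>If A U = 0, then f_+ U has the same Cauchy data at 0 as f_- U' for a suitable U', so it
  decays in both directions; self-adjointness forbids this for non-real k^2. In terms of
  \<open>weyl_form\<close> the values of the two half-lines are opposite to each other and both
  nonpositive, hence 0.\<close>

lemma invertible_coefA_off_axis:
  fixes V :: "real \<Rightarrow> complex^'n^'n"
  assumes herm: "hermitian V"
    and V: "decays \<gamma> V" and k: "0 < Im k" and re: "Re k \<noteq> 0"
  shows "invertible (coefA V k)"
proof (rule invertible_if_mult_eq_0)
  fix U :: "complex^'n^'n" assume AU: "coefA V k ** U = 0"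
  have k0: "k \<noteq> 0" "0 \<le> Im k" using k by auto
  let ?R = "refl_pot V" and ?l = "- cnj k"
  note hR = herm_refl_pot[OF herm] and VR = decays_refl_pot[OF V]
  define P where "P = jf V k 0 ** U"
  define P' where "P' = jf' V k 0 ** U"
  define F where "F = madj (jf ?R ?l 0)"
  define F' where "F' = madj (jf' ?R ?l 0)"
  define E where "E = jf ?R k 0"
  define E' where "E' = jf' ?R k 0"
  \<comment> \<open>Where E is invertible, this is the symmetry of the Weyl function E' E^{-1} of
    the left half-line under k -> - cnj k and passage to the adjoint.\<close>
  have FE: "F ** E' = F' ** E"
    using wr_jf_minus_cnj[OF hR VR k0(2,1), of 0] by (simp add: wr_def F_def F'_def E_def E'_def)
  have "(1 / (2 * \<i> * k)) \<odot> ((F ** jf' V k 0 + F' ** jf V k 0) ** U) = 0"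
    using AU unfolding coefA_eq[OF herm V k0(2,1), of 0]
    by (simp add: wr_def gm_def gm'_def F_def F'_def madj_minus mm.minus_left)
  then have "(2 * \<i> * k) \<odot> (1 / (2 * \<i> * k)) \<odot> ((F ** jf' V k 0 + F' ** jf V k 0) ** U) = (2 * \<i> * k) \<odot> 0"
    by (rule arg_cong)
  then have FP: "F ** P' + F' ** P = 0"
    using k0 by (simp add: P_def P'_def mm.add_left matrix_mul_assoc)
  have "invertible E" unfolding E_def by (rule invertible_jf_0[OF hR VR k re])
  note Ei = matrix_inv_right_left[OF this]
  have "invertible (jf ?R ?l 0)"
    by (rule invertible_jf_0[OF hR VR]) (use k re in auto)
  note Li = matrix_inv_right_left[OF this]
  have "madj (jf ?R ?l 0 ** matrix_inv (jf ?R ?l 0)) = mat 1"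
    unfolding Li by simp
  then have Fi: "madj (matrix_inv (jf ?R ?l 0)) ** F = mat 1"
    by (simp add: F_def madj_mult)
  \<comment> \<open>The coefficient for which f_- U' and f_+ U agree at 0; \<open>FE\<close> and
    \<open>FP\<close> then match the derivatives, with the sign that the reflection of x brings
    in.\<close>
  define U' where "U' = matrix_inv E ** P"
  have EU: "E ** U' = P"
    by (simp add: U'_def matrix_mul_assoc Ei)
  have "F ** (E' ** U') = F' ** P"
    by (simp add: matrix_mul_assoc FE) (simp add: EU flip: matrix_mul_assoc)
  also have "\<dots> = F ** (- P')"
    using FP by (simp add: mm.minus_right eq_neg_iff_add_eq_0 add.commute)
  finally have "madj (matrix_inv (jf ?R ?l 0)) ** F ** (E' ** U') = madj (matrix_inv (jf ?R ?l 0)) ** F ** (- P')"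
    by (simp add: matrix_mul_assoc[symmetric])
  then have EU': "E' ** U' = - P'"
    unfolding Fi by simp
  have "weyl_form ?R k 0 U' = - weyl_form V k 0 U"
  proof -
    have "wr P (- P') P (- P') = - wr P P' P P'"
      by (rule wr_uminus)
    then show ?thesis
      unfolding weyl_form_def EU[unfolded E_def] EU'[unfolded E'_def] P_def[symmetric] P'_def[symmetric]
      by (simp only: cs.minus_right linear_neg[OF bounded_linear.linear[OF bounded_linear_retr]])
  qed
  then have "weyl_form V k 0 U = 0"
    using weyl_form(1)[OF herm V k re, of U] weyl_form(1)[OF hR VR k re, of U'] by simp
  then show "U = 0" by (rule weyl_form(2)[OF herm V k re])
qed

section \<open>Functions with vanishing interval integrals\<close>

text \<open>Intervals generate the Borel sets, and Lebesgue sets differ from Borel sets by null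
  sets, so the integral of \<open>f\<close> vanishes over every measurable set and
  \<open>density_zero\<close> applies.\<close>

lemma AE_zero_if_interval_integrals_zero:
  fixes f :: "real \<Rightarrow> 'a::euclidean_space"
  assumes f: "integrable lebesgue f" and zero: "\<And>a b. a \<le> b \<Longrightarrow> integral {a..b} f = 0"
  shows "AE x in lebesgue. f x = 0"
proof (rule sigma_finite_measure.density_zero[OF _ f])
  show "sigma_finite_measure (lebesgue :: real measure)"
  proof
    obtain A :: "real set set" where A: "countable A" "A \<subseteq> sets lborel" "\<Union> A = space lborel" "\<forall>a\<in>A. emeasure lborel a \<noteq> \<infinity>"
      using lborel.sigma_finite_countable by blast
    have "emeasure lebesgue a = emeasure lborel a" if "a \<in> A" for a
    proof -
      have "a \<in> sets lborel" using A(2) that by blast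
      then show ?thesis by (simp add: emeasure_completion main_part_sets)
    qed
    then show "\<exists>A::real set set. countable A \<and> A \<subseteq> sets lebesgue \<and> \<Union> A = space lebesgue \<and> (\<forall>a\<in>A. emeasure lebesgue a \<noteq> \<infinity>)"
      using A by (intro exI[of _ A]) auto
  qed
next
  have si: "set_integrable lebesgue A f" if "A \<in> sets lebesgue" for A
    unfolding set_integrable_def by (rule integrable_mult_indicator[OF that f])
  have int: "set_lebesgue_integral lebesgue {a..b} f = 0" for a b
  proof (cases "a \<le> b")
    case True
    then show ?thesis
      using set_lebesgue_integral_eq_integral(2)[OF si, of "{a..b}"] zero[OF True] by simp
  qed (simp add: set_lebesgue_integral_def)
  \<comment> \<open>Needed for complements in the induction over Borel sets.\<close>
  have all: "integral\<^sup>L lebesgue f = 0"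
  proof -
    have "(\<lambda>n. \<integral>t. indicator {- real n..real n} t *\<^sub>R f t \<partial>lebesgue) \<longlonglongrightarrow> integral\<^sup>L lebesgue f"
    proof (rule integral_dominated_convergence)
      show "integrable lebesgue (\<lambda>t. norm (f t))" using f by (rule integrable_norm)
      show "AE t in lebesgue. (\<lambda>n. indicator {- real n..real n} t *\<^sub>R f t) \<longlonglongrightarrow> f t"
      proof (rule AE_I2)
        fix t :: real
        obtain N where N: "\<bar>t\<bar> \<le> real N" using real_arch_simple by blast
        have "\<forall>\<^sub>F n in sequentially. indicator {- real n..real n} t *\<^sub>R f t = f t"
          by (intro eventually_sequentiallyI[of N]) (use N in \<open>auto simp: indicator_def\<close>)
        then show "(\<lambda>n. indicator {- real n..real n} t *\<^sub>R f t) \<longlonglongrightarrow> f t"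
          by (rule tendsto_eventually)
      qed
      show "f \<in> borel_measurable lebesgue" using f by (rule borel_measurable_integrable)
      show "(\<lambda>t. indicator {- real n..real n} t *\<^sub>R f t) \<in> borel_measurable lebesgue" for n
        using si[of "{- real n..real n}"] unfolding set_integrable_def by (intro borel_measurable_integrable) auto
      show "AE t in lebesgue. norm (indicator {- real n..real n} t *\<^sub>R f t) \<le> norm (f t)" for n
        by (intro AE_I2) (auto simp: indicator_def)
    qed
    then show ?thesis
      using int unfolding set_lebesgue_integral_def by (simp add: LIMSEQ_const_iff)
  qed
  have borel: "set_lebesgue_integral lebesgue A f = 0" if "A \<in> sets borel" for A
    using that
  proof (induction rule: borel_set_induct)
    case empty
    show ?case by (simp add: set_lebesgue_integral_def)
  next
    case (interval a b)
    show ?case by (rule int)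
  next
    case (compl A)
    have "set_lebesgue_integral lebesgue (- A) f = (\<integral>t. f t - indicator A t *\<^sub>R f t \<partial>lebesgue)"
      unfolding set_lebesgue_integral_def
      by (intro Bochner_Integration.integral_cong refl) (auto simp: indicator_def)
    also have "\<dots> = integral\<^sup>L lebesgue f - set_lebesgue_integral lebesgue A f"
      unfolding set_lebesgue_integral_def
      by (rule Bochner_Integration.integral_diff[OF f]) (use si[of A] compl in \<open>auto simp: set_integrable_def\<close>)
    finally show ?case using all compl by simp
  next
    case (union F)
    have "set_lebesgue_integral lebesgue (\<Union>(range F)) f = (\<Sum>i. set_lebesgue_integral lebesgue (F i) f)"
    proof (rule lebesgue_integral_countable_add)
      show "F i \<inter> F j = {}" if "i \<noteq> j" for i j
        using union(1) that by (auto simp: disjoint_family_on_def)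
      show "F i \<in> sets lebesgue" for i using union by auto
      then show "set_integrable lebesgue (\<Union>(range F)) f" by (intro si) auto
    qed
    then show ?case using union by simp
  qed
  fix A :: "real set" assume "A \<in> sets lebesgue"
  then obtain S N N' where A: "A = S \<union> N" "N \<subseteq> N'" "N' \<in> null_sets lborel" "S \<in> sets lborel"
    by (rule sets_completionE)
  have "AE x in lebesgue. x \<notin> N'"
    using A(3) by (intro AE_completion) (simp add: AE_not_in)
  then have "AE x in lebesgue. indicator A x *\<^sub>R f x = indicator S x *\<^sub>R f x"
    by eventually_elim (use A in \<open>auto simp: indicator_def\<close>)
  moreover have "A \<in> sets lebesgue" "S \<in> sets lebesgue" using A(4) \<open>A \<in> sets lebesgue\<close> by auto
  ultimately have "set_lebesgue_integral lebesgue A f = set_lebesgue_integral lebesgue S f"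
    unfolding set_lebesgue_integral_def using si[unfolded set_integrable_def]
    by (intro integral_cong_AE borel_measurable_integrable) auto
  then show "set_lebesgue_integral lebesgue A f = 0"
    using borel[of S] A(4) by simp
qed

section \<open>High energy asymptotics\<close>

text \<open>For the inverse X, the identity X - 1 = -(A - 1) X gives first the bound of X and then
  that of X - 1.\<close>

lemma norm_sub_one_half_inverse:
  fixes A :: "complex^'n^'n"
  assumes "norm (A - mat 1) \<le> 1 / 2"
  shows "invertible A" and "norm (matrix_inv A) \<le> 2 * norm (mat 1 :: complex^'n^'n)"
    and "norm (matrix_inv A - mat 1) \<le> 2 * norm (mat 1 :: complex^'n^'n) * norm (A - mat 1)"
proof -
  show inv: "invertible A"
  proof (rule invertible_if_mult_eq_0)
    fix U :: "complex^'n^'n" assume "A ** U = 0"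
    then have "U = - ((A - mat 1) ** U)" by (simp add: mm.diff_left)
    then have "norm U \<le> norm (A - mat 1) * norm U"
      using norm_matrix_mult_le[of "A - mat 1" U] by (metis norm_minus_cancel)
    also have "\<dots> \<le> 1 / 2 * norm U" using assms by (intro mult_right_mono) auto
    finally show "U = 0" by simp
  qed
  let ?X = "matrix_inv A"
  have X: "?X - mat 1 = - ((A - mat 1) ** ?X)"
    using matrix_inv_right_left(1)[OF inv] by (simp add: mm.diff_left)
  then have le: "norm (?X - mat 1) \<le> norm (A - mat 1) * norm ?X"
    using norm_matrix_mult_le[of "A - mat 1" ?X] by simp
  also have "\<dots> \<le> 1 / 2 * norm ?X" using assms by (intro mult_right_mono) auto
  finally have "norm (?X - mat 1) \<le> 1 / 2 * norm ?X" .
  moreover have "norm ?X \<le> norm (?X - mat 1) + norm (mat 1 :: complex^'n^'n)"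
    using norm_triangle_ineq[of "?X - mat 1" "mat 1"] by simp
  ultimately show X2: "norm ?X \<le> 2 * norm (mat 1 :: complex^'n^'n)" by linarith
  have "norm (A - mat 1) * norm ?X \<le> norm (A - mat 1) * (2 * norm (mat 1 :: complex^'n^'n))"
    using X2 by (rule mult_left_mono) simp
  with le show "norm (?X - mat 1) \<le> 2 * norm (mat 1 :: complex^'n^'n) * norm (A - mat 1)"
    by (simp add: mult_ac)
qed

text \<open>One constant for all |k| \<ge> 1: the first two factors bound \<open>vm\<close>, and the
  factor 1 + Q, with Q the integral of norm V, makes room for \<open>vn\<close> and for k (vm -
  1).\<close>

definition hiC :: "(real \<Rightarrow> complex^'n^'n) \<Rightarrow> real" where
  "hiC V = norm (mat 1 :: complex^'n^'n) * exp (\<integral>t. norm (V t) \<partial>lebesgue) * (1 + (\<integral>t. norm (V t) \<partial>lebesgue))"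

lemma high_energy_bounds:
  fixes V :: "real \<Rightarrow> complex^'n^'n"
  assumes V: "decays \<gamma> V" and k: "0 \<le> Im k" "1 \<le> norm k"
  shows "norm (vm V k x) \<le> hiC V" "norm (vn V k x) \<le> hiC V"
    "norm (vm V k x - mat 1) \<le> hiC V / norm k"
proof -
  let ?Q = "\<integral>t. norm (V t) \<partial>lebesgue" and ?N = "norm (mat 1 :: complex^'n^'n)"
  have k0: "k \<noteq> 0" using k by auto
  have Q: "0 \<le> ?Q" by (intro Bochner_Integration.integral_nonneg) auto
  have "?Q / norm k \<le> ?Q" using divide_left_mono[OF k(2) Q] k0 by simp
  then have e: "vC V k \<le> ?N * exp ?Q"
    unfolding vC_def by (intro mult_left_mono) auto
  also have "\<dots> \<le> hiC V"
    unfolding hiC_def using Q by (intro mult_left_mono[of 1 "1 + ?Q", simplified]) auto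
  finally have "vC V k \<le> hiC V" .
  then show "norm (vm V k x) \<le> hiC V"
    using vm_upper_bound[OF V k(1) k0, of x] by (simp add: vC_def)
  have vQ: "vC V k * ?Q \<le> hiC V"
  proof -
    have "vC V k * ?Q \<le> ?N * exp ?Q * (1 + ?Q)"
      using e Q by (intro mult_mono) auto
    then show ?thesis by (simp add: hiC_def)
  qed
  then show "norm (vn V k x) \<le> hiC V"
    using vn_le[OF V k(1) k0, of x] by simp
  have "vC V k / norm k * ?Q \<le> hiC V / norm k"
    using divide_right_mono[OF vQ, of "norm k"] by simp
  then show "norm (vm V k x - mat 1) \<le> hiC V / norm k"
    using vm_sub_one_le[OF V k(1) k0, of x] by simp
qed

text \<open>At k = i\<kappa> the factor 2\<kappa> turns \<open>vker k s\<close> into 1 -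
  exp(-2\<kappa>s), which lies between 0 and 1 and tends to 1 for s > 0; as \<open>vm\<close> tends
  to 1 too, only V is left under the integral.\<close>

lemma vm_imag_asymptotics:
  fixes V :: "real \<Rightarrow> complex^'n^'n"
  assumes V: "decays \<gamma> V"
  shows "(\<lambda>n. of_real (2 * real (Suc n)) \<odot> (vm V (\<i> * of_real (real (Suc n))) x - mat 1))
    \<longlonglongrightarrow> (LINT t:{x..}|lebesgue. V t)"
proof -
  \<comment> \<open>\<open>Suc n\<close> instead of n keeps norm (k n) at least 1, as
    \<open>high_energy_bounds\<close> requires.\<close>
  define k where "k = (\<lambda>n. \<i> * complex_of_real (real (Suc n)))"
  have nk: "norm (k n) = real (Suc n)" for n
    by (simp add: k_def norm_mult del: of_nat_Suc)
  have k: "0 \<le> Im (k n)" "1 \<le> norm (k n)" "k n \<noteq> 0" "- \<gamma> < Im (k n)" for n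
    using V nk[of n] by (auto simp: k_def decays_def)
  let ?f = "\<lambda>n t. of_real (2 * real (Suc n)) \<odot> vker (k n) (t - x) \<odot> (V t ** vm V (k n) t)"
  have ker: "of_real (2 * real (Suc n)) * vker (k n) s = of_real (1 - exp (- (2 * real (Suc n) * s)))" if "0 < s" for n s
  proof -
    have 1: "2 * \<i> * k n = - of_real (2 * real (Suc n))"
      by (simp add: k_def complex_eq_iff del: of_nat_Suc)
    have "vker (k n) s = (exp (- of_real (2 * real (Suc n)) * of_real s) - 1) / (- of_real (2 * real (Suc n)))"
      using vker_eq[OF k(3), of s n] that unfolding 1 by simp
    then have "of_real (2 * real (Suc n)) * vker (k n) s = 1 - exp (- of_real (2 * real (Suc n)) * complex_of_real s)"
      by (simp add: divide_simps del: of_nat_Suc) (simp add: algebra_simps)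
    also have "exp (- of_real (2 * real (Suc n)) * complex_of_real s) = of_real (exp (- (2 * real (Suc n) * s)))"
      by (simp only: exp_of_real[symmetric] of_real_minus of_real_mult mult_minus_left)
    finally show ?thesis by simp
  qed
  have meas: "?f n \<in> borel_measurable lebesgue" for n
  proof -
    have "(\<lambda>t. vker (k n) (t - x) \<odot> (V t ** vm V (k n) t)) \<in> borel_measurable lebesgue"
      by (intro vker_cscale_measurable borel_measurable_matrix_mult decays_measurable[OF V] vm_measurable[OF V k(4)])
    then show ?thesis by (rule borel_measurable_cscale[OF borel_measurable_const])
  qed
  have "(\<lambda>n. \<integral>t. ?f n t \<partial>lebesgue) \<longlonglongrightarrow> (\<integral>t. indicator {x..} t *\<^sub>R V t \<partial>lebesgue)"
  proof (rule integral_dominated_convergence)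
    show "integrable lebesgue (\<lambda>t. hiC V * norm (V t))"
      using integrable_norm[OF decays_integrable[OF V]] by simp
    show "(\<lambda>t. indicator {x..} t *\<^sub>R V t) \<in> borel_measurable lebesgue"
      by (intro borel_measurable_scaleR borel_measurable_indicator decays_measurable[OF V]) auto
    have lim: "(\<lambda>n. ?f n t) \<longlonglongrightarrow> indicator {x..} t *\<^sub>R V t" if "t \<noteq> x" for t
    proof (cases "x < t")
      case True
      have "(\<lambda>n. vm V (k n) t - mat 1) \<longlonglongrightarrow> 0"
      proof (rule Lim_null_comparison)
        show "\<forall>\<^sub>F n in sequentially. norm (vm V (k n) t - mat 1) \<le> hiC V / real (Suc n)"
          using high_energy_bounds(3)[OF V k(1,2), of _ t] unfolding nk by (intro always_eventually allI)
        show "(\<lambda>n. hiC V / real (Suc n)) \<longlonglongrightarrow> 0"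
          by (rule LIMSEQ_Suc[OF lim_const_over_n])
      qed
      then have m: "(\<lambda>n. vm V (k n) t) \<longlonglongrightarrow> mat 1" by (rule Lim_null[THEN iffD2])
      have "filterlim (\<lambda>n. 2 * (t - x) * real (Suc n)) at_top sequentially"
        using True by (intro filterlim_tendsto_pos_mult_at_top[OF tendsto_const]
            filterlim_compose[OF filterlim_real_sequentially filterlim_Suc]) auto
      then have "(\<lambda>n. exp (- (2 * (t - x) * real (Suc n)))) \<longlonglongrightarrow> 0"
        by (intro filterlim_compose[OF exp_at_bot] filterlim_compose[OF filterlim_uminus_at_bot_at_top])
      then have "(\<lambda>n. complex_of_real (1 - exp (- (2 * real (Suc n) * (t - x))))) \<longlonglongrightarrow> of_real (1 - 0)"
        by (intro tendsto_of_real tendsto_diff tendsto_const) (simp only: mult_ac)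
      then have "(\<lambda>n. of_real (1 - exp (- (2 * real (Suc n) * (t - x)))) \<odot> (V t ** vm V (k n) t)) \<longlonglongrightarrow> of_real (1 - 0) \<odot> (V t ** mat 1)"
        by (intro cs.tendsto mm.tendsto tendsto_const m)
      then show ?thesis
        unfolding cscale_cscale using True by (simp only: ker diff_gt_0_iff_gt) simp
    qed (use that in simp)
    \<comment> \<open>At t = x the kernel is 0 for every n while the indicator is 1, so this point
      is excluded.\<close>
    have "negligible {x}" by simp
    then have "AE t in lebesgue. t \<notin> {x}" by (simp only: negligible_iff_null_sets AE_not_in)
    then show "AE t in lebesgue. (\<lambda>n. ?f n t) \<longlonglongrightarrow> indicator {x..} t *\<^sub>R V t"
      by eventually_elim (use lim in auto)
    show "AE t in lebesgue. norm (?f n t) \<le> hiC V * norm (V t)" for n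
    proof (rule AE_I2)
      fix t
      have h: "0 \<le> hiC V" using order_trans[OF norm_ge_zero high_energy_bounds(1)[OF V k(1,2)]] .
      show "norm (?f n t) \<le> hiC V * norm (V t)"
      proof (cases "x < t")
        case True
        have "norm (V t ** vm V (k n) t) \<le> norm (V t) * norm (vm V (k n) t)"
          by (rule norm_matrix_mult_le)
        also have "\<dots> \<le> norm (V t) * hiC V"
          by (intro mult_left_mono high_energy_bounds(1)[OF V k(1,2)]) auto
        finally have "norm (1 - exp (- (2 * real (Suc n) * (t - x)))) * norm (V t ** vm V (k n) t) \<le> 1 * (norm (V t) * hiC V)"
          using True by (intro mult_mono) auto
        then show ?thesis
          unfolding cscale_cscale using True
          by (simp only: ker diff_gt_0_iff_gt norm_cscale norm_of_real real_norm_def) (simp add: mult.commute)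
      qed (use h in simp)
    qed
  qed (rule meas)
  moreover have "(\<integral>t. ?f n t \<partial>lebesgue) = of_real (2 * real (Suc n)) \<odot> (vm V (k n) x - mat 1)" for n
  proof -
    have "of_real (2 * real (Suc n)) \<odot> (vm V (k n) x - mat 1) = of_real (2 * real (Suc n)) \<odot> volt (k n) (\<lambda>t. V t ** vm V (k n) t) x"
      using vm_volterra[OF V k(4), of n x] by simp
    also have "\<dots> = (\<integral>t. ?f n t \<partial>lebesgue)"
      unfolding volt_def
    proof (rule integral_bounded_linear[OF cs.bounded_linear_right, symmetric])
      show "integrable lebesgue (\<lambda>t. vker (k n) (t - x) \<odot> (V t ** vm V (k n) t))"
      proof (rule Bochner_Integration.integrable_bound)
        show "integrable lebesgue (\<lambda>t. vbound 0 \<gamma> V x * vmaj 0 \<gamma> V x t)"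
          using vmaj_integrable[OF V] by simp
        show "(\<lambda>t. vker (k n) (t - x) \<odot> (V t ** vm V (k n) t)) \<in> borel_measurable lebesgue"
          by (intro vker_cscale_measurable borel_measurable_matrix_mult decays_measurable[OF V] vm_measurable[OF V k(4)])
        have "norm (vker (k n) (t - x)) * norm (V t ** vm V (k n) t) \<le> vbound 0 \<gamma> V x * vmaj 0 \<gamma> V x t" for t
          by (rule vm_dominated[OF V order_refl _ _ order_refl]) (use k(1)[of n] V in \<open>auto simp: decays_def\<close>)
        then show "AE t in lebesgue. norm (vker (k n) (t - x) \<odot> (V t ** vm V (k n) t)) \<le> norm (vbound 0 \<gamma> V x * vmaj 0 \<gamma> V x t)"
          by (intro AE_I2) (auto intro: order_trans[OF _ abs_ge_self])
      qed
    qed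
    finally show ?thesis by simp
  qed
  ultimately show ?thesis
    by (simp add: k_def set_lebesgue_integral_def)
qed

section \<open>Continuation of the transition matrix\<close>

text \<open>\<open>ka V k\<close> continues \<open>k A(k)\<close> to \<open>Im k > - \<gamma>\<close>.\<close>

definition ka :: "(real \<Rightarrow> complex^'n^'n) \<Rightarrow> complex \<Rightarrow> complex^'n^'n" where
  "ka V k = (1 / (2 * \<i>)) \<odot>
     (madj (vm (refl_pot V) (- cnj k) 0) ** ((\<i> * k) \<odot> vm V k 0 + vn V k 0)
      + ((\<i> * k) \<odot> madj (vm (refl_pot V) (- cnj k) 0) + madj (vn (refl_pot V) (- cnj k) 0)) ** vm V k 0)"

lemma minus_cnj_half_plane: "(\<lambda>k. - cnj k) ` half_plane \<gamma> \<subseteq> half_plane \<gamma>"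
  by auto

lemma mhol_ka:
  assumes "decays \<gamma> V"
  shows "mhol (ka V) (half_plane \<gamma>)"
  unfolding ka_def[abs_def]
  by (intro mhol_cscale mhol_add mhol_mult mhol_vm[OF assms] mhol_vn[OF assms] holomorphic_intros
      mhol_madj_minus_cnj[OF mhol_vm[OF decays_refl_pot[OF assms]] open_half_plane minus_cnj_half_plane]
      mhol_madj_minus_cnj[OF mhol_vn[OF decays_refl_pot[OF assms]] open_half_plane minus_cnj_half_plane])

lemma coefA_eq_ka:
  assumes herm: "hermitian V"
    and V: "decays \<gamma> V" and k: "0 \<le> Im k" and k0: "k \<noteq> 0"
  shows "coefA V k = (1 / k) \<odot> ka V k"
proof -
  have 1: "gm V (- cnj k) 0 = vm (refl_pot V) (- cnj k) 0"
    by (simp add: gm_def jf_def)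
  have 2: "gm' V (- cnj k) 0 = - ((\<i> * (- cnj k)) \<odot> vm (refl_pot V) (- cnj k) 0 + vn (refl_pot V) (- cnj k) 0)"
    by (simp add: gm'_def jf'_def)
  have 3: "jf V k 0 = vm V k 0" "jf' V k 0 = (\<i> * k) \<odot> vm V k 0 + vn V k 0"
    by (simp_all add: jf_def jf'_def)
  have c: "cnj (\<i> * (- cnj k)) = \<i> * k" by simp
  show ?thesis
    unfolding coefA_eq[OF assms, of 0] 1 2 3 wr_def ka_def madj_minus madj_add madj_cscale c mm.minus_left
      cscale_cscale diff_minus_eq_add
    using k0 by (simp add: mult.commute)
qed

text \<open>The parts of the Wronskian with ik add up to 2ik M m, where M and m are the values at 0
  of the two factors stripped of exponentials. After division by 2ik the coefficient is M m plus a
  remainder of order 1/k, and M and m are themselves 1 + O(1/k).\<close>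

lemma coefA_sub_one_le:
  fixes V :: "real \<Rightarrow> complex^'n^'n"
  assumes herm: "hermitian V"
    and V: "decays \<gamma> V" and k: "0 \<le> Im k" "1 \<le> norm k"
  shows "norm (coefA V k - mat 1) \<le> (2 * (hiC V * hiC (refl_pot V)) + hiC V + hiC (refl_pot V)) / norm k"
proof -
  have k0: "k \<noteq> 0" and l: "0 \<le> Im (- cnj k)" "1 \<le> norm (- cnj k)" using k by auto
  note VR = decays_refl_pot[OF V]
  let ?m = "vm V k 0" and ?n = "vn V k 0"
  let ?M = "madj (vm (refl_pot V) (- cnj k) 0)" and ?N = "madj (vn (refl_pot V) (- cnj k) 0)"
  note b = high_energy_bounds[OF V k, of 0]
  have B: "norm ?M \<le> hiC (refl_pot V)" "norm ?N \<le> hiC (refl_pot V)" "norm (?M - mat 1) \<le> hiC (refl_pot V) / norm k"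
  proof -
    show "norm ?M \<le> hiC (refl_pot V)" "norm ?N \<le> hiC (refl_pot V)"
      using high_energy_bounds(1,2)[OF VR l, of 0] by simp_all
    have "?M - mat 1 = madj (vm (refl_pot V) (- cnj k) 0 - mat 1)"
      by (simp add: madj_diff)
    then show "norm (?M - mat 1) \<le> hiC (refl_pot V) / norm k"
      using high_energy_bounds(3)[OF VR l, of 0] by simp
  qed
  have h: "0 \<le> hiC V" "0 \<le> hiC (refl_pot V)"
    using order_trans[OF norm_ge_zero b(1)] order_trans[OF norm_ge_zero B(1)] by auto
  have "coefA V k - mat 1 = (1 / (2 * \<i> * k)) \<odot> (?M ** ?n + ?N ** ?m) + (?M - mat 1) ** ?m + (?m - mat 1)"
  proof -
    have "coefA V k = (1 / (2 * \<i> * k)) \<odot> (?M ** ?n + ?N ** ?m) + ?M ** ?m"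
      unfolding coefA_eq_ka[OF herm V k(1) k0] ka_def mm.add_left mm.add_right cscale_mult_left cscale_mult_right
      using k0 by (simp add: vec_eq_iff field_simps)
    then show ?thesis by (simp add: mm.diff_left)
  qed
  also have "norm \<dots> \<le> norm ((1 / (2 * \<i> * k)) \<odot> (?M ** ?n + ?N ** ?m)) + norm ((?M - mat 1) ** ?m) + norm (?m - mat 1)"
    by (intro order_trans[OF norm_triangle_ineq] add_right_mono norm_triangle_ineq)
  also have "norm ((1 / (2 * \<i> * k)) \<odot> (?M ** ?n + ?N ** ?m)) \<le> hiC V * hiC (refl_pot V) / norm k"
  proof -
    have "norm (?M ** ?n) \<le> hiC (refl_pot V) * hiC V" "norm (?N ** ?m) \<le> hiC (refl_pot V) * hiC V"
      using b B h by (auto intro!: order_trans[OF norm_matrix_mult_le] mult_mono)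
    then have "norm (?M ** ?n + ?N ** ?m) \<le> 2 * (hiC V * hiC (refl_pot V))"
      using norm_triangle_ineq[of "?M ** ?n" "?N ** ?m"] by (simp add: mult.commute)
    then have "1 / (2 * norm k) * norm (?M ** ?n + ?N ** ?m) \<le> 1 / (2 * norm k) * (2 * (hiC V * hiC (refl_pot V)))"
      by (intro mult_left_mono) auto
    then show ?thesis by (simp add: norm_divide norm_mult)
  qed
  also have "norm ((?M - mat 1) ** ?m) \<le> hiC V * hiC (refl_pot V) / norm k"
  proof -
    have "norm ((?M - mat 1) ** ?m) \<le> hiC (refl_pot V) / norm k * hiC V"
      using b B h by (intro order_trans[OF norm_matrix_mult_le] mult_mono) auto
    then show ?thesis by (simp add: mult.commute)
  qed
  also have "norm (?m - mat 1) \<le> (hiC V + hiC (refl_pot V)) / norm k"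
    using b(3) h by (simp add: add_divide_distrib order_trans[OF b(3)])
  finally show ?thesis by (simp add: add_divide_distrib)
qed

lemma matrix_inv_unique:
  fixes A X :: "complex^'n^'n"
  assumes "A ** X = mat 1" "X ** A = mat 1"
  shows "matrix_inv A = X"
proof -
  have "invertible A" using assms by (auto simp: invertible_def)
  note i = matrix_inv_right_left[OF this]
  have "matrix_inv A = matrix_inv A ** (A ** X)" by (simp add: assms)
  also have "\<dots> = X" by (simp add: matrix_mul_assoc i)
  finally show ?thesis .
qed

lemma invertible_cscale_iff:
  fixes A :: "complex^'n^'n"
  assumes "c \<noteq> 0"
  shows "invertible (c \<odot> A) \<longleftrightarrow> invertible A"
proof -
  have *: "invertible (d \<odot> B)" if "d \<noteq> 0" "invertible B" for d and B :: "complex^'n^'n"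
    unfolding invertible_def
    by (rule exI[of _ "(1 / d) \<odot> matrix_inv B"]) (use that matrix_inv_right_left[OF that(2)] in simp)
  show ?thesis
    using *[OF assms, of A] *[of "1 / c" "c \<odot> A"] assms by auto
qed

lemma matrix_inv_cscale:
  fixes A :: "complex^'n^'n"
  assumes "c \<noteq> 0" "invertible A"
  shows "matrix_inv (c \<odot> A) = (1 / c) \<odot> matrix_inv A"
  by (rule matrix_inv_unique) (use assms matrix_inv_right_left[OF assms(2)] in simp_all)

lemma one_islimpt_reals: "(1::complex) islimpt complex_of_real ` {0<..}"
  unfolding islimpt_approachable
proof (intro allI impI)
  fix e :: real assume "e > 0"
  have "dist (complex_of_real (1 + e / 2)) 1 = e / 2"
    using \<open>e > 0\<close> by (simp add: dist_norm norm_of_real del: of_real_add) simp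
  then show "\<exists>x'\<in>complex_of_real ` {0<..}. x' \<noteq> 1 \<and> dist x' 1 < e"
    using \<open>e > 0\<close> by (intro bexI[of _ "complex_of_real (1 + e / 2)"]) (auto simp: complex_eq_iff)
qed

text \<open>The identity theorem, with 1 as limit point of the positive reals. The point k = 0,
  where the scattering data are not given, stays out of the comparison set.\<close>

lemma mhol_eq_if_eq_on_reals:
  assumes F: "mhol F U" and G: "mhol G U" and U: "open U" "connected U"
    and sub: "complex_of_real ` {0<..} \<subseteq> U"
    and eq: "\<And>t. 0 < t \<Longrightarrow> F (complex_of_real t) = G (complex_of_real t)" and k: "k \<in> U"
  shows "F k = G k"
proof -
  have "F k $ i $ j - G k $ i $ j = 0" for i j
  proof (rule analytic_continuation[OF _ U sub _ one_islimpt_reals _ k])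
    show "(\<lambda>k. F k $ i $ j - G k $ i $ j) holomorphic_on U"
      by (intro holomorphic_intros mholD F G)
    have "complex_of_real 1 \<in> U" using sub by (rule subsetD) (rule image_eqI[of _ _ 1], auto)
    then show "1 \<in> U" by simp
    show "F z $ i $ j - G z $ i $ j = 0" if "z \<in> complex_of_real ` {0<..}" for z
      using that eq by auto
  qed
  then show ?thesis by (simp add: vec_eq_iff)
qed

lemma mhol_continuous:
  assumes "mhol F U"
  shows "continuous_on U F"
proof -
  have "continuous_on U (\<lambda>k. \<chi> i j. F k $ i $ j)"
    by (intro continuous_on_vec_lambda holomorphic_on_imp_continuous_on mholD[OF assms])
  then show ?thesis by simp
qed

lemma mhol_Un:
  assumes "mhol F U" "mhol F W" "open U" "open W"
  shows "mhol F (U \<union> W)"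
  using assms by (auto simp: mhol_def intro: holomorphic_on_Un)

lemma mhol_cong:
  assumes "mhol F U" "\<And>k. k \<in> U \<Longrightarrow> F k = G k"
  shows "mhol G U"
  unfolding mhol_def
proof (intro allI)
  fix i j show "(\<lambda>k. G k $ i $ j) holomorphic_on U"
    by (rule holomorphic_transform[OF mholD[OF assms(1)]]) (simp add: assms(2))
qed

section \<open>Uniqueness\<close>

text \<open>\<open>tinv\<close> continues \<open>A(k)\<^sup>-\<^sup>1\<close>.\<close>

definition tinv :: "(real \<Rightarrow> complex^'n^'n) \<Rightarrow> complex \<Rightarrow> complex^'n^'n" where
  "tinv V k = k \<odot> matrix_inv (ka V k)"

section \<open>Mixed Green functions on the real axis\<close>

text \<open>At equal arguments the exponentials of the two Jost factors cancel, which keeps the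
  function bounded at high energy.\<close>

definition green :: "(real \<Rightarrow> complex^'n^'n) \<Rightarrow> (real \<Rightarrow> complex^'n^'n) \<Rightarrow> real \<Rightarrow> complex \<Rightarrow> complex^'n^'n" where
  "green V W x k = vm V k x ** tinv V k ** madj (vm (refl_pot W) (- cnj k) (- x))"

definition green_diff :: "(real \<Rightarrow> complex^'n^'n) \<Rightarrow> (real \<Rightarrow> complex^'n^'n) \<Rightarrow> real \<Rightarrow> complex \<Rightarrow> complex^'n^'n" where
  "green_diff V W x k = green V W x k - madj (green W V x (- cnj k))"

text \<open>\<open>vm (refl_pot V) k (- x)\<close> is exp(ikx) f_-(k,x). No inverse of A occurs,
  hence no pole in the strip.\<close>

definition strip_diff :: "(real \<Rightarrow> complex^'n^'n) \<Rightarrow> (real \<Rightarrow> complex^'n^'n) \<Rightarrow> real \<Rightarrow> complex \<Rightarrow> complex^'n^'n" where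
  "strip_diff V W x k = vm (refl_pot V) (- k) (- x) ** madj (vm (refl_pot W) (- cnj k) (- x))
     - vm (refl_pot V) k (- x) ** madj (vm (refl_pot W) (cnj k) (- x))"

lemma strip_diff_uminus: "strip_diff V W x (- k) = - strip_diff V W x k"
  by (simp add: strip_diff_def)

lemma tinv_eq:
  assumes "hermitian V" "decays \<gamma> V" "0 \<le> Im k" "k \<noteq> 0" "invertible (coefA V k)"
  shows "tinv V k = matrix_inv (coefA V k)"
proof -
  have "ka V k = k \<odot> coefA V k"
    using assms(4) by (simp add: coefA_eq_ka[OF assms(1-4)])
  then show ?thesis
    using assms(4) by (simp add: tinv_def matrix_inv_cscale[OF assms(4,5)])
qed

text \<open>This is \<open>jf_connection\<close> multiplied by the inverse of A and by exp(-ikx); a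
  factor exp(-2ikx) remains at f_-(k), whose exponential is opposite to that of f_+(k).\<close>

lemma vm_tinv_real:
  fixes V :: "real \<Rightarrow> complex^'n^'n" and k :: real
  assumes herm: "hermitian V" and V: "decays \<gamma> V" and k: "k \<noteq> 0"
  shows "vm V k x ** tinv V k = vm (refl_pot V) (- k) (- x)
    + exp (- 2 * \<i> * k * x) \<odot> (vm (refl_pot V) k (- x) ** refl_minus V k)"
proof -
  note inv = invertible_coefA_real[OF herm V k]
  let ?e = "exp (\<i> * complex_of_real k * complex_of_real x)" and ?e' = "exp (- (\<i> * complex_of_real k * complex_of_real x))"
  have t: "tinv V k = matrix_inv (coefA V k)"
    using k inv by (intro tinv_eq[OF herm V]) auto
  have g: "gm V (- k) x = ?e \<odot> vm (refl_pot V) (- k) (- x)" "gm V k x = ?e' \<odot> vm (refl_pot V) k (- x)"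
    by (simp_all add: gm_def jf_def)
  have "?e \<odot> (vm V k x ** tinv V k) = jf V k x ** matrix_inv (coefA V k)"
    by (simp add: jf_def t)
  also have "\<dots> = gm V (- k) x ** (coefA V k ** matrix_inv (coefA V k)) + gm V k x ** (coefB V k ** matrix_inv (coefA V k))"
    unfolding jf_connection(1)[OF herm V k] mm.add_left by (simp only: matrix_mul_assoc)
  also have "\<dots> = gm V (- k) x + gm V k x ** refl_minus V k"
    unfolding matrix_inv_right_left(1)[OF inv] by (simp add: refl_minus_def)
  finally have "?e' \<odot> ?e \<odot> (vm V k x ** tinv V k) = ?e' \<odot> (gm V (- k) x + gm V k x ** refl_minus V k)"
    by (rule arg_cong)
  moreover have "?e' * ?e = 1" "?e' * ?e' = exp (- 2 * \<i> * k * x)"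
    by (simp_all add: mult_exp_exp mult.assoc)
  ultimately show ?thesis
    unfolding g cs.add_right cscale_mult_left cscale_cscale by simp
qed

context
  fixes V1 V2 :: "real \<Rightarrow> complex^'n^'n" and \<gamma> :: real
  assumes herm1: "hermitian V1" and herm2: "hermitian V2"
    and V1: "decays \<gamma> V1" and V2: "decays \<gamma> V2"
    and zeros: "\<And>\<kappa>. \<gamma> \<le> \<kappa> \<Longrightarrow> det (coefA V1 (\<i> * complex_of_real \<kappa>)) \<noteq> 0"
    and A_eq: "\<And>k. k \<noteq> (0::real) \<Longrightarrow> coefA V1 (complex_of_real k) = coefA V2 (complex_of_real k)"
    and S_eq: "\<And>k. k \<noteq> (0::real) \<Longrightarrow> refl_minus V1 (complex_of_real k) = refl_minus V2 (complex_of_real k)"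
begin

lemma green_diff_real:
  assumes k: "k \<noteq> (0::real)"
  shows "green_diff V1 V2 x k = strip_diff V1 V2 x k"
proof -
  let ?p1 = "vm (refl_pot V1) (- k) (- x)" and ?q1 = "vm (refl_pot V1) k (- x)"
  let ?p2 = "vm (refl_pot V2) (- k) (- x)" and ?q2 = "vm (refl_pot V2) k (- x)"
  let ?E = "exp (- 2 * \<i> * complex_of_real k * complex_of_real x)"
  have m: "- k \<noteq> 0" using k by simp
  have 1: "vm V1 k x ** tinv V1 k = ?p1 + ?E \<odot> (?q1 ** refl_minus V1 k)"
    using vm_tinv_real[OF herm1 V1 k, of x] by simp
  have c: "cnj (exp (2 * \<i> * complex_of_real k * complex_of_real x)) = ?E"
    by (simp add: exp_cnj)
  have S: "madj (refl_minus V2 (- complex_of_real k)) = refl_minus V1 k"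
    using refl_minus_symmetric[OF herm2 V2 k] S_eq[OF k] by simp
  have "vm V2 (- complex_of_real k) x ** tinv V2 (- complex_of_real k)
      = ?q2 + exp (2 * \<i> * complex_of_real k * complex_of_real x) \<odot> (vm (refl_pot V2) (- complex_of_real k) (- x) ** refl_minus V2 (- complex_of_real k))"
    using vm_tinv_real[OF herm2 V2 m, of x] by simp
  then have 2: "madj (vm V2 (- complex_of_real k) x ** tinv V2 (- complex_of_real k))
      = madj ?q2 + ?E \<odot> (refl_minus V1 k ** madj (vm (refl_pot V2) (- complex_of_real k) (- x)))"
    by (simp add: madj_add madj_mult S exp_cnj)
  have "green V2 V1 x (- cnj k) = (vm V2 (- complex_of_real k) x ** tinv V2 (- complex_of_real k)) ** madj ?q1"
    by (simp add: green_def)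
  then have "madj (green V2 V1 x (- cnj k)) = ?q1 ** (madj ?q2 + ?E \<odot> (refl_minus V1 k ** madj ?p2))"
    using 2 by (simp only: madj_mult[of _ "madj ?q1"] madj_madj) simp
  moreover have "green V1 V2 x k = (?p1 + ?E \<odot> (?q1 ** refl_minus V1 k)) ** madj ?p2"
    unfolding green_def 1 by simp
  ultimately have "green_diff V1 V2 x k = (?p1 + ?E \<odot> (?q1 ** refl_minus V1 k)) ** madj ?p2
      - ?q1 ** (madj ?q2 + ?E \<odot> (refl_minus V1 k ** madj ?p2))"
    by (simp only: green_diff_def)
  also have "\<dots> = ?p1 ** madj ?p2 - ?q1 ** madj ?q2"
    by (simp add: mm.add_left mm.add_right matrix_mul_assoc)
  also have "\<dots> = strip_diff V1 V2 x k"
    by (simp add: strip_diff_def)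
  finally show ?thesis .
qed

text \<open>Multiplied by k the coefficients are holomorphic across 0, so the identity theorem
  carries their agreement from the real axis through the half-plane, and with it the zeros of the
  determinant.\<close>

lemma ka_eq:
  assumes "- \<gamma> < Im k"
  shows "ka V1 k = ka V2 k"
proof (rule mhol_eq_if_eq_on_reals[OF mhol_ka[OF V1] mhol_ka[OF V2] open_half_plane])
  show "connected (half_plane \<gamma>)"
    by (intro convex_connected convex_halfspace_Im_gt)
  have "0 < \<gamma>" using V1 by (simp add: decays_def)
  then show "complex_of_real ` {0<..} \<subseteq> half_plane \<gamma>" by auto
  fix t :: real assume t: "0 < t"
  then have "(1 / complex_of_real t) \<odot> ka V1 t = (1 / complex_of_real t) \<odot> ka V2 t"
    using A_eq[of t] coefA_eq_ka[OF herm1 V1, of t] coefA_eq_ka[OF herm2 V2, of t] by simp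
  then have "complex_of_real t \<odot> (1 / complex_of_real t) \<odot> ka V1 t = complex_of_real t \<odot> (1 / complex_of_real t) \<odot> ka V2 t"
    by (rule arg_cong)
  then show "ka V1 t = ka V2 t" using t by simp
qed (use assms in auto)

section \<open>Poles and continuation through the strip\<close>

lemma invertible_ka:
  assumes "\<gamma> \<le> Im k"
  shows "invertible (ka V1 k)"
proof -
  have k: "0 < Im k" "k \<noteq> 0" using assms V1 by (auto simp: decays_def)
  have "invertible (coefA V1 k)"
  proof (cases "Re k = 0")
    case True
    then have "k = \<i> * complex_of_real (Im k)" by (simp add: complex_eq_iff)
    then show ?thesis using zeros[OF assms] by (simp add: invertible_det_nz)
  qed (use invertible_coefA_off_axis[OF herm1 V1 k(1)] in auto)
  then show ?thesis
    using k by (simp add: coefA_eq_ka[OF herm1 V1] invertible_cscale_iff)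
qed

lemma invertible_ka_real:
  assumes "k \<noteq> (0::real)"
  shows "invertible (ka V1 k)"
  using invertible_coefA_real[OF herm1 V1 assms] assms
  by (simp add: coefA_eq_ka[OF herm1 V1] invertible_cscale_iff)

text \<open>Symmetric under k -> - cnj k, since \<open>green_diff\<close> evaluates Green functions
  at both points.\<close>

definition regular :: "complex set" where
  "regular = {k. - \<gamma> < Im k \<and> invertible (ka V1 k) \<and> invertible (ka V1 (- cnj k))}"

lemma continuous_det_ka: "continuous_on (half_plane \<gamma>) (\<lambda>k. det (ka V1 k))"
  by (intro holomorphic_on_imp_continuous_on holomorphic_on_det mhol_ka V1)

lemma open_regular: "open regular"
proof -
  let ?A = "half_plane \<gamma> \<inter> (\<lambda>k. det (ka V1 k)) -` (- {0})"
  let ?B = "half_plane \<gamma> \<inter> (\<lambda>k. det (ka V1 (- cnj k))) -` (- {0})"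
  have "open ?A"
    by (intro continuous_open_preimage continuous_det_ka open_half_plane) auto
  moreover have "open ?B"
    by (intro continuous_open_preimage open_half_plane continuous_on_compose2[OF continuous_det_ka] continuous_intros) auto
  moreover have "regular = ?A \<inter> ?B"
    by (auto simp: regular_def invertible_det_nz)
  ultimately show ?thesis by (simp add: open_Int)
qed

text \<open>A non-constant holomorphic function on the half-plane has countably many zeros; the
  half-plane is exhausted by closed half-planes. If the determinant is constant, its value at k = 1
  shows that it never vanishes.\<close>

lemma countable_zeros: "countable {k \<in> half_plane \<gamma>. det (ka V1 k) = 0}"
proof (cases "(\<lambda>k. det (ka V1 k)) constant_on (half_plane \<gamma>)")
  case True
  have "det (ka V1 k) \<noteq> 0" if "- \<gamma> < Im k" for k
  proof -
    have "(1::complex) \<in> half_plane \<gamma>" using V1 by (simp add: decays_def)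
    then have "det (ka V1 k) = det (ka V1 1)"
      using True that by (auto simp: constant_on_def)
    then show ?thesis using invertible_ka_real[of 1] by (simp add: invertible_det_nz)
  qed
  then have Z: "{k \<in> half_plane \<gamma>. det (ka V1 k) = 0} = {}" by auto
  show ?thesis unfolding Z by simp
next
  case False
  have "half_plane \<gamma> = (\<Union>n. {k. - \<gamma> + inverse (real (Suc n)) \<le> Im k})" (is "_ = ?U")
  proof (intro equalityI subsetI)
    fix k assume "k \<in> half_plane \<gamma>"
    then obtain n where "inverse (real (Suc n)) < Im k + \<gamma>"
      using reals_Archimedean[of "Im k + \<gamma>"] by auto
    then have "k \<in> {k. - \<gamma> + inverse (real (Suc n)) \<le> Im k}" by simp
    then show "k \<in> ?U" by blast
  next
    fix k assume "k \<in> ?U"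
    then obtain n where "- \<gamma> + inverse (real (Suc n)) \<le> Im k" by blast
    moreover have "0 < inverse (real (Suc n))" by simp
    ultimately have "- \<gamma> < Im k" by linarith
    then show "k \<in> half_plane \<gamma>" by simp
  qed
  moreover have "fsigma ?U"
    by (intro fsigma.intros closed_halfspace_Im_ge)
  ultimately have "fsigma (half_plane \<gamma>)" by simp
  then show ?thesis
    by (intro holomorphic_countable_zeros[OF holomorphic_on_det[OF mhol_ka[OF V1]] open_half_plane _ _ False]
        convex_connected convex_halfspace_Im_gt)
qed

text \<open>An open connected set minus a countable set stays connected, so the identity theorem
  reaches every regular point of the strip from the real axis, past all poles.\<close>

lemma connected_strip_regular: "connected ({k. \<bar>Im k\<bar> < \<gamma>} \<inter> regular)"
proof -
  let ?Z = "{k \<in> half_plane \<gamma>. det (ka V1 k) = 0}"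
  have S: "{k. \<bar>Im k\<bar> < \<gamma>} = half_plane \<gamma> \<inter> {k. Im k < \<gamma>}" by auto
  have "connected ({k. \<bar>Im k\<bar> < \<gamma>} - (?Z \<union> (\<lambda>k. - cnj k) ` ?Z))"
  proof (rule connected_open_diff_countable)
    show "open {k. \<bar>Im k\<bar> < \<gamma>}"
      unfolding S by (intro open_Int open_halfspace_Im_gt open_halfspace_Im_lt)
    show "connected {k. \<bar>Im k\<bar> < \<gamma>}"
      unfolding S by (intro convex_connected convex_Int convex_halfspace_Im_gt convex_halfspace_Im_lt)
    show "countable (?Z \<union> (\<lambda>k. - cnj k) ` ?Z)"
      using countable_zeros by blast
  qed simp
  moreover have "{k. \<bar>Im k\<bar> < \<gamma>} - (?Z \<union> (\<lambda>k. - cnj k) ` ?Z) = {k. \<bar>Im k\<bar> < \<gamma>} \<inter> regular"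
  proof -
    have "k \<in> (\<lambda>k. - cnj k) ` ?Z \<longleftrightarrow> det (ka V1 (- cnj k)) = 0" if "\<bar>Im k\<bar> < \<gamma>" for k
    proof
      assume "det (ka V1 (- cnj k)) = 0"
      then show "k \<in> (\<lambda>k. - cnj k) ` ?Z"
        using that by (intro image_eqI[of _ _ "- cnj k"]) auto
    qed auto
    then show ?thesis by (auto simp: regular_def invertible_det_nz)
  qed
  ultimately show ?thesis by simp
qed

lemma mhol_green: "mhol (green V1 V2 x) regular" "mhol (green V2 V1 x) regular"
proof -
  have sub: "regular \<subseteq> half_plane \<gamma>" by (auto simp: regular_def)
  have refl: "(\<lambda>k. - cnj k) ` regular \<subseteq> half_plane \<gamma>" by (auto simp: regular_def)
  have t1: "mhol (tinv V1) regular"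
    unfolding tinv_def
    by (intro mhol_cscale mhol_matrix_inv mhol_subset[OF mhol_ka[OF V1] sub] holomorphic_intros) (simp add: regular_def)
  have t2: "mhol (tinv V2) regular"
    by (rule mhol_cong[OF t1]) (use sub ka_eq in \<open>auto simp: tinv_def\<close>)
  show "mhol (green V1 V2 x) regular" "mhol (green V2 V1 x) regular"
    unfolding green_def
    by (intro mhol_mult t1 t2 mhol_subset[OF mhol_vm[OF V1] sub] mhol_subset[OF mhol_vm[OF V2] sub]
        mhol_madj_minus_cnj[OF mhol_vm[OF decays_refl_pot[OF V1]] open_regular refl]
        mhol_madj_minus_cnj[OF mhol_vm[OF decays_refl_pot[OF V2]] open_regular refl])+
qed

lemma mhol_green_diff: "mhol (green_diff V1 V2 x) regular"
proof -
  have "(\<lambda>k. - cnj k) ` regular \<subseteq> regular" by (auto simp: regular_def)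
  then show ?thesis
    unfolding green_diff_def[abs_def]
    by (intro mhol_diff mhol_green mhol_madj_minus_cnj[OF mhol_green(2) open_regular])
qed

text \<open>Both k and -k occur, so the half-plane Im k > -\<gamma> where \<open>vm\<close> is
  holomorphic has to be met with its mirror image.\<close>

lemma mhol_strip_diff: "mhol (strip_diff V1 V2 x) {k. \<bar>Im k\<bar> < \<gamma>}"
proof -
  note R1 = mhol_vm[OF decays_refl_pot[OF V1]] and R2 = mhol_vm[OF decays_refl_pot[OF V2]]
  have S: "{k. \<bar>Im k\<bar> < \<gamma>} = half_plane \<gamma> \<inter> {k. Im k < \<gamma>}" by auto
  have op: "open {k. \<bar>Im k\<bar> < \<gamma>}"
    unfolding S by (intro open_Int open_halfspace_Im_gt open_halfspace_Im_lt)
  show ?thesis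
    unfolding strip_diff_def[abs_def]
    by (intro mhol_diff mhol_mult mhol_compose[OF R1] mhol_subset[OF R1] mhol_madj_minus_cnj[OF R2 op]
        mhol_madj_cnj[OF R2 op] holomorphic_intros) auto
qed

lemma green_diff_eq_strip_diff:
  assumes "k \<in> regular" "\<bar>Im k\<bar> < \<gamma>"
  shows "green_diff V1 V2 x k = strip_diff V1 V2 x k"
proof (rule mhol_eq_if_eq_on_reals[OF _ _ _ connected_strip_regular])
  have S: "{k. \<bar>Im k\<bar> < \<gamma>} = half_plane \<gamma> \<inter> {k. Im k < \<gamma>}" by auto
  show "open ({k. \<bar>Im k\<bar> < \<gamma>} \<inter> regular)"
    unfolding S by (intro open_Int open_halfspace_Im_gt open_halfspace_Im_lt open_regular)
  show "mhol (green_diff V1 V2 x) ({k. \<bar>Im k\<bar> < \<gamma>} \<inter> regular)"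
    by (rule mhol_subset[OF mhol_green_diff]) auto
  show "mhol (strip_diff V1 V2 x) ({k. \<bar>Im k\<bar> < \<gamma>} \<inter> regular)"
    by (rule mhol_subset[OF mhol_strip_diff]) auto
  have "0 < \<gamma>" using V1 by (simp add: decays_def)
  show "complex_of_real ` {0<..} \<subseteq> {k. \<bar>Im k\<bar> < \<gamma>} \<inter> regular"
  proof (rule image_subsetI)
    fix t :: real assume "t \<in> {0<..}"
    then show "complex_of_real t \<in> {k. \<bar>Im k\<bar> < \<gamma>} \<inter> regular"
      using invertible_ka_real[of t] invertible_ka_real[of "- t"] \<open>0 < \<gamma>\<close> by (simp add: regular_def)
  qed
  show "green_diff V1 V2 x (complex_of_real t) = strip_diff V1 V2 x (complex_of_real t)" if "0 < t" for t
    using that by (intro green_diff_real) auto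
qed (use assms in auto)

section \<open>High energy bounds and Liouville's theorem\<close>

lemma high_energy_tinv:
  obtains R C where "1 \<le> R" "0 \<le> C"
    and "\<And>k. 0 \<le> Im k \<Longrightarrow> R \<le> norm k \<Longrightarrow> invertible (ka V1 k) \<and> norm (tinv V1 k) \<le> C \<and> norm (tinv V1 k - mat 1) \<le> C / norm k"
proof -
  define c where "c = 2 * (hiC V1 * hiC (refl_pot V1)) + hiC V1 + hiC (refl_pot V1)"
  define N where "N = norm (mat 1 :: complex^'n^'n)"
  \<comment> \<open>norm k \<ge> 2 c gives norm (A - 1) \<le> 1/2, where
    \<open>norm_sub_one_half_inverse\<close> applies; the second maximum collects its two
    bounds.\<close>
  show ?thesis
  proof (rule that[of "max 1 (2 * c)" "max (2 * N) (2 * N * c)"])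
    show "0 \<le> max (2 * N) (2 * N * c)" by (simp add: N_def le_max_iff_disj)
    fix k assume k: "0 \<le> Im k" "max 1 (2 * c) \<le> norm k"
    then have k1: "1 \<le> norm k" and k0: "k \<noteq> 0" by auto
    have le: "norm (coefA V1 k - mat 1) \<le> c / norm k"
      unfolding c_def by (rule coefA_sub_one_le[OF herm1 V1 k(1) k1])
    have "c / norm k \<le> 1 / 2" using k(2) k1 by (simp add: divide_simps)
    with le have half: "norm (coefA V1 k - mat 1) \<le> 1 / 2" by linarith
    note inv = norm_sub_one_half_inverse[OF half]
    have t: "tinv V1 k = matrix_inv (coefA V1 k)"
      by (rule tinv_eq[OF herm1 V1 k(1) k0 inv(1)])
    have "invertible (ka V1 k)"
      using inv(1) k0 by (simp add: coefA_eq_ka[OF herm1 V1 k(1) k0] invertible_cscale_iff)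
    moreover have "norm (tinv V1 k) \<le> max (2 * N) (2 * N * c)"
      using inv(2) by (simp add: t N_def)
    moreover have "norm (tinv V1 k - mat 1) \<le> max (2 * N) (2 * N * c) / norm k"
    proof -
      have "norm (tinv V1 k - mat 1) \<le> 2 * N * norm (coefA V1 k - mat 1)"
        using inv(3) by (simp add: t N_def)
      also have "\<dots> \<le> 2 * N * (c / norm k)"
        using le by (intro mult_left_mono) (auto simp: N_def)
      also have "\<dots> = (2 * N * c) / norm k" by simp
      also have "\<dots> \<le> max (2 * N) (2 * N * c) / norm k"
        by (intro divide_right_mono) auto
      finally show ?thesis .
    qed
    ultimately show "invertible (ka V1 k) \<and> norm (tinv V1 k) \<le> max (2 * N) (2 * N * c)
        \<and> norm (tinv V1 k - mat 1) \<le> max (2 * N) (2 * N * c) / norm k"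
      by blast
  qed simp
qed

lemma tinv_V2: "- \<gamma> < Im k \<Longrightarrow> tinv V2 k = tinv V1 k"
  by (simp add: tinv_def ka_eq)

lemma high_energy_green_diff:
  obtains R C where "1 \<le> R"
    and "\<And>k. 0 \<le> Im k \<Longrightarrow> R \<le> norm k \<Longrightarrow> k \<in> regular \<and> norm (green_diff V1 V2 x k) \<le> C"
proof -
  obtain R C where R: "1 \<le> R" "0 \<le> C"
    and b: "\<And>k. 0 \<le> Im k \<Longrightarrow> R \<le> norm k \<Longrightarrow> invertible (ka V1 k) \<and> norm (tinv V1 k) \<le> C \<and> norm (tinv V1 k - mat 1) \<le> C / norm k"
    by (rule high_energy_tinv) blast
  define B where "B = hiC V1 * C * hiC (refl_pot V2) + hiC V2 * C * hiC (refl_pot V1)"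
  have \<gamma>: "0 < \<gamma>" using V1 by (simp add: decays_def)
  have g: "norm (green V W x k) \<le> hiC V * C * hiC (refl_pot W)"
    if V: "decays \<gamma> V" and W: "decays \<gamma> W" and k: "0 \<le> Im k" "R \<le> norm k" and t: "tinv V k = tinv V1 k"
    for V W :: "real \<Rightarrow> complex^'n^'n" and k
  proof -
    have k1: "1 \<le> norm k" "0 \<le> Im (- cnj k)" "1 \<le> norm (- cnj k)" using k R by auto
    have m: "norm (vm V k x) \<le> hiC V" "norm (vm (refl_pot W) (- cnj k) (- x)) \<le> hiC (refl_pot W)"
      by (rule high_energy_bounds(1)[OF V k(1) k1(1)], rule high_energy_bounds(1)[OF decays_refl_pot[OF W] k1(2,3)])
    have h: "0 \<le> hiC V" using m(1) norm_ge_zero order_trans by blast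
    have "norm (green V W x k) \<le> norm (vm V k x ** tinv V k) * norm (vm (refl_pot W) (- cnj k) (- x))"
      unfolding green_def by (rule order_trans[OF norm_matrix_mult_le]) simp
    also have "\<dots> \<le> (norm (vm V k x) * norm (tinv V k)) * norm (vm (refl_pot W) (- cnj k) (- x))"
      by (intro mult_right_mono norm_matrix_mult_le) auto
    also have "\<dots> \<le> (hiC V * C) * hiC (refl_pot W)"
      using m b[OF k] h R(2) unfolding t by (intro mult_mono) auto
    finally show ?thesis .
  qed
  show ?thesis
  proof (rule that[OF R(1), of B], intro conjI)
    fix k assume k: "0 \<le> Im k" "R \<le> norm k"
    then have l: "0 \<le> Im (- cnj k)" "R \<le> norm (- cnj k)" by auto
    show "k \<in> regular"
      using b[OF k] b[OF l] k \<gamma> by (simp add: regular_def)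
    have "norm (green_diff V1 V2 x k) \<le> norm (green V1 V2 x k) + norm (green V2 V1 x (- cnj k))"
      unfolding green_diff_def by (rule order_trans[OF norm_triangle_ineq4]) simp
    also have "\<dots> \<le> B"
      unfolding B_def by (intro add_mono g V1 V2 k l refl tinv_V2) (use k \<gamma> in auto)
    finally show "norm (green_diff V1 V2 x k) \<le> B" .
  qed
qed

text \<open>\<open>green_diff\<close> is holomorphic in the upper half-plane apart from the zeros of \<open>det A\<close>; all of
  these lie in the strip, where \<open>strip_diff\<close> continues it without poles. As \<open>strip_diff\<close> is odd,
  reflection yields a bounded odd entire function.\<close>

lemma green_diff_eq_0:
  assumes "\<gamma> \<le> Im k"
  shows "green_diff V1 V2 x k = 0"
proof -
  have \<gamma>: "0 < \<gamma>" using V1 by (simp add: decays_def)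
  \<comment> \<open>In the strip the pole-free function is taken as the definition, also at points
    where A is singular; below the strip the values are dictated by oddness.\<close>
  define F where "F = (\<lambda>k. if \<bar>Im k\<bar> < \<gamma> then strip_diff V1 V2 x k
     else if 0 < Im k then green_diff V1 V2 x k else - green_diff V1 V2 x (- k))"
  have odd: "F (- k) = - F k" for k
    using \<gamma> by (auto simp: F_def strip_diff_uminus)
  let ?S = "{k. \<bar>Im k\<bar> < \<gamma>}"
  define P where "P = regular \<inter> {k. 0 < Im k}"
  have "?S = half_plane \<gamma> \<inter> {k. Im k < \<gamma>}" by auto
  then have opS: "open ?S" by (simp add: open_Int open_halfspace_Im_gt open_halfspace_Im_lt)
  have opP: "open P" unfolding P_def by (intro open_Int open_regular open_halfspace_Im_gt)
  have opP': "open (uminus ` P)" using opP by (rule open_negations)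
  have FP: "F k = green_diff V1 V2 x k" if "k \<in> P" for k
    using that green_diff_eq_strip_diff[of k x] by (auto simp: F_def P_def)
  have mP: "mhol F P"
    by (rule mhol_cong[OF mhol_subset[OF mhol_green_diff[of x]]]) (auto simp: P_def FP)
  have mP': "mhol F (uminus ` P)"
  proof (rule mhol_cong)
    have "mhol (\<lambda>k. F (- k)) (uminus ` P)"
      by (rule mhol_compose[OF mP]) (auto intro!: holomorphic_intros)
    then show "mhol (\<lambda>k. (-1) \<odot> F (- k)) (uminus ` P)"
      by (intro mhol_cscale) auto
    show "(-1) \<odot> F (- k) = F k" for k
      using odd[of k] by (simp add: cs.minus_left)
  qed
  have mS: "mhol F ?S"
    by (rule mhol_cong[OF mhol_strip_diff[of x]]) (auto simp: F_def)
  \<comment> \<open>On and above the line Im k = \<gamma> every point is regular: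
    \<open>zeros\<close> covers the imaginary axis and \<open>invertible_coefA_off_axis\<close> the
    rest.\<close>
  have reg: "k \<in> P" if "\<gamma> \<le> Im k" for k
    using invertible_ka[OF that] invertible_ka[of "- cnj k"] that \<gamma> by (simp add: P_def regular_def)
  have "mhol F (?S \<union> P \<union> uminus ` P)"
    by (intro mhol_Un mS mP mP' open_Un opS opP opP')
  moreover have "?S \<union> P \<union> uminus ` P = UNIV"
  proof -
    have "k \<in> ?S \<union> P \<union> uminus ` P" for k
    proof -
      consider "\<bar>Im k\<bar> < \<gamma>" | "\<gamma> \<le> Im k" | "\<gamma> \<le> Im (- k)" by fastforce
      then show ?thesis
      proof cases
        case 3
        then have "- k \<in> P" by (rule reg)
        then have "k \<in> uminus ` P" by (intro image_eqI[of _ _ "- k"]) auto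
        then show ?thesis by blast
      qed (use reg in auto)
    qed
    then show ?thesis by blast
  qed
  ultimately have ent: "mhol F UNIV" by simp
  have "\<exists>B. \<forall>k. norm (F k) \<le> B"
  proof -
    obtain R C where R: "1 \<le> R"
      and C: "\<And>k. 0 \<le> Im k \<Longrightarrow> R \<le> norm k \<Longrightarrow> k \<in> regular \<and> norm (green_diff V1 V2 x k) \<le> C"
      by (rule high_energy_green_diff[of x]) blast
    have up: "norm (F k) \<le> C" if "0 \<le> Im k" "R \<le> norm k" for k
    proof -
      have "F k = green_diff V1 V2 x k"
        using C[OF that] that \<gamma> green_diff_eq_strip_diff[of k x] by (auto simp: F_def)
      then show ?thesis using C[OF that] by simp
    qed
    \<comment> \<open>Oddness carries the bound to the lower half-plane.\<close>
    have out: "norm (F k) \<le> C" if "R \<le> norm k" for k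
      using up[of k] up[of "- k"] that odd[of k] by (cases "0 \<le> Im k") auto
    have "compact (F ` cball 0 R)"
      by (intro compact_continuous_image continuous_on_subset[OF mhol_continuous[OF ent]]) auto
    then obtain B where B: "\<forall>y\<in>F ` cball 0 R. norm y \<le> B"
      using compact_imp_bounded bounded_iff by blast
    have "norm (F k) \<le> max B C" for k
      using B out[of k] by (cases "norm k \<le> R") (auto simp: max.coboundedI1 max.coboundedI2)
    then show ?thesis by blast
  qed
  then obtain B where B: "\<And>k. norm (F k) \<le> B" by blast
  have F0: "F k $ i $ j = 0" for k i j
  proof -
    have "norm (F k $ i $ j) \<le> B" for k
      using norm_matrix_le B by (rule order_trans)
    then have "bounded (range (\<lambda>k. F k $ i $ j))"
      by (intro boundedI[of _ B]) auto
    then have "(\<lambda>k. F k $ i $ j) constant_on UNIV"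
      by (intro Liouville_theorem mholD[OF ent])
    then have "F k $ i $ j = F 0 $ i $ j" by (auto simp: constant_on_def)
    \<comment> \<open>At k = 0 oddness reads F 0 = - F 0, which fixes the constant in Liouville's
      theorem.\<close>
    also have "\<dots> = 0"
      using odd[of 0] by (simp add: vec_eq_iff)
    finally show ?thesis .
  qed
  then have "F k = 0" by (simp add: vec_eq_iff)
  then show ?thesis using FP[OF reg[OF assms]] by simp
qed

section \<open>Recovery of the potential\<close>

lemma potentials_agree: "AE x in lebesgue. V1 x = V2 x"
proof -
  define k where "k = (\<lambda>n. \<i> * complex_of_real (real (Suc n)))"
  define c where "c = (\<lambda>n. complex_of_real (2 * real (Suc n)))"
  define X where "X = (\<lambda>n. tinv V1 (k n))"
  have \<gamma>: "0 < \<gamma>" using V1 by (simp add: decays_def)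
  have nk: "norm (k n) = real (Suc n)" for n
    by (simp add: k_def norm_mult del: of_nat_Suc)
  \<comment> \<open>On the imaginary axis k = - cnj k, so the vanishing of \<open>green_diff\<close>
    relates the two Green functions at one and the same point.\<close>
  have k: "- cnj (k n) = k n" "0 \<le> Im (k n)" "Im (k n) = real (Suc n)" for n
    by (simp_all add: k_def)
  note R1 = decays_refl_pot[OF V1] and R2 = decays_refl_pot[OF V2]
  have X1: "X \<longlonglongrightarrow> mat 1"
  proof -
    obtain R C where R: "\<And>k. 0 \<le> Im k \<Longrightarrow> R \<le> norm k \<Longrightarrow> norm (tinv V1 k - mat 1) \<le> C / norm k"
      by (rule high_energy_tinv) blast
    obtain N where N: "R \<le> real N" using real_arch_simple by blast
    have "(\<lambda>n. X n - mat 1) \<longlonglongrightarrow> 0"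
    proof (rule Lim_null_comparison)
      show "\<forall>\<^sub>F n in sequentially. norm (X n - mat 1) \<le> C / real (Suc n)"
      proof (rule eventually_sequentiallyI)
        fix n assume "N \<le> n"
        then have "R \<le> norm (k n)" using N nk[of n] by simp
        then show "norm (X n - mat 1) \<le> C / real (Suc n)"
          using R[OF k(2), of n] nk[of n] by (simp add: X_def)
      qed
      show "(\<lambda>n. C / real (Suc n)) \<longlonglongrightarrow> 0"
        by (rule LIMSEQ_Suc[OF lim_const_over_n])
    qed
    then show ?thesis by (rule Lim_null[THEN iffD2])
  qed
  then have X1': "(\<lambda>n. madj (X n)) \<longlonglongrightarrow> mat 1"
    using tendsto_madj[OF X1] by simp
  have lim1: "(\<lambda>n. vm V (k n) y) \<longlonglongrightarrow> mat 1" if V: "decays \<gamma> V" for V :: "real \<Rightarrow> complex^'n^'n" and y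
  proof (rule Lim_null[THEN iffD2], rule Lim_null_comparison)
    show "\<forall>\<^sub>F n in sequentially. norm (vm V (k n) y - mat 1) \<le> hiC V / real (Suc n)"
      using high_energy_bounds(3)[OF V k(2), of _ y] unfolding nk by (intro always_eventually allI) auto
    show "(\<lambda>n. hiC V / real (Suc n)) \<longlonglongrightarrow> 0"
      by (rule LIMSEQ_Suc[OF lim_const_over_n])
  qed
  have limc: "(\<lambda>n. c n \<odot> (vm V (k n) y - mat 1)) \<longlonglongrightarrow> (LINT t:{y..}|lebesgue. V t)" if V: "decays \<gamma> V"
    for V :: "real \<Rightarrow> complex^'n^'n" and y
    unfolding c_def k_def by (rule vm_imag_asymptotics[OF V])
  \<comment> \<open>Subtracting \<open>Z n\<close> removes the leading term before scaling by
    2\<kappa>; what survives are the first-order corrections of the two outer factors, since all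
    other factors tend to 1.\<close>
  have prod: "(\<lambda>n. c n \<odot> (vm V (k n) y ** Z n ** madj (vm W (k n) z) - Z n))
      \<longlonglongrightarrow> (LINT t:{y..}|lebesgue. V t) + madj (LINT t:{z..}|lebesgue. W t)"
    if V: "decays \<gamma> V" and W: "decays \<gamma> W" and Z: "Z \<longlonglongrightarrow> mat 1"
    for V W :: "real \<Rightarrow> complex^'n^'n" and y z and Z :: "nat \<Rightarrow> complex^'n^'n"
  proof -
    have e: "c n \<odot> (vm V (k n) y ** Z n ** madj (vm W (k n) z) - Z n)
      = (c n \<odot> (vm V (k n) y - mat 1)) ** Z n ** madj (vm W (k n) z) + Z n ** madj (c n \<odot> (vm W (k n) z - mat 1))" for n
    proof -
      have "madj (c n \<odot> (vm W (k n) z - mat 1)) = c n \<odot> (madj (vm W (k n) z) - mat 1)"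
        by (simp add: c_def madj_diff)
      then show ?thesis
        by (simp add: mm.diff_left mm.diff_right cs.diff_right)
    qed
    have "(\<lambda>n. (c n \<odot> (vm V (k n) y - mat 1)) ** Z n ** madj (vm W (k n) z) + Z n ** madj (c n \<odot> (vm W (k n) z - mat 1)))
      \<longlonglongrightarrow> (LINT t:{y..}|lebesgue. V t) ** mat 1 ** madj (mat 1) + mat 1 ** madj (LINT t:{z..}|lebesgue. W t)"
      by (intro tendsto_add mm.tendsto tendsto_madj limc lim1 V W Z)
    then show ?thesis unfolding e by simp
  qed
  define T1 where "T1 = (\<lambda>x. LINT t:{x..}|lebesgue. V1 t)"
  define T2 where "T2 = (\<lambda>x. LINT t:{x..}|lebesgue. V2 t)"
  define U1 where "U1 = (\<lambda>x. LINT t:{x..}|lebesgue. refl_pot V1 t)"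
  define U2 where "U2 = (\<lambda>x. LINT t:{x..}|lebesgue. refl_pot V2 t)"
  define L where "L = (\<lambda>x. (T1 x + madj (U2 (- x))) - (U1 (- x) + madj (T2 x)))"
  \<comment> \<open>Once Im (k n) \<ge> \<gamma>, the vanishing of \<open>green_diff\<close> cancels
    the products and leaves a sequence without x, whose limit is nevertheless \<open>L x\<close> for
    every x.\<close>
  have L: "(\<lambda>n. c n \<odot> (madj (X n) - X n)) \<longlonglongrightarrow> L x" for x
  proof -
    let ?l = "\<lambda>n. vm V1 (k n) x ** X n ** madj (vm (refl_pot V2) (k n) (- x))"
    let ?r = "\<lambda>n. vm (refl_pot V1) (k n) (- x) ** madj (X n) ** madj (vm V2 (k n) x)"
    obtain N where N: "\<gamma> \<le> real N" using real_arch_simple by blast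
    have 1: "(\<lambda>n. c n \<odot> (?l n - X n)
        - c n \<odot> (?r n - madj (X n))) \<longlonglongrightarrow> L x"
      unfolding L_def T1_def T2_def U1_def U2_def by (intro tendsto_diff prod V1 V2 R1 R2 X1 X1')
    have "\<forall>\<^sub>F n in sequentially. c n \<odot> (?l n - X n)
        - c n \<odot> (?r n - madj (X n))
        = c n \<odot> (madj (X n) - X n)"
    proof (rule eventually_sequentiallyI)
      fix n assume "N \<le> n"
      then have g: "\<gamma> \<le> Im (k n)" using N k(3)[of n] by simp
      have t: "tinv V2 (k n) = X n" using g \<gamma> by (simp add: X_def tinv_V2)
      have "?l n
          = ?r n"
        using green_diff_eq_0[OF g, of x] unfolding green_diff_def green_def k(1) t
        by (simp add: X_def madj_mult matrix_mul_assoc)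
      then show "c n \<odot> (?l n - X n)
        - c n \<odot> (?r n - madj (X n))
        = c n \<odot> (madj (X n) - X n)"
        by (simp add: cs.diff_right)
    qed
    from Lim_transform_eventually[OF 1 this] show ?thesis .
  qed
  have Lc: "L x = L y" for x y
    using LIMSEQ_unique[OF L[of x] L[of y]] .
  have si: "set_integrable lebesgue {x..} V" if "decays \<gamma> V" for V :: "real \<Rightarrow> complex^'n^'n" and x
    unfolding set_integrable_def by (intro integrable_mult_indicator decays_integrable[OF that]) auto
  \<comment> \<open>The tails to the right and to the left contribute equally, so this derivative of
    \<open>L\<close> is 2 (V2^H - V1).\<close>
  let ?f = "\<lambda>x. (- V1 x + madj (V2 x)) - (V1 x + madj (- V2 x))"
  have "prim L (\<lambda>x. (- V1 x + madj (- (- refl_pot V2 (- x)))) - (- (- refl_pot V1 (- x)) + madj (- V2 x)))"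
    unfolding L_def T1_def T2_def U1_def U2_def
    by (intro prim_diff prim_add prim_linear[OF bounded_linear_madj] prim_reflect[where u="\<lambda>x. LINT t:{x..}|lebesgue. refl_pot V t" for V]
        prim_tail si V1 V2 R1 R2)
  then have pL: "prim L ?f" by (simp add: refl_pot_def)
  have "AE x in lebesgue. ?f x = 0"
  proof (rule AE_zero_if_interval_integrals_zero)
    show "integrable lebesgue ?f"
      using decays_integrable[OF V1] decays_integrable[OF V2]
      by (intro Bochner_Integration.integrable_diff Bochner_Integration.integrable_add integrable_minus
          integrable_bounded_linear[OF bounded_linear_madj])
    show "integral {a..b} ?f = 0" if "a \<le> b" for a b
      using primD(3)[OF pL that] Lc[of b a] by simp
  qed
  then show ?thesis
    using herm2
  proof eventually_elim
    fix x assume "?f x = 0" and h: "madj (V2 x) = V2 x"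
    then have "2 *\<^sub>R (V2 x - V1 x) = 0"
      by (simp add: madj_minus scaleR_2 algebra_simps)
    then show "V1 x = V2 x" by simp
  qed
qed

end

section \<open>Reduction of the hypotheses to a common exponent\<close>

lemma admissible_decays:
  assumes "admissible_potential V"
  obtains \<gamma> where "decays \<gamma> V" "\<And>\<kappa>. \<gamma> \<le> \<kappa> \<Longrightarrow> det (coefA V (\<i> * complex_of_real \<kappa>)) \<noteq> 0"
proof -
  from assms obtain \<gamma> where g: "\<gamma> > 0"
    and int: "\<And>l s. integrable lebesgue (\<lambda>x. exp (2 * \<gamma> * \<bar>x\<bar>) *\<^sub>R (V x $ l $ s))"
    and z: "\<And>\<kappa>::real. \<kappa> > 0 \<Longrightarrow> det (coefA V (\<i> * complex_of_real \<kappa>)) = 0 \<Longrightarrow> \<kappa> < \<gamma>"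
    unfolding admissible_potential_def by blast
  \<comment> \<open>The matrix units: entrywise integrability is assembled into integrability of the
    matrix function.\<close>
  define D where "D = (\<lambda>l s. \<chi> i j. if i = l \<and> j = s then (1::complex) else 0 :: complex^'a^'a)"
  have "integrable lebesgue (\<lambda>x. \<Sum>l\<in>UNIV. \<Sum>s\<in>UNIV. (exp (2 * \<gamma> * \<bar>x\<bar>) *\<^sub>R (V x $ l $ s)) \<odot> D l s)"
    by (intro Bochner_Integration.integrable_sum integrable_bounded_linear[OF cs.bounded_linear_left] int)
  moreover have "(\<Sum>l\<in>UNIV. \<Sum>s\<in>UNIV. (exp (2 * \<gamma> * \<bar>x\<bar>) *\<^sub>R (V x $ l $ s)) \<odot> D l s) = exp (2 * \<gamma> * \<bar>x\<bar>) *\<^sub>R V x" for x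
  proof -
    have "(\<Sum>l\<in>UNIV. \<Sum>s\<in>UNIV. (M $ l $ s) \<odot> D l s) = M" for M
    proof -
      have "(\<Sum>l\<in>UNIV. \<Sum>s\<in>UNIV. (M $ l $ s) \<odot> D l s) $ i $ j = M $ i $ j" for i j
      proof -
        have "(\<Sum>l\<in>UNIV. \<Sum>s\<in>UNIV. (M $ l $ s) \<odot> D l s) $ i $ j = (\<Sum>l\<in>UNIV. \<Sum>s\<in>UNIV. if i = l then (if j = s then M $ l $ s else 0) else 0)"
          by (simp add: D_def) (intro sum.cong refl, auto)
        also have "\<dots> = (\<Sum>l\<in>UNIV. if i = l then (\<Sum>s\<in>UNIV. if j = s then M $ l $ s else 0) else 0)"
          by (intro sum.cong refl) auto
        finally show ?thesis by simp
      qed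
      then show ?thesis by (simp add: vec_eq_iff)
    qed
    from this[of "exp (2 * \<gamma> * \<bar>x\<bar>) *\<^sub>R V x"] show ?thesis by simp
  qed
  ultimately have "decays \<gamma> V" using g by (simp add: decays_def)
  moreover have "det (coefA V (\<i> * complex_of_real \<kappa>)) \<noteq> 0" if "\<gamma> \<le> \<kappa>" for \<kappa>
    using z[of \<kappa>] that g by auto
  ultimately show ?thesis by (rule that)
qed

lemma decays_mono:
  assumes "decays \<gamma> V" "0 < \<gamma>'" "\<gamma>' \<le> \<gamma>"
  shows "decays \<gamma>' V"
proof -
  have "integrable lebesgue (\<lambda>t. exp (2 * \<gamma>' * \<bar>t\<bar>) *\<^sub>R V t)"
  proof (rule Bochner_Integration.integrable_bound[OF decays_norm_integrable[OF assms(1)]])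
    show "(\<lambda>t. exp (2 * \<gamma>' * \<bar>t\<bar>) *\<^sub>R V t) \<in> borel_measurable lebesgue"
      by (intro borel_measurable_scaleR decays_measurable[OF assms(1)] borel_measurable_lebesgue_continuous continuous_intros)
    have "exp (2 * \<gamma>' * \<bar>t\<bar>) \<le> exp (2 * \<gamma> * \<bar>t\<bar>)" for t
      using assms(3) by (simp add: mult_right_mono)
    then show "AE t in lebesgue. norm (exp (2 * \<gamma>' * \<bar>t\<bar>) *\<^sub>R V t) \<le> norm (exp (2 * \<gamma> * \<bar>t\<bar>) * norm (V t))"
      by (intro AE_I2) (simp add: mult_right_mono)
  qed
  then show ?thesis using assms(2) by (simp add: decays_def)
qed

theorem theorem3p1:
  fixes V1 V2 :: "real \<Rightarrow> complex^'n^'n"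
  assumes "admissible_potential V1" and "admissible_potential V2"
    and "\<forall>k::real. k \<noteq> 0 \<longrightarrow>
           trans_plus V1 (complex_of_real k) = trans_plus V2 (complex_of_real k) \<and>
           refl_plus V1 (complex_of_real k) = refl_plus V2 (complex_of_real k) \<and>
           refl_minus V1 (complex_of_real k) = refl_minus V2 (complex_of_real k) \<and>
           trans_minus V1 (complex_of_real k) = trans_minus V2 (complex_of_real k)"
  shows "AE x in lebesgue. V1 x = V2 x"
proof -
  have herm: "hermitian V1" "hermitian V2"
    using assms(1,2) by (auto simp: admissible_potential_def)
  obtain \<gamma>1 where g1: "decays \<gamma>1 V1" "\<And>\<kappa>. \<gamma>1 \<le> \<kappa> \<Longrightarrow> det (coefA V1 (\<i> * complex_of_real \<kappa>)) \<noteq> 0"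
    using admissible_decays[OF assms(1)] by blast
  obtain \<gamma>2 where g2: "decays \<gamma>2 V2" "\<And>\<kappa>. \<gamma>2 \<le> \<kappa> \<Longrightarrow> det (coefA V2 (\<i> * complex_of_real \<kappa>)) \<noteq> 0"
    using admissible_decays[OF assms(2)] by blast
  have A: "coefA V1 k = coefA V2 k" if k: "k \<noteq> 0" for k :: real
  proof -
    have t: "matrix_inv (coefA V1 k) = matrix_inv (coefA V2 k)"
      using assms(3) k by (simp add: trans_plus_def)
    note i1 = matrix_inv_right_left[OF invertible_coefA_real[OF herm(1) g1(1) k]]
    note i2 = matrix_inv_right_left[OF invertible_coefA_real[OF herm(2) g2(1) k]]
    \<comment> \<open>\<open>matrix_inv\<close> is unspecified at singular matrices; A can be read
      off from \<open>trans_plus\<close> because it is invertible for real k.\<close>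
    have "coefA V1 k = matrix_inv (matrix_inv (coefA V1 k))"
      by (rule matrix_inv_unique[symmetric]) (rule i1)+
    also have "\<dots> = coefA V2 k"
      unfolding t by (rule matrix_inv_unique) (rule i2)+
    finally show ?thesis .
  qed
  have S: "refl_minus V1 k = refl_minus V2 k" if "k \<noteq> 0" for k :: real
    using assms(3) that by blast
  \<comment> \<open>The smaller exponent serves for the decay of both potentials by
    \<open>decays_mono\<close>. The potential it comes from takes the role of \<open>V1\<close> in
    \<open>potentials_agree\<close>, since the zeros of its determinant lie below that
    exponent.\<close>
  show ?thesis
  proof (cases "\<gamma>1 \<le> \<gamma>2")
    case True
    then have "decays \<gamma>1 V2"
      using g1(1) by (intro decays_mono[OF g2(1)]) (auto simp: decays_def)
    then show ?thesis
      using potentials_agree[OF herm g1(1) _ g1(2) A S] by blast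
  next
    case False
    then have "decays \<gamma>2 V1"
      using g2(1) by (intro decays_mono[OF g1(1)]) (auto simp: decays_def)
    then have "AE x in lebesgue. V2 x = V1 x"
      using potentials_agree[OF herm(2,1) g2(1) _ g2(2) A[symmetric] S[symmetric]] by blast
    then show ?thesis by eventually_elim simp
  qed
qed

end
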